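(* Let $\vartheta_n=\theta_2-\theta_1$ and assume that, as $n\to\infty$, $\vartheta_n\to0$ and $\sqrt n\,\vartheta_n/\sqrt{\log n}\to\infty$. Let $\hat k_0$ be the least squares change point estimator defined in the context, $\hat\tau_0=\hat k_0/n$, and let $\tilde\theta$ be a consistent estimator for $\theta_1$ or $\theta_2$. Then, as $n\to\infty$ with $n\Delta_n=T$, $$\frac{n\vartheta_n^2(\hat\tau_0-\tau_0)}{2\tilde\theta^2}\ \stackrel{d}{\to}\ \arg\max_v\left\{\mathcal W(v)-\frac{|v|}2\right\},$$ where $\mathcal W$ is a two-sided Brownian motion, i.e. $\mathcal W(u)=W_1(-u)$ for $u<0$ and $\mathcal W(u)=W_2(u)$ for $u\ge0$, with $W_1,W_2$ two independent standard Brownian motions on $[0,\infty)$, and the argmax is over $v\in\mathbb R$.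
   Context: $[x]$ denotes the integer part of $x$. Model: $X=\{X_t,0\le t\le T\}$ is a one-dimensional diffusion with state space $I=(l,r)$, $-\infty\le l\le r\le+\infty$, solving $dX_t=b(X_t)\,dt+\sqrt{\theta}\,\sigma(X_t)\,dW_t$, $X_0=x_0$, with $W$ a standard Brownian motion and $\theta=\theta_1 1_{\{t\le t^*\}}+\theta_2 1_{\{t>t^*\}}$, $t^*\in(0,T)$ unknown, where $\theta_1,\theta_2$ (which here depend on $n$) lie in a compact set $\Theta\subset(0,\infty)$; let $\theta_0$ denote the limiting value of both $\theta_1$ and $\theta_2$. Here $b:I\to\mathbb R$ and $\sigma:I\to(0,\infty)$ are known with continuous derivatives. With $s(x)=\exp\{-\int_{x_0}^x 2b(u)/\sigma^2(u)\,du\}$, it is assumed that $\lim_{x_1\to l}\int_{x_1}^x s(u)du=-\infty$ and $\lim_{x_2\to r}\int_x^{x_2}s(u)du=+\infty$ for $l<x_1<x<x_2<r$ (a condition imposed so that $X$ does not exit $I$). $X$ is observed at times $t_i=i\Delta_n$, $i=0,\dots,n$, with $T=n\Delta_n$ and $\Delta_n\to0$ as $n\to\infty$; write $X_i=X_{t_i}$, $W_i=W_{t_i}$. The change occurs at $t^*=k_0\Delta_n$, $k_0=[n\tau_0]$, with $\tau_0\in(0,1)$ fixed. One works under the Euler approximation $X_i=X_{i-1}+b(X_{i-1})\Delta_n+\sqrt{\theta}\,\sigma(X_{i-1})(W_i-W_{i-1})$ (with $\theta=\theta_1$ for $i\le k_0$ and $\theta=\theta_2$ for $i>k_0$), so that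 $$Z_i=\frac{X_i-X_{i-1}-b(X_{i-1})\Delta_n}{\sqrt{\Delta_n}\,\sigma(X_{i-1})}=\sqrt\theta\,\frac{W_i-W_{i-1}}{\sqrt{\Delta_n}},\qquad i=1,\dots,n,$$ are independent, $Z_i\sim N(0,\theta_1)$ for $i\le k_0$ and $Z_i\sim N(0,\theta_2)$ for $i>k_0$. The least squares estimator is $$\hat k_0=\arg\min_{1\le k\le n-1}\left\{\sum_{i=1}^k(Z_i^2-\bar\theta_1)^2+\sum_{i=k+1}^n(Z_i^2-\bar\theta_2)^2\right\},\quad \bar\theta_1=\frac1k\sum_{i=1}^kZ_i^2,\quad \bar\theta_2=\frac1{n-k}\sum_{i=k+1}^nZ_i^2;$$ equivalently $\hat k_0=\arg\max_k V_k^2$ with $V_k=\left(\frac{k(n-k)}{n^2}\right)^{1/2}(\bar\theta_2-\bar\theta_1)$. "$\tilde\theta$ is a consistent estimator for $\theta_1$ or $\theta_2$" means $\tilde\theta-\theta_j\to0$ in probability for $j=1$ or $j=2$.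
   Formalization: The scale condition at l is read as the integral of s from x to x_1 tending to minus infinity (as printed it is impossible, since s>0); b and σ>0 are extended arbitrarily outside I, since the Euler chain may leave I. *)

theory Defs
  imports "HOL-Probability.Probability"
begin

locale standard_brownian_motion = prob_space M for M :: "'a measure" +
  fixes W :: "real \<Rightarrow> 'a \<Rightarrow> real"
  assumes random_variable_W: "\<And>t. 0 \<le> t \<Longrightarrow> W t \<in> borel_measurable M"
    and start_zero: "AE \<omega> in M. W 0 \<omega> = 0"
    and indep_increments: "\<And>(t :: nat \<Rightarrow> real) m. 0 \<le> t 0 \<Longrightarrow> mono t \<Longrightarrow>
          indep_vars (\<lambda>_. borel) (\<lambda>i \<omega>. W (t (Suc i)) \<omega> - W (t i) \<omega>) {..<m}"
    and normal_increments: "\<And>s t. 0 \<le> s \<Longrightarrow> s < t \<Longrightarrow>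
          distributed M lborel (\<lambda>\<omega>. W t \<omega> - W s \<omega>) (normal_density 0 (sqrt (t - s)))"
    and continuous_paths: "AE \<omega> in M. continuous_on {0..} (\<lambda>t. W t \<omega>)"

text \<open>Independence of two processes indexed by \<open>[0,\<infinity>)\<close> is independence of the
  path-valued random variables with respect to the product \<open>\<sigma>\<close>-algebra.\<close>

definition indep_processes ::
    "'a measure \<Rightarrow> (real \<Rightarrow> 'a \<Rightarrow> real) \<Rightarrow> (real \<Rightarrow> 'a \<Rightarrow> real) \<Rightarrow> bool" where
  "indep_processes M W1 W2 \<longleftrightarrow>
     prob_space.indep_var M
       (Pi\<^sub>M {0..} (\<lambda>_. borel)) (\<lambda>\<omega>. \<lambda>t\<in>{0..}. W1 t \<omega>)
       (Pi\<^sub>M {0..} (\<lambda>_. borel)) (\<lambda>\<omega>. \<lambda>t\<in>{0..}. W2 t \<omega>)"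

definition two_sided ::
    "(real \<Rightarrow> 'a \<Rightarrow> real) \<Rightarrow> (real \<Rightarrow> 'a \<Rightarrow> real) \<Rightarrow> real \<Rightarrow> 'a \<Rightarrow> real" where
  "two_sided W1 W2 u \<omega> = (if u < 0 then W1 (- u) \<omega> else W2 u \<omega>)"

definition tendsto_zero_in_prob :: "'a measure \<Rightarrow> (nat \<Rightarrow> 'a \<Rightarrow> real) \<Rightarrow> bool" where
  "tendsto_zero_in_prob M Y \<longleftrightarrow>
     (\<forall>\<epsilon>>0. (\<lambda>n. measure M {\<omega> \<in> space M. \<bar>Y n \<omega>\<bar> > \<epsilon>}) \<longlonglongrightarrow> 0)"

definition scale_density :: "(real \<Rightarrow> real) \<Rightarrow> (real \<Rightarrow> real) \<Rightarrow> real \<Rightarrow> real \<Rightarrow> real" where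
  "scale_density b \<sigma> x\<^sub>0 x = exp (- (LBINT u=ereal x\<^sub>0..ereal x. 2 * b u / (\<sigma> u)\<^sup>2))"

text \<open>The coefficients live on the open interval \<open>(l,r)\<close>, but the Euler scheme has Gaussian
  increments and may leave it. So \<open>b\<close> and \<open>\<sigma>\<close> are total functions; outside \<open>(l,r)\<close> their values
  are arbitrary, except that \<open>\<sigma>\<close> remains positive so that the normalised increments make sense.
  Smoothness and non-explosion concern \<open>(l,r)\<close> only.

  Both scale integrals start at the interior point \<open>x\<close>; the one towards \<open>l\<close> is thus the signed
  integral from \<open>x\<close> down to \<open>y\<close>, which is negative and has to diverge to \<open>-\<infinity>\<close>.\<close>

definition diffusion_coefficients ::
    "ereal \<Rightarrow> ereal \<Rightarrow> real \<Rightarrow> (real \<Rightarrow> real) \<Rightarrow> (real \<Rightarrow> real) \<Rightarrow> bool" where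
  "diffusion_coefficients l r x\<^sub>0 b \<sigma> \<longleftrightarrow>
     x\<^sub>0 \<in> einterval l r \<and>
     b C1_differentiable_on einterval l r \<and>
     \<sigma> C1_differentiable_on einterval l r \<and>
     (\<forall>x. 0 < \<sigma> x) \<and>
     (\<forall>x \<in> einterval l r.
        filterlim (\<lambda>y. LBINT u=ereal x..y. scale_density b \<sigma> x\<^sub>0 u) at_bot (at_right l) \<and>
        filterlim (\<lambda>y. LBINT u=ereal x..y. scale_density b \<sigma> x\<^sub>0 u) at_top (at_left r))"

definition change_index :: "real \<Rightarrow> nat \<Rightarrow> nat" where
  "change_index \<tau> n = nat \<lfloor>real n * \<tau>\<rfloor>"

text \<open>The sequence \<open>x\<close> is the Euler scheme with step \<open>\<Delta>\<close> along the driving path \<open>w\<close>, with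
  variance parameter \<open>\<theta> i\<close> in the \<open>i\<close>-th step.\<close>

definition euler_scheme ::
    "(real \<Rightarrow> real) \<Rightarrow> (real \<Rightarrow> real) \<Rightarrow> real \<Rightarrow> real \<Rightarrow> (nat \<Rightarrow> real) \<Rightarrow> nat
      \<Rightarrow> (real \<Rightarrow> real) \<Rightarrow> (nat \<Rightarrow> real) \<Rightarrow> bool" where
  "euler_scheme b \<sigma> x\<^sub>0 \<Delta> \<theta> n w x \<longleftrightarrow>
     x 0 = x\<^sub>0 \<and>
     (\<forall>i\<in>{1..n}. x i = x (i - 1) + b (x (i - 1)) * \<Delta>
        + sqrt (\<theta> i) * \<sigma> (x (i - 1)) * (w (real i * \<Delta>) - w (real (i - 1) * \<Delta>)))"

definition normalised_increment ::
    "(real \<Rightarrow> real) \<Rightarrow> (real \<Rightarrow> real) \<Rightarrow> real \<Rightarrow> (nat \<Rightarrow> real) \<Rightarrow> nat \<Rightarrow> real" where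
  "normalised_increment b \<sigma> \<Delta> x i =
     (x i - x (i - 1) - b (x (i - 1)) * \<Delta>) / (sqrt \<Delta> * \<sigma> (x (i - 1)))"

definition theta_bar1 :: "(nat \<Rightarrow> real) \<Rightarrow> nat \<Rightarrow> real" where
  "theta_bar1 z k = (\<Sum>i=1..k. (z i)\<^sup>2) / real k"

definition theta_bar2 :: "(nat \<Rightarrow> real) \<Rightarrow> nat \<Rightarrow> nat \<Rightarrow> real" where
  "theta_bar2 z n k = (\<Sum>i=k+1..n. (z i)\<^sup>2) / real (n - k)"

definition sum_of_squares :: "(nat \<Rightarrow> real) \<Rightarrow> nat \<Rightarrow> nat \<Rightarrow> real" where
  "sum_of_squares z n k =
     (\<Sum>i=1..k. ((z i)\<^sup>2 - theta_bar1 z k)\<^sup>2) + (\<Sum>i=k+1..n. ((z i)\<^sup>2 - theta_bar2 z n k)\<^sup>2)"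

text \<open>Minimisers need not be unique, so being a least squares change point estimate is a
  predicate. The set of candidates is empty for \<open>n < 2\<close>.\<close>

definition least_squares_change_point :: "(nat \<Rightarrow> real) \<Rightarrow> nat \<Rightarrow> nat \<Rightarrow> bool" where
  "least_squares_change_point z n k \<longleftrightarrow>
     is_arg_min (sum_of_squares z n) (\<lambda>k. k \<in> {1..n - 1}) k"

end

theory Submission
  imports Defs
begin

text \<open>
  The squares \<open>Z\<^sub>i\<^sup>2 = \<theta>\<^sub>i \<xi>\<^sub>i\<^sup>2\<close> have means \<open>\<theta>\<^sub>i\<close> with a single jump of size \<open>\<delta> = \<theta>\<^sub>2 - \<theta>\<^sub>1\<close> at \<open>k\<^sub>0\<close>, and least
  squares maximises the absolute value of their normalised CUSUM statistic. Let \<open>N\<^sub>k\<close> be the partial sums of the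
  noise \<open>\<theta>\<^sub>i (\<xi>\<^sub>i\<^sup>2 - 1)\<close>. Chow's maximal inequality gives \<open>\<bar>N\<^sub>k\<bar> \<le> \<lambda> \<surd>k\<close> for all \<open>k\<close>, with \<open>\<lambda>\<close> of larger order
  than \<open>\<surd>ln n\<close> and smaller order than \<open>\<surd>n \<delta>\<close>. On this event the maximiser satisfies
  \<open>\<bar>N\<^sub>k - N\<^bsub>k\<^sub>0\<^esub>\<bar> \<ge> \<delta> \<bar>k - k\<^sub>0\<bar> / 16\<close>, which the same inequality makes unlikely for \<open>\<bar>k - k\<^sub>0\<bar>\<close> much larger than
  \<open>\<delta>\<^sup>-\<^sup>2\<close>. In that range the statistic is, up to scaling and a negligible error, \<open>N\<^bsub>k\<^sub>0\<^esub> - N\<^sub>k - \<delta> \<bar>k - k\<^sub>0\<bar> / 2\<close>.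

  No functional limit theorem is needed: time is cut into blocks of length proportional to \<open>\<delta>\<^sup>-\<^sup>2\<close>, the block sums
  converge jointly by the central limit theorem and Skorohod's representation, and fourth moments control the
  oscillation within a block. As the mesh tends to zero, the probability that the scaled estimator lies in a
  closed set is asymptotically at most the probability that the argmax of the limit process lies there. That argmax
  is unique because the maxima over two disjoint intervals differ by an independent Gaussian increment.
\<close>

section \<open>Maximal inequalities for sums of independent variables\<close>

text \<open>The constants come from matching variance and drift. Near the change each noise term has
  variance about 2 \<theta>0^2, while the statistic drifts down by \<delta> / 2 per step.
  Multiplication by \<delta> / (2 \<theta>0^2) turns the variance per step into \<delta>^2 / (2
  \<theta>0^2) and the drift into half of it: this is Brownian motion with drift -|v| / 2 once a
  step is given the length \<delta>^2 / (2 \<theta>0^2). Since the mesh is refined only after n has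
  tended to infinity, everything is finite dimensional for a fixed mesh. The estimator is not a grid
  point, so the limit sees only almost maximisers lying within a few cells of a closed set. Such
  events are closed, and weak convergence bounds their probabilities from above; that suffices,
  because closed half-lines in both directions determine convergence of the distribution function.
  The slack must vanish together with the mesh, and this is where uniqueness of the argmax
  enters.\<close>

lemma sets_Ex_less:
  "(\<And>k. k < n \<Longrightarrow> {x \<in> space M. P k x} \<in> sets M) \<Longrightarrow> {x \<in> space M. \<exists>k<n. P k x} \<in> sets M" for n :: nat
  using sets.sets_Collect_finite_Ex[of "{..<n}" M P] by (simp add: Bex_def)

lemma (in prob_space) indep_sets_reindex:
  assumes "inj_on f I" "indep_sets F (f ` I)"
  shows "indep_sets (\<lambda>i. F (f i)) I"
proof (rule indep_setsI)
  show "F (f i) \<subseteq> events" if "i \<in> I" for i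
    using assms(2) that by (auto simp: indep_sets_def)
  fix A J assume J: "J \<noteq> {}" "J \<subseteq> I" "finite J" "\<forall>j\<in>J. A j \<in> F (f j)"
  define g where "g = the_inv_into I f"
  have g: "g (f j) = j" if "j \<in> J" for j
    using that J assms(1) unfolding g_def by (intro the_inv_into_f_f) auto
  have inj: "inj_on f J" using assms(1) J(2) by (rule inj_on_subset)
  have "prob (\<Inter>j\<in>f ` J. A (g j)) = (\<Prod>j\<in>f ` J. prob (A (g j)))"
    using J g by (intro indep_setsD[OF assms(2)]) auto
  also have "(\<Inter>j\<in>f ` J. A (g j)) = (\<Inter>j\<in>J. A j)" using g by auto
  also have "(\<Prod>j\<in>f ` J. prob (A (g j))) = (\<Prod>j\<in>J. prob (A j))"
    using g inj by (simp add: prod.reindex)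
  finally show "prob (\<Inter>j\<in>J. A j) = (\<Prod>j\<in>J. prob (A j))" .
qed

lemma (in prob_space) indep_vars_reindex:
  assumes "inj_on f I" "indep_vars N X (f ` I)"
  shows "indep_vars (\<lambda>i. N (f i)) (\<lambda>i. X (f i)) I"
  using assms indep_sets_reindex[OF assms(1), of "\<lambda>i. {X i -` A \<inter> space M |A. A \<in> sets (N i)}"]
  by (simp add: indep_vars_def2)

text \<open>The numbers \<open>s\<close> and \<open>r\<close> are mere upper bounds, so
  \<open>s\<^sup>2 \<le> r\<close>, automatic for the exact moments of one variable, has to be
  assumed. It lets \<open>r\<close> alone bound the fourth moment of a sum.\<close>

locale indep_centred = prob_space M for M :: "'a measure" +
  fixes X :: "nat \<Rightarrow> 'a \<Rightarrow> real" and n :: nat and s r :: real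
  assumes indep: "indep_vars (\<lambda>_. borel) X {..<n}"
    and integrable4: "\<And>i. i < n \<Longrightarrow> integrable M (\<lambda>\<omega>. X i \<omega> ^ 4)"
    and mean0: "\<And>i. i < n \<Longrightarrow> expectation (X i) = 0"
    and second_moment: "\<And>i. i < n \<Longrightarrow> expectation (\<lambda>\<omega>. X i \<omega> ^ 2) \<le> s"
    and fourth_moment: "\<And>i. i < n \<Longrightarrow> expectation (\<lambda>\<omega>. X i \<omega> ^ 4) \<le> r"
    and moments_le: "s\<^sup>2 \<le> r" and s_nonneg: "0 \<le> s"
begin

definition S :: "nat \<Rightarrow> 'a \<Rightarrow> real" where
  "S k \<omega> = (\<Sum>i<k. X i \<omega>)"

lemma S_0 [simp]: "S 0 = (\<lambda>\<omega>. 0)" and S_Suc: "S (Suc k) \<omega> = S k \<omega> + X k \<omega>"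
  by (simp_all add: S_def fun_eq_iff)

lemma random_variable_X [measurable]: "i < n \<Longrightarrow> X i \<in> borel_measurable M"
  using indep by (auto simp: indep_vars_def2)

lemma random_variable_S: "k \<le> n \<Longrightarrow> S k \<in> borel_measurable M"
  unfolding S_def by (intro borel_measurable_sum random_variable_X) auto

lemma power_le_fourth:
  fixes x :: real assumes "j \<le> 4" shows "\<bar>x\<bar> ^ j \<le> 1 + x ^ 4"
proof (cases "\<bar>x\<bar> \<le> 1")
  case True
  then have "\<bar>x\<bar> ^ j \<le> 1" by (intro power_le_one) auto
  moreover have "0 \<le> x ^ 4" by simp
  ultimately show ?thesis by linarith
next
  case False
  then have "\<bar>x\<bar> ^ j \<le> \<bar>x\<bar> ^ 4" using assms by (intro power_increasing) auto
  then show ?thesis by (simp add: power_even_abs)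
qed

lemma integrable_power:
  assumes "Y \<in> borel_measurable M" "integrable M (\<lambda>\<omega>. Y \<omega> ^ 4 :: real)" "j \<le> 4"
  shows "integrable M (\<lambda>\<omega>. Y \<omega> ^ j)"
proof (rule Bochner_Integration.integrable_bound)
  show "integrable M (\<lambda>\<omega>. 1 + Y \<omega> ^ 4)" using assms by simp
  show "AE \<omega> in M. norm (Y \<omega> ^ j) \<le> norm (1 + Y \<omega> ^ 4)"
    using power_le_fourth[OF assms(3)] by (intro AE_I2) (auto simp: power_abs intro: order.trans[OF _ abs_ge_self])
qed (use assms in measurable)

lemma integrable_X_power: "i < n \<Longrightarrow> j \<le> 4 \<Longrightarrow> integrable M (\<lambda>\<omega>. X i \<omega> ^ j)"
  by (rule integrable_power[OF random_variable_X integrable4])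

text \<open>The martingale property without conditional expectations: a function of the first
  \<open>k\<close> variables is independent of \<open>X k\<close>.\<close>

lemma expectation_past_times_power:
  assumes k: "k < n" and g: "g \<in> borel_measurable (Pi\<^sub>M {..<k} (\<lambda>_. borel))"
    and int: "integrable M (\<lambda>\<omega>. g (\<lambda>i\<in>{..<k}. X i \<omega>))" and j: "j \<le> 4"
  shows "integrable M (\<lambda>\<omega>. g (\<lambda>i\<in>{..<k}. X i \<omega>) * X k \<omega> ^ j)"
    and "expectation (\<lambda>\<omega>. g (\<lambda>i\<in>{..<k}. X i \<omega>) * X k \<omega> ^ j)
      = expectation (\<lambda>\<omega>. g (\<lambda>i\<in>{..<k}. X i \<omega>)) * expectation (\<lambda>\<omega>. X k \<omega> ^ j)"
proof -
  have "indep_var (Pi\<^sub>M {..<k} (\<lambda>_. borel)) (\<lambda>\<omega>. \<lambda>i\<in>{..<k}. X i \<omega>)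
      (Pi\<^sub>M {k} (\<lambda>_. borel)) (\<lambda>\<omega>. \<lambda>i\<in>{k}. X i \<omega>)"
  proof (rule indep_var_restrict[OF indep])
    show "{..<k} \<inter> {k} = {}" "{..<k} \<subseteq> {..<n}" "{k} \<subseteq> {..<n}" using k by simp_all
  qed
  moreover have h: "(\<lambda>x. x k ^ j) \<in> borel_measurable (Pi\<^sub>M {k} (\<lambda>_. borel :: real measure))"
    by measurable
  ultimately have "indep_var borel (g \<circ> (\<lambda>\<omega>. \<lambda>i\<in>{..<k}. X i \<omega>)) borel ((\<lambda>x. x k ^ j) \<circ> (\<lambda>\<omega>. \<lambda>i\<in>{k}. X i \<omega>))"
    using indep_var_compose[OF _ g h] by blast
  then have ind: "indep_var borel (\<lambda>\<omega>. g (\<lambda>i\<in>{..<k}. X i \<omega>)) borel (\<lambda>\<omega>. X k \<omega> ^ j)"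
    by (simp add: o_def)
  show "integrable M (\<lambda>\<omega>. g (\<lambda>i\<in>{..<k}. X i \<omega>) * X k \<omega> ^ j)"
    by (rule indep_var_integrable[OF ind int integrable_X_power[OF k j]])
  show "expectation (\<lambda>\<omega>. g (\<lambda>i\<in>{..<k}. X i \<omega>) * X k \<omega> ^ j)
      = expectation (\<lambda>\<omega>. g (\<lambda>i\<in>{..<k}. X i \<omega>)) * expectation (\<lambda>\<omega>. X k \<omega> ^ j)"
    by (rule indep_var_lebesgue_integral[OF ind int integrable_X_power[OF k j]])
qed

lemma S_restrict: "(\<Sum>i<k. (\<lambda>i\<in>{..<k}. X i \<omega>) i) = S k \<omega>"
  by (simp add: S_def)

lemma integrable_S4: "k \<le> n \<Longrightarrow> integrable M (\<lambda>\<omega>. S k \<omega> ^ 4)"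
proof (induction k)
  case (Suc k)
  have "integrable M (\<lambda>\<omega>. 8 * (S k \<omega> ^ 4 + X k \<omega> ^ 4))"
    using Suc integrable4[of k] by auto
  then show ?case
  proof (rule Bochner_Integration.integrable_bound)
    show "(\<lambda>\<omega>. S (Suc k) \<omega> ^ 4) \<in> borel_measurable M"
      using random_variable_S[OF Suc.prems] by measurable
    have "(a + b) ^ 4 \<le> 8 * (a ^ 4 + b ^ 4)" for a b :: real
    proof -
      have "(a + b)\<^sup>2 \<le> 2 * (a\<^sup>2 + b\<^sup>2)"
        using sum_squares_bound[of a b] by (simp add: power2_sum)
      then have "((a + b)\<^sup>2)\<^sup>2 \<le> (2 * (a\<^sup>2 + b\<^sup>2))\<^sup>2"
        by (intro power_mono) auto
      also have "\<dots> \<le> 8 * ((a\<^sup>2)\<^sup>2 + (b\<^sup>2)\<^sup>2)"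
        using sum_squares_bound[of "a\<^sup>2" "b\<^sup>2"] by (simp add: power2_sum power_mult_distrib)
      finally show ?thesis by simp
    qed
    then show "AE \<omega> in M. norm (S (Suc k) \<omega> ^ 4) \<le> norm (8 * (S k \<omega> ^ 4 + X k \<omega> ^ 4))"
      by (intro AE_I2) (auto simp: S_Suc)
  qed
qed simp

lemma integrable_S_power: "k \<le> n \<Longrightarrow> j \<le> 4 \<Longrightarrow> integrable M (\<lambda>\<omega>. S k \<omega> ^ j)"
  by (rule integrable_power[OF random_variable_S integrable_S4])

lemma expectation_S_times:
  assumes "k < n" "i \<le> 4" "j \<le> 4"
  shows "integrable M (\<lambda>\<omega>. S k \<omega> ^ i * X k \<omega> ^ j)"
    and "expectation (\<lambda>\<omega>. S k \<omega> ^ i * X k \<omega> ^ j) = expectation (\<lambda>\<omega>. S k \<omega> ^ i) * expectation (\<lambda>\<omega>. X k \<omega> ^ j)"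
proof -
  have g: "(\<lambda>x. (\<Sum>i<k. x i) ^ i :: real) \<in> borel_measurable (Pi\<^sub>M {..<k} (\<lambda>_. borel))"
    by measurable
  note * = expectation_past_times_power[OF assms(1) g _ assms(3), unfolded S_restrict]
  show "integrable M (\<lambda>\<omega>. S k \<omega> ^ i * X k \<omega> ^ j)"
    and "expectation (\<lambda>\<omega>. S k \<omega> ^ i * X k \<omega> ^ j) = expectation (\<lambda>\<omega>. S k \<omega> ^ i) * expectation (\<lambda>\<omega>. X k \<omega> ^ j)"
    using * integrable_S_power[of k i] assms by auto
qed

lemma expectation_S: "k \<le> n \<Longrightarrow> expectation (S k) = 0"
  unfolding S_def using mean0 integrable_X_power[of _ 1]
  by (subst Bochner_Integration.integral_sum) auto

lemma expectation_S2_Suc: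
  assumes "k < n"
  shows "expectation (\<lambda>\<omega>. S (Suc k) \<omega> ^ 2) = expectation (\<lambda>\<omega>. S k \<omega> ^ 2) + expectation (\<lambda>\<omega>. X k \<omega> ^ 2)"
proof -
  have "expectation (\<lambda>\<omega>. S (Suc k) \<omega> ^ 2)
      = expectation (\<lambda>\<omega>. S k \<omega> ^ 2 + X k \<omega> ^ 2 + 2 * (S k \<omega> ^ 1 * X k \<omega> ^ 1))"
    by (simp add: S_Suc power2_sum mult.assoc)
  also have "\<dots> = expectation (\<lambda>\<omega>. S k \<omega> ^ 2) + expectation (\<lambda>\<omega>. X k \<omega> ^ 2)
      + 2 * (expectation (\<lambda>\<omega>. S k \<omega> ^ 1) * expectation (\<lambda>\<omega>. X k \<omega> ^ 1))"
    using assms integrable_S_power[of k 2] integrable_X_power[of k 2] expectation_S_times[of k 1 1]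
    by simp
  finally show ?thesis using mean0[OF assms] by simp
qed

lemma expectation_S2_le: "k \<le> n \<Longrightarrow> expectation (\<lambda>\<omega>. S k \<omega> ^ 2) \<le> s * k"
proof (induction k)
  case (Suc k)
  then show ?case using expectation_S2_Suc[of k] second_moment[of k] by (simp add: algebra_simps)
qed simp

text \<open>In the binomial expansion every term with a first power of \<open>S k\<close> or
  \<open>X k\<close> has mean 0. The rest adds at most 6 r k + r, which is below 3 r (2 k + 1), the
  increment of 3 r k^2.\<close>

lemma expectation_S4_le: "k \<le> n \<Longrightarrow> expectation (\<lambda>\<omega>. S k \<omega> ^ 4) \<le> 3 * r * (real k)\<^sup>2"
proof (induction k)
  case (Suc k)
  then have k: "k < n" by simp
  have eq: "(a + b) ^ 4 = a ^ 4 + 4 * (a ^ 3 * b ^ 1) + 6 * (a\<^sup>2 * b\<^sup>2) + 4 * (a ^ 1 * b ^ 3) + b ^ 4" for a b :: real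
    by algebra
  have "expectation (\<lambda>\<omega>. S (Suc k) \<omega> ^ 4) = expectation (\<lambda>\<omega>. S k \<omega> ^ 4 + 4 * (S k \<omega> ^ 3 * X k \<omega> ^ 1)
       + 6 * (S k \<omega> ^ 2 * X k \<omega> ^ 2) + 4 * (S k \<omega> ^ 1 * X k \<omega> ^ 3) + X k \<omega> ^ 4)"
    by (simp only: S_Suc eq)
  also have "\<dots> = expectation (\<lambda>\<omega>. S k \<omega> ^ 4) + 4 * (expectation (\<lambda>\<omega>. S k \<omega> ^ 3) * expectation (\<lambda>\<omega>. X k \<omega> ^ 1))
     + 6 * (expectation (\<lambda>\<omega>. S k \<omega> ^ 2) * expectation (\<lambda>\<omega>. X k \<omega> ^ 2))
     + 4 * (expectation (\<lambda>\<omega>. S k \<omega> ^ 1) * expectation (\<lambda>\<omega>. X k \<omega> ^ 3)) + expectation (\<lambda>\<omega>. X k \<omega> ^ 4)"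
    using k integrable_S_power[of k 4] integrable_X_power[of k 4] expectation_S_times[of k 3 1]
      expectation_S_times[of k 2 2] expectation_S_times[of k 1 3] by simp
  also have "\<dots> = expectation (\<lambda>\<omega>. S k \<omega> ^ 4) + 6 * (expectation (\<lambda>\<omega>. S k \<omega> ^ 2) * expectation (\<lambda>\<omega>. X k \<omega> ^ 2))
      + expectation (\<lambda>\<omega>. X k \<omega> ^ 4)"
    using k mean0[of k] expectation_S[of k] by simp
  also have "\<dots> \<le> 3 * r * (real k)\<^sup>2 + 6 * (s * k * s) + r"
    using Suc k fourth_moment[of k] second_moment[of k] expectation_S2_le[of k] s_nonneg
    by (intro add_mono mult_mono) auto
  also have "\<dots> \<le> 3 * r * (real k)\<^sup>2 + 6 * (r * k) + 3 * r"
  proof -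
    have "s * k * s \<le> r * k"
      using mult_right_mono[OF moments_le, of "real k"] by (simp add: power2_eq_square mult_ac)
    moreover have "0 \<le> r" using moments_le zero_le_power2[of s] by linarith
    ultimately show ?thesis by linarith
  qed
  also have "\<dots> = 3 * r * (real (Suc k))\<^sup>2"
    by (simp add: power2_eq_square algebra_simps)
  finally show ?case .
qed simp

text \<open>Convexity: the graph lies above its tangent. For \<open>p = 4\<close> the difference is
  an explicit nonnegative polynomial.\<close>

lemma power_tangent:
  fixes a b :: real assumes "p \<in> {2, 4}"
  shows "a ^ p + p * a ^ (p - 1) * b \<le> (a + b) ^ p"
proof -
  have "(a + b) ^ 4 - (a ^ 4 + 4 * a ^ 3 * b) = b\<^sup>2 * (2 * a\<^sup>2 + (2 * a + b)\<^sup>2)" by algebra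
  moreover have "\<dots> \<ge> 0" by simp
  ultimately show ?thesis using assms by (auto simp: power2_sum)
qed

text \<open>Even powers of a martingale form a submartingale; testing against indicators of past
  events replaces conditioning. The tangent at \<open>S k\<close> is used because its linear term is
  a function of the past times \<open>X k\<close> and so has mean 0.\<close>

lemma submartingale_step:
  assumes k: "k < n" and p: "p \<in> {2, 4}" and A: "A \<in> sets (Pi\<^sub>M {..<k} (\<lambda>_. borel))"
  shows "0 \<le> expectation (\<lambda>\<omega>. indicator A (\<lambda>i\<in>{..<k}. X i \<omega>) * (S (Suc k) \<omega> ^ p - S k \<omega> ^ p))"
proof -
  define g where "g x = indicator A x * (p * (\<Sum>i<k. x i) ^ (p - 1))" for x :: "nat \<Rightarrow> real"
  have g: "g \<in> borel_measurable (Pi\<^sub>M {..<k} (\<lambda>_. borel))"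
    unfolding g_def using A by measurable
  let ?R = "\<lambda>\<omega>. \<lambda>i\<in>{..<k}. X i \<omega>"
  have R: "?R \<in> measurable M (Pi\<^sub>M {..<k} (\<lambda>_. borel))"
    using k by (intro measurable_restrict random_variable_X) auto
  have p4: "p \<le> 4" using p by auto
  have gR: "g (?R \<omega>) = indicator A (?R \<omega>) * (p * S k \<omega> ^ (p - 1))" for \<omega>
    unfolding g_def S_restrict ..
  have indR: "(\<lambda>\<omega>. indicator A (?R \<omega>) :: real) \<in> borel_measurable M"
    using measurable_compose[OF R borel_measurable_indicator[OF A]] .
  have ind_int: "integrable M (\<lambda>\<omega>. indicator A (?R \<omega>) * f \<omega>)" if "integrable M f" for f :: "'a \<Rightarrow> real"
    using that by (rule Bochner_Integration.integrable_bound)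
      (use indR that in \<open>auto simp: indicator_def intro!: borel_measurable_times\<close>)
  have int: "integrable M (\<lambda>\<omega>. g (?R \<omega>))"
    unfolding gR using k p4 by (intro ind_int integrable_mult_right integrable_S_power) auto
  have "expectation (\<lambda>\<omega>. g (?R \<omega>) * X k \<omega> ^ 1) = 0" and I: "integrable M (\<lambda>\<omega>. g (?R \<omega>) * X k \<omega> ^ 1)"
    using expectation_past_times_power[OF k g int, of 1] mean0[OF k] by (simp_all only: power_one_right mult_zero_right)
  then have "0 = expectation (\<lambda>\<omega>. g (?R \<omega>) * X k \<omega> ^ 1)" by simp
  also have "\<dots> \<le> expectation (\<lambda>\<omega>. indicator A (?R \<omega>) * (S (Suc k) \<omega> ^ p - S k \<omega> ^ p))"
  proof (rule integral_mono[OF I])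
    show "integrable M (\<lambda>\<omega>. indicator A (?R \<omega>) * (S (Suc k) \<omega> ^ p - S k \<omega> ^ p))"
      using k p4 by (intro ind_int Bochner_Integration.integrable_diff integrable_S_power) auto
    fix \<omega>
    have "p * S k \<omega> ^ (p - 1) * X k \<omega> \<le> S (Suc k) \<omega> ^ p - S k \<omega> ^ p"
      using power_tangent[OF p, of "S k \<omega>" "X k \<omega>"] by (simp add: S_Suc)
    then have "indicator A (?R \<omega>) * (p * S k \<omega> ^ (p - 1) * X k \<omega>) \<le> indicator A (?R \<omega>) * (S (Suc k) \<omega> ^ p - S k \<omega> ^ p)"
      by (intro mult_left_mono) auto
    then show "g (?R \<omega>) * X k \<omega> ^ 1 \<le> indicator A (?R \<omega>) * (S (Suc k) \<omega> ^ p - S k \<omega> ^ p)"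
      by (simp add: gR mult_ac)
  qed
  finally show ?thesis .
qed

text \<open>For \<open>p = 2\<close> this is the Hajek-Renyi inequality; with \<open>p = 4\<close> and constant weights it bounds the oscillation of
  the sums strongly enough to survive a union bound over many short blocks.\<close>

theorem chow_maximal_inequality:
  fixes c :: "nat \<Rightarrow> real" and \<delta> :: real and p :: nat
  assumes p: "p \<in> {2, 4}" and c: "\<And>i. 0 \<le> c i" "decseq c" and m: "m \<le> n"
  shows "\<delta> * prob {\<omega> \<in> space M. \<exists>k<m. \<delta> \<le> c k * S (Suc k) \<omega> ^ p}
    \<le> (\<Sum>k<m. c k * (expectation (\<lambda>\<omega>. S (Suc k) \<omega> ^ p) - expectation (\<lambda>\<omega>. S k \<omega> ^ p)))"
proof -
  \<comment> \<open>\<open>D k\<close> says that the threshold was reached within the first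
    \<open>k\<close> steps. It depends on the past only, so \<open>submartingale_step\<close>
    applies to it.\<close>
  define D where "D k = {\<omega> \<in> space M. \<exists>i<k. \<delta> \<le> c i * S (Suc i) \<omega> ^ p}" for k
  have p4: "p \<le> 4" "even p" using p by auto
  have D: "D k \<in> events" if "k \<le> n" for k
    unfolding D_def using that
    by (intro sets_Ex_less borel_measurable_le borel_measurable_times borel_measurable_power
        borel_measurable_const random_variable_S) simp
  have step: "expectation (\<lambda>\<omega>. indicator (space M - D k) \<omega> * (S (Suc k) \<omega> ^ p - S k \<omega> ^ p))
      \<le> expectation (\<lambda>\<omega>. S (Suc k) \<omega> ^ p) - expectation (\<lambda>\<omega>. S k \<omega> ^ p)" if k: "k < n" for k
  proof -
    define A where "A = {x \<in> space (Pi\<^sub>M {..<k} (\<lambda>_. borel)). \<exists>i<k. \<delta> \<le> c i * (\<Sum>j<Suc i. x j) ^ p}"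
    have A: "A \<in> sets (Pi\<^sub>M {..<k} (\<lambda>_. borel))"
      unfolding A_def
      by (intro sets_Ex_less borel_measurable_le borel_measurable_times borel_measurable_power
          borel_measurable_const borel_measurable_sum measurable_component_singleton) auto
    have eq: "indicator A (\<lambda>i\<in>{..<k}. X i \<omega>) = (indicator (D k) \<omega> :: real)" if "\<omega> \<in> space M" for \<omega>
    proof -
      define x where "x = (\<lambda>i\<in>{..<k}. X i \<omega>)"
      have "(\<Sum>j<Suc i. x j) = S (Suc i) \<omega>" if "i < k" for i
        using that unfolding S_def x_def by (intro sum.cong) auto
      moreover have "x \<in> space (Pi\<^sub>M {..<k} (\<lambda>_. borel))"
        by (simp add: x_def space_PiM)
      ultimately have "x \<in> A \<longleftrightarrow> \<omega> \<in> D k"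
        using that unfolding A_def D_def mem_Collect_eq by metis
      then show ?thesis by (simp add: indicator_def x_def)
    qed
    have int: "integrable M (\<lambda>\<omega>. S (Suc k) \<omega> ^ p - S k \<omega> ^ p)"
      using k p4 by (intro Bochner_Integration.integrable_diff integrable_S_power) auto
    have int': "integrable M (\<lambda>\<omega>. indicator B \<omega> * (S (Suc k) \<omega> ^ p - S k \<omega> ^ p))" if "B \<in> events" for B
      using integrable_mult_indicator[OF that int] by simp
    have "0 \<le> expectation (\<lambda>\<omega>. indicator A (\<lambda>i\<in>{..<k}. X i \<omega>) * (S (Suc k) \<omega> ^ p - S k \<omega> ^ p))"
      by (rule submartingale_step[OF k p A])
    also have "\<dots> = expectation (\<lambda>\<omega>. indicator (D k) \<omega> * (S (Suc k) \<omega> ^ p - S k \<omega> ^ p))"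
      by (intro Bochner_Integration.integral_cong) (auto simp: eq)
    finally have "expectation (\<lambda>\<omega>. indicator (space M - D k) \<omega> * (S (Suc k) \<omega> ^ p - S k \<omega> ^ p))
      \<le> expectation (\<lambda>\<omega>. indicator (space M - D k) \<omega> * (S (Suc k) \<omega> ^ p - S k \<omega> ^ p))
        + expectation (\<lambda>\<omega>. indicator (D k) \<omega> * (S (Suc k) \<omega> ^ p - S k \<omega> ^ p))" by simp
    also have "\<dots> = expectation (\<lambda>\<omega>. indicator (space M - D k) \<omega> * (S (Suc k) \<omega> ^ p - S k \<omega> ^ p)
        + indicator (D k) \<omega> * (S (Suc k) \<omega> ^ p - S k \<omega> ^ p))"
      using k D[of k] by (intro Bochner_Integration.integral_add[symmetric] int') auto
    also have "\<dots> = expectation (\<lambda>\<omega>. S (Suc k) \<omega> ^ p - S k \<omega> ^ p)"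
      by (intro Bochner_Integration.integral_cong) (auto simp: indicator_def)
    also have "\<dots> = expectation (\<lambda>\<omega>. S (Suc k) \<omega> ^ p) - expectation (\<lambda>\<omega>. S k \<omega> ^ p)"
      using k p4 by (intro Bochner_Integration.integral_diff integrable_S_power) auto
    finally show ?thesis .
  qed
  have ind_int: "integrable M (\<lambda>\<omega>. indicator B \<omega> * S k \<omega> ^ p)" if "B \<in> events" "k \<le> n" for B k
    using integrable_mult_indicator[OF that(1) integrable_S_power[OF that(2) p4(1)]] by simp
  \<comment> \<open>The second summand makes the induction close: it keeps the mass of
    \<open>S m ^ p\<close> where the threshold has not yet been reached, to be spent on later hits.
    For \<open>m = 0\<close> the truncated index \<open>m - 1\<close> is harmless, since
    \<open>S 0\<close> vanishes.\<close>
  have "\<delta> * prob (D m) + c (m - 1) * expectation (\<lambda>\<omega>. indicator (space M - D m) \<omega> * S m \<omega> ^ p)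
     \<le> (\<Sum>k<m. c k * (expectation (\<lambda>\<omega>. S (Suc k) \<omega> ^ p) - expectation (\<lambda>\<omega>. S k \<omega> ^ p)))"
    using m
  proof (induction m)
    case 0
    then show ?case using p by (auto simp: D_def)
  next
    case (Suc m)
    then have m: "m < n" by simp
    let ?e = "\<lambda>B k. expectation (\<lambda>\<omega>. indicator B \<omega> * S k \<omega> ^ p)"
    let ?B = "\<lambda>k. space M - D k"
    have sub: "D m \<subseteq> D (Suc m)" by (auto simp: D_def less_Suc_eq)
    have "\<delta> * prob (D (Suc m) - D m) = expectation (\<lambda>\<omega>. \<delta> * indicator (D (Suc m) - D m) \<omega>)"
      using m D[of m] D[of "Suc m"] by simp
    also have "\<dots> \<le> expectation (\<lambda>\<omega>. c m * (indicator (D (Suc m) - D m) \<omega> * S (Suc m) \<omega> ^ p))"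
    proof (rule integral_mono)
      show "integrable M (\<lambda>\<omega>. c m * (indicator (D (Suc m) - D m) \<omega> * S (Suc m) \<omega> ^ p))"
        using m by (intro integrable_mult_right ind_int sets.Diff D) auto
      show "\<delta> * indicator (D (Suc m) - D m) \<omega> \<le> c m * (indicator (D (Suc m) - D m) \<omega> * S (Suc m) \<omega> ^ p)" for \<omega>
        by (auto simp: indicator_def D_def less_Suc_eq)
      show "integrable M (\<lambda>\<omega>. \<delta> * indicator (D (Suc m) - D m) \<omega>)"
        using m D[of m] D[of "Suc m"]
        by (intro integrable_mult_right integrable_real_indicator) (auto simp: emeasure_eq_measure)
    qed
    also have "\<dots> = c m * (?e (?B m) (Suc m) - ?e (?B (Suc m)) (Suc m))"
    proof -
      have "?e (?B m) (Suc m) - ?e (?B (Suc m)) (Suc m)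
         = expectation (\<lambda>\<omega>. indicator (?B m) \<omega> * S (Suc m) \<omega> ^ p - indicator (?B (Suc m)) \<omega> * S (Suc m) \<omega> ^ p)"
        using m by (intro Bochner_Integration.integral_diff[symmetric] ind_int sets.Diff D) auto
      also have "\<dots> = ?e (D (Suc m) - D m) (Suc m)"
        using sub sets.sets_into_space[OF D[of "Suc m"]] m
        by (intro Bochner_Integration.integral_cong) (auto simp: indicator_def)
      finally show ?thesis by simp
    qed
    finally have 1: "\<delta> * prob (D (Suc m) - D m) \<le> c m * (?e (?B m) (Suc m) - ?e (?B (Suc m)) (Suc m))" .
    have 2: "?e (?B m) (Suc m) - ?e (?B m) m \<le> expectation (\<lambda>\<omega>. S (Suc m) \<omega> ^ p) - expectation (\<lambda>\<omega>. S m \<omega> ^ p)"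
    proof -
      have "?e (?B m) (Suc m) - ?e (?B m) m = expectation (\<lambda>\<omega>. indicator (?B m) \<omega> * (S (Suc m) \<omega> ^ p - S m \<omega> ^ p))"
        using m D[of m]
        by (subst Bochner_Integration.integral_diff[symmetric]) (auto intro!: ind_int simp: right_diff_distrib)
      then show ?thesis using step[OF m] by simp
    qed
    \<comment> \<open>Monotonicity of the weights enters here: the retained mass is reweighted from
      \<open>c (m - 1)\<close> to \<open>c m\<close>.\<close>
    have 3: "c m * ?e (?B m) m \<le> c (m - 1) * ?e (?B m) m"
      using c(2) p4 by (intro mult_right_mono Bochner_Integration.integral_nonneg) (auto simp: decseq_def)
    have 4: "prob (D (Suc m)) = prob (D m) + prob (D (Suc m) - D m)"
      using finite_measure_Diff[OF D[of "Suc m"] D[of m] sub] m by simp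
    have "c m * (?e (?B m) (Suc m) - ?e (?B m) m)
        \<le> c m * (expectation (\<lambda>\<omega>. S (Suc m) \<omega> ^ p) - expectation (\<lambda>\<omega>. S m \<omega> ^ p))"
      using 2 c by (intro mult_left_mono) auto
    moreover have "\<delta> * prob (D m) + c (m - 1) * ?e (?B m) m
        \<le> (\<Sum>k<m. c k * (expectation (\<lambda>\<omega>. S (Suc k) \<omega> ^ p) - expectation (\<lambda>\<omega>. S k \<omega> ^ p)))"
      using Suc by simp
    ultimately show ?case
      using 1 3 unfolding 4 distrib_left right_diff_distrib sum.lessThan_Suc diff_Suc_1 by linarith
  qed
  moreover have "0 \<le> c (m - 1) * expectation (\<lambda>\<omega>. indicator (space M - D m) \<omega> * S m \<omega> ^ p)"
    using c p4 by (intro mult_nonneg_nonneg Bochner_Integration.integral_nonneg) auto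
  ultimately show ?thesis unfolding D_def by linarith
qed

section \<open>Maximal bounds for three choices of the weights\<close>

lemma sum_inverse_le_ln: "0 < m \<Longrightarrow> (\<Sum>k<m. 1 / real (Suc k)) \<le> 1 + ln (real m)"
proof (induction m)
  case (Suc m)
  show ?case
  proof (cases "m = 0")
    case False
    then have "ln (real m / real (Suc m)) \<le> real m / real (Suc m) - 1"
      by (intro ln_le_minus_one) auto
    also have "\<dots> = - (1 / real (Suc m))" by (simp add: field_simps)
    finally have "1 / real (Suc m) \<le> ln (real (Suc m)) - ln (real m)"
      using False by (simp add: ln_div)
    with Suc False show ?thesis by simp
  qed simp
qed simp

text \<open>The terms up to \<open>m\<close> contribute 1 / m, and the tail at most another 1 / m by
  comparison with a telescoping sum. Freezing the weights below \<open>m\<close> keeps them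
  decreasing from the start.\<close>

lemma sum_inverse_square_le:
  assumes "0 < m"
  shows "(\<Sum>k<j. 1 / (real (max m (Suc k)))\<^sup>2) \<le> 2 / real m"
proof -
  have "(\<Sum>k<m + i. 1 / (real (max m (Suc k)))\<^sup>2) \<le> 2 / real m - 1 / real (m + i)" for i
  proof (induction i)
    case 0
    have "(\<Sum>k<m. 1 / (real (max m (Suc k)))\<^sup>2) = (\<Sum>k<m. 1 / (real m)\<^sup>2)"
      by (intro sum.cong) (auto simp: max_def)
    then show ?case using assms by (simp add: power2_eq_square field_simps)
  next
    case (Suc i)
    have "1 / (real (m + Suc i))\<^sup>2 \<le> 1 / (real (m + i) * real (m + Suc i))"
      using assms unfolding power2_eq_square by (intro divide_left_mono mult_right_mono mult_pos_pos) auto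
    also have "\<dots> = 1 / real (m + i) - 1 / real (m + Suc i)"
      using assms by (simp add: field_simps)
    finally show ?case using Suc by (simp add: max_def)
  qed
  note * = this[of j]
  have "(\<Sum>k<j. 1 / (real (max m (Suc k)))\<^sup>2) \<le> (\<Sum>k<m + j. 1 / (real (max m (Suc k)))\<^sup>2)"
    by (intro sum_mono2) auto
  also have "\<dots> \<le> 2 / real m" using * by (simp add: order_trans[OF *])
  finally show ?thesis .
qed

lemma expectation_S2_increment_le:
  "k < n \<Longrightarrow> expectation (\<lambda>\<omega>. S (Suc k) \<omega> ^ 2) - expectation (\<lambda>\<omega>. S k \<omega> ^ 2) \<le> s"
  using expectation_S2_Suc second_moment by simp

text \<open>The weights 1 / k sum to a logarithm; this is the source of the logarithm in the rate
  condition on the jump.\<close>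

lemma prob_max_S_sqrt_le:
  assumes "0 < \<delta>" "0 < n"
  shows "prob {\<omega> \<in> space M. \<exists>k<n. \<delta> * sqrt (Suc k) \<le> \<bar>S (Suc k) \<omega>\<bar>} \<le> s * (1 + ln n) / \<delta>\<^sup>2"
proof -
  have eq: "\<delta> * sqrt (Suc k) \<le> \<bar>x\<bar> \<longleftrightarrow> \<delta>\<^sup>2 \<le> 1 / real (Suc k) * x\<^sup>2" for k and x :: real
  proof -
    have "\<delta> * sqrt (Suc k) \<le> \<bar>x\<bar> \<longleftrightarrow> (\<delta> * sqrt (Suc k))\<^sup>2 \<le> \<bar>x\<bar>\<^sup>2"
      using assms abs_le_square_iff[of "\<delta> * sqrt (Suc k)" "\<bar>x\<bar>"] by simp
    then show ?thesis by (simp add: power_mult_distrib field_simps del: of_nat_Suc)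
  qed
  have "\<delta>\<^sup>2 * prob {\<omega> \<in> space M. \<exists>k<n. \<delta>\<^sup>2 \<le> 1 / real (Suc k) * S (Suc k) \<omega> ^ 2}
    \<le> (\<Sum>k<n. 1 / real (Suc k) * (expectation (\<lambda>\<omega>. S (Suc k) \<omega> ^ 2) - expectation (\<lambda>\<omega>. S k \<omega> ^ 2)))"
    by (rule chow_maximal_inequality) (auto simp: decseq_def frac_le)
  also have "\<dots> \<le> (\<Sum>k<n. 1 / real (Suc k) * s)"
    by (intro sum_mono mult_left_mono expectation_S2_increment_le) auto
  also have "\<dots> = s * (\<Sum>k<n. 1 / real (Suc k))" by (simp add: sum_distrib_left)
  also have "\<dots> \<le> s * (1 + ln n)"
    using sum_inverse_le_ln assms s_nonneg by (intro mult_left_mono) auto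
  finally show ?thesis unfolding eq using assms by (simp add: field_simps)
qed

text \<open>The squared weights are summable, so the bound does not depend on \<open>n\<close>.
  Hence it serves both for the distance of the estimator from the change and for the growth of
  Brownian motion over unbounded time.\<close>

lemma prob_S_linear_le:
  fixes \<delta> :: real
  assumes "0 < \<delta>" "0 < m"
  shows "prob {\<omega> \<in> space M. \<exists>k<n. m \<le> Suc k \<and> \<delta> * Suc k \<le> \<bar>S (Suc k) \<omega>\<bar>} \<le> 2 * s / (m * \<delta>\<^sup>2)"
proof -
  let ?c = "\<lambda>k. 1 / (real (max m (Suc k)))\<^sup>2"
  have sub: "{\<omega> \<in> space M. \<exists>k<n. m \<le> Suc k \<and> \<delta> * Suc k \<le> \<bar>S (Suc k) \<omega>\<bar>}
      \<subseteq> {\<omega> \<in> space M. \<exists>k<n. \<delta>\<^sup>2 \<le> ?c k * S (Suc k) \<omega> ^ 2}"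
  proof safe
    fix \<omega> k assume k: "k < n" "m \<le> Suc k" "\<delta> * Suc k \<le> \<bar>S (Suc k) \<omega>\<bar>"
    then have "(\<delta> * Suc k)\<^sup>2 \<le> \<bar>S (Suc k) \<omega>\<bar>\<^sup>2" using assms by (intro power_mono) auto
    then have "\<delta>\<^sup>2 \<le> ?c k * S (Suc k) \<omega> ^ 2"
      using k by (simp add: max_absorb2 power_mult_distrib pos_le_divide_eq del: of_nat_Suc)
    then show "\<exists>k<n. \<delta>\<^sup>2 \<le> ?c k * S (Suc k) \<omega> ^ 2" using k by blast
  qed
  have meas: "{\<omega> \<in> space M. \<exists>k<n. \<delta>\<^sup>2 \<le> ?c k * S (Suc k) \<omega> ^ 2} \<in> events"
    by (intro sets_Ex_less borel_measurable_le borel_measurable_times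
        borel_measurable_power borel_measurable_const random_variable_S) auto
  have "\<delta>\<^sup>2 * prob {\<omega> \<in> space M. \<exists>k<n. m \<le> Suc k \<and> \<delta> * Suc k \<le> \<bar>S (Suc k) \<omega>\<bar>}
      \<le> \<delta>\<^sup>2 * prob {\<omega> \<in> space M. \<exists>k<n. \<delta>\<^sup>2 \<le> ?c k * S (Suc k) \<omega> ^ 2}"
    using finite_measure_mono[OF sub meas] by (intro mult_left_mono) auto
  also have "\<dots> \<le> (\<Sum>k<n. ?c k * (expectation (\<lambda>\<omega>. S (Suc k) \<omega> ^ 2) - expectation (\<lambda>\<omega>. S k \<omega> ^ 2)))"
    using assms by (intro chow_maximal_inequality) (auto simp: decseq_def intro!: frac_le power_mono)
  also have "\<dots> \<le> (\<Sum>k<n. ?c k * s)"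
    by (intro sum_mono mult_left_mono expectation_S2_increment_le) auto
  also have "\<dots> = s * (\<Sum>k<n. ?c k)" by (simp add: sum_distrib_left)
  also have "\<dots> \<le> s * (2 / m)"
    using sum_inverse_square_le assms s_nonneg by (intro mult_left_mono) auto
  finally show ?thesis using assms by (simp add: field_simps)
qed

lemma prob_max_S_le:
  assumes "0 < \<delta>"
  shows "prob {\<omega> \<in> space M. \<exists>k<n. \<delta> \<le> \<bar>S (Suc k) \<omega>\<bar>} \<le> 3 * r * (real n)\<^sup>2 / \<delta> ^ 4"
proof -
  have eq: "\<delta> \<le> \<bar>x\<bar> \<longleftrightarrow> \<delta> ^ 4 \<le> 1 * x ^ 4" for x :: real
    using assms power_mono_iff[of \<delta> "\<bar>x\<bar>" 4] by (simp add: power_even_abs)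
  have "\<delta> ^ 4 * prob {\<omega> \<in> space M. \<exists>k<n. \<delta> ^ 4 \<le> 1 * S (Suc k) \<omega> ^ 4}
    \<le> (\<Sum>k<n. 1 * (expectation (\<lambda>\<omega>. S (Suc k) \<omega> ^ 4) - expectation (\<lambda>\<omega>. S k \<omega> ^ 4)))"
    by (rule chow_maximal_inequality) auto
  also have "\<dots> = expectation (\<lambda>\<omega>. S n \<omega> ^ 4)"
    using sum_lessThan_telescope[of "\<lambda>k. expectation (\<lambda>\<omega>. S k \<omega> ^ 4)" n] by simp
  also have "\<dots> \<le> 3 * r * (real n)\<^sup>2" by (rule expectation_S4_le) simp
  finally show ?thesis unfolding eq using assms by (simp add: field_simps)
qed

text \<open>Provides time reversal and restriction to blocks.\<close>

lemma reindexed: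
  assumes "inj_on f {..<m}" "f ` {..<m} \<subseteq> {..<n}"
  shows "indep_centred M (\<lambda>i. X (f i)) m s r"
proof
  show "indep_vars (\<lambda>_. borel) (\<lambda>i. X (f i)) {..<m}"
    using assms(1) indep_vars_subset[OF indep assms(2)] by (rule indep_vars_reindex)
qed (use assms moments_le s_nonneg in \<open>auto intro: integrable4 mean0 second_moment fourth_moment\<close>)

end

section \<open>The CUSUM statistic near and far from the change point\<close>

lemma abs_add_le: "\<bar>x\<bar> \<le> p \<Longrightarrow> \<bar>y\<bar> \<le> q \<Longrightarrow> \<bar>x + y\<bar> \<le> p + q"
  and abs_diff_le: "\<bar>x\<bar> \<le> p \<Longrightarrow> \<bar>y\<bar> \<le> q \<Longrightarrow> \<bar>x - y\<bar> \<le> p + q" for x y p q :: real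
  by linarith+

section \<open>Least squares as maximisation of the CUSUM statistic\<close>

lemma sum_squared_deviations:
  fixes y :: "'i \<Rightarrow> real" assumes "finite A" "A \<noteq> {}"
  shows "(\<Sum>i\<in>A. (y i - (\<Sum>i\<in>A. y i) / card A)\<^sup>2) = (\<Sum>i\<in>A. (y i)\<^sup>2) - (\<Sum>i\<in>A. y i)\<^sup>2 / card A"
proof -
  define m where "m = (\<Sum>i\<in>A. y i) / card A"
  have "(\<Sum>i\<in>A. (y i - m)\<^sup>2) = (\<Sum>i\<in>A. (y i)\<^sup>2) - 2 * m * (\<Sum>i\<in>A. y i) + card A * m\<^sup>2"
    unfolding power2_diff sum.distrib sum_subtractf
    by (simp flip: sum_distrib_left sum_distrib_right)
  also have "\<dots> = (\<Sum>i\<in>A. (y i)\<^sup>2) - (\<Sum>i\<in>A. y i)\<^sup>2 / card A"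
    using assms by (simp add: m_def power2_eq_square field_simps)
  finally show ?thesis unfolding m_def .
qed

text \<open>This is the statistic \<open>V\<^sub>k\<close> of the context.\<close>

definition cusum :: "(nat \<Rightarrow> real) \<Rightarrow> nat \<Rightarrow> nat \<Rightarrow> real" where
  "cusum y n k = (real k / n * (\<Sum>i=1..n. y i) - (\<Sum>i=1..k. y i)) / sqrt (real k * (real n - real k))"

text \<open>Analysis of variance: the total sum of squares does not depend on \<open>k\<close>, and
  the part explained by the two group means is n V_k^2.\<close>

lemma sum_of_squares_eq_cusum:
  assumes "1 \<le> k" "k < n"
  shows "sum_of_squares z n k
    = (\<Sum>i=1..n. ((z i)\<^sup>2)\<^sup>2) - (\<Sum>i=1..n. (z i)\<^sup>2)\<^sup>2 / n - n * (cusum (\<lambda>i. (z i)\<^sup>2) n k)\<^sup>2"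
proof -
  define a b where "a = (\<Sum>i=1..k. (z i)\<^sup>2)" and "b = (\<Sum>i=k+1..n. (z i)\<^sup>2)"
  have split: "sum f {1..n} = sum f {1..k} + sum f {k+1..n}" for f :: "nat \<Rightarrow> real"
    using sum.ub_add_nat[of 1 k f "n - k"] assms by simp
  have ss: "sum_of_squares z n k = (\<Sum>i=1..n. ((z i)\<^sup>2)\<^sup>2) - (a\<^sup>2 / k + b\<^sup>2 / (n - k))"
    unfolding sum_of_squares_def theta_bar1_def theta_bar2_def split a_def b_def
    using sum_squared_deviations[of "{1..k}" "\<lambda>i. (z i)\<^sup>2"]
      sum_squared_deviations[of "{k+1..n}" "\<lambda>i. (z i)\<^sup>2"] assms by simp
  have cus: "n * (cusum (\<lambda>i. (z i)\<^sup>2) n k)\<^sup>2 = n * (real k / n * (a + b) - a)\<^sup>2 / (real k * (real n - real k))"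
    unfolding cusum_def split[of "\<lambda>i. (z i)\<^sup>2"] a_def[symmetric] b_def[symmetric] power_divide
    using assms by simp
  define K m where "K = real k" and "m = real n - real k"
  have pos: "0 < K" "0 < m" and n: "real n = K + m" and m: "real (n - k) = m"
    using assms by (auto simp: K_def m_def)
  have "a\<^sup>2 / K + b\<^sup>2 / m = (a + b)\<^sup>2 / (K + m) + (K + m) * (K / (K + m) * (a + b) - a)\<^sup>2 / (K * m)"
  proof -
    have e: "K / (K + m) * (a + b) - a = (K * b - m * a) / (K + m)"
      using pos by (simp add: field_simps)
    show ?thesis unfolding e power_divide using pos
      by (simp add: divide_simps power2_eq_square) algebra
  qed
  then show ?thesis
    unfolding ss cus split[of "\<lambda>i. (z i)\<^sup>2"] a_def[symmetric] b_def[symmetric] m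
    by (simp add: n K_def[symmetric] m_def[symmetric])
qed

lemma least_squares_maximises_cusum:
  assumes "least_squares_change_point z n k"
  shows "k \<in> {1..n - 1}" and "j \<in> {1..n - 1} \<Longrightarrow> \<bar>cusum (\<lambda>i. (z i)\<^sup>2) n j\<bar> \<le> \<bar>cusum (\<lambda>i. (z i)\<^sup>2) n k\<bar>"
proof -
  show k: "k \<in> {1..n - 1}"
    using assms by (simp add: least_squares_change_point_def is_arg_min_def)
  assume j: "j \<in> {1..n - 1}"
  have "sum_of_squares z n k \<le> sum_of_squares z n j"
    using assms j by (auto simp: least_squares_change_point_def is_arg_min_def not_less)
  then have "real n * (cusum (\<lambda>i. (z i)\<^sup>2) n j)\<^sup>2 \<le> real n * (cusum (\<lambda>i. (z i)\<^sup>2) n k)\<^sup>2"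
    using j k by (subst (asm) (1 2) sum_of_squares_eq_cusum) auto
  moreover have "0 < real n" using j by auto
  ultimately show "\<bar>cusum (\<lambda>i. (z i)\<^sup>2) n j\<bar> \<le> \<bar>cusum (\<lambda>i. (z i)\<^sup>2) n k\<bar>"
    by (simp add: abs_le_square_iff)
qed

text \<open>In the next locale \<open>\<rho>\<close> is the ratio of the noiseless normalised statistics at \<open>a\<close> and at the
  change point \<open>c\<close>. Only \<open>a \<le> c\<close> is considered; \<open>a \<ge> c\<close> follows by reflecting time.\<close>

locale one_side =
  fixes n a c \<theta> E E0 D m :: real
  assumes a: "0 < a" "a \<le> c" and c: "c < n" and jump: "0 < \<theta>"
    and E: "E = E0 * a / c + (D - m * (c - a) / c)"
begin

text \<open>\<open>E\<close> and \<open>E0\<close> stand for the numerators of the statistic at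
  \<open>a\<close> and \<open>c\<close>, \<open>D\<close> for the noise increment between the two,
  and \<open>m\<close> for the noise accumulated up to \<open>c\<close>.\<close>

definition "F = E / sqrt (a * (n - a))"
definition "F0 = E0 / sqrt (c * (n - c))"
definition "\<rho> = sqrt (a * (n - c) / (c * (n - a)))"
text \<open>The noiseless statistic at \<open>c\<close>; by \<open>signal_eq\<close> its value at
  \<open>a\<close> is \<open>f0 * \<rho>\<close>.\<close>

definition "f0 = \<theta> * sqrt (c * (n - c)) / n"

lemma pos: "0 < c" "0 < n" "0 < n - a" "0 < n - c" "0 < a * (n - a)" "0 < c * (n - c)" "0 < c * (n - a)"
  using a c by auto

lemma rho_square: "\<rho>\<^sup>2 = a * (n - c) / (c * (n - a))" and rho_pos: "0 < \<rho>"
  using a pos by (auto simp: \<rho>_def)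

lemma one_minus_rho_square: "1 - \<rho>\<^sup>2 = n * (c - a) / (c * (n - a))"
  unfolding rho_square using pos by (simp add: divide_simps) (simp add: algebra_simps)

lemma rho_le_1: "\<rho> \<le> 1"
proof -
  have "0 \<le> 1 - \<rho>\<^sup>2"
    unfolding one_minus_rho_square using a pos by (intro divide_nonneg_pos mult_nonneg_nonneg) auto
  then show ?thesis using rho_pos by (simp add: abs_square_le_1)
qed

lemma one_minus_rho_le: "1 - \<rho> \<le> n * (c - a) / (c * (n - a))" "n * (c - a) / (c * (n - a)) / 2 \<le> 1 - \<rho>"
proof -
  have "1 - \<rho>\<^sup>2 = (1 - \<rho>) * (1 + \<rho>)" by (simp add: power2_eq_square algebra_simps)
  moreover have "(1 - \<rho>) * 1 \<le> (1 - \<rho>) * (1 + \<rho>)" "(1 - \<rho>) * (1 + \<rho>) \<le> (1 - \<rho>) * 2"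
    using rho_le_1 rho_pos by (intro mult_left_mono; simp)+
  ultimately show "1 - \<rho> \<le> n * (c - a) / (c * (n - a))" "n * (c - a) / (c * (n - a)) / 2 \<le> 1 - \<rho>"
    using one_minus_rho_square by simp_all
qed

lemma rho_alt: "sqrt (a * (n - a)) * sqrt (c * (n - c)) = \<rho> * (c * (n - a))"
  "\<rho> * sqrt (a * (n - a)) = sqrt (c * (n - c)) * (a / c)"
proof -
  have "sqrt (a * (n - a)) * sqrt (c * (n - c)) = sqrt (a * (n - c) / (c * (n - a)) * (c * (n - a))\<^sup>2)"
    unfolding real_sqrt_mult[symmetric] using pos by (simp add: power2_eq_square divide_simps mult_ac)
  then show "sqrt (a * (n - a)) * sqrt (c * (n - c)) = \<rho> * (c * (n - a))"
    unfolding real_sqrt_mult \<rho>_def using pos by simp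
  then have "sqrt (a * (n - a)) * sqrt (a * (n - a)) * sqrt (c * (n - c)) = \<rho> * sqrt (a * (n - a)) * c * (n - a)"
    by (simp only: mult_ac)
  then have "a * (n - a) * sqrt (c * (n - c)) = \<rho> * sqrt (a * (n - a)) * c * (n - a)"
    using pos(5) by (simp only: real_sqrt_mult_self abs_of_pos)
  then have "a * sqrt (c * (n - c)) = \<rho> * sqrt (a * (n - a)) * c" using pos(3) by simp
  then show "\<rho> * sqrt (a * (n - a)) = sqrt (c * (n - c)) * (a / c)"
    using pos(1) by (simp add: nonzero_divide_eq_eq nonzero_eq_divide_eq mult_ac)
qed

lemma rho_eq: "\<rho> = sqrt (c * (n - c)) * (a / c) / sqrt (a * (n - a))"
proof -
  have s: "sqrt (a * (n - a)) \<noteq> 0" using pos(5) by (simp only: real_sqrt_eq_zero_cancel_iff)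
  show ?thesis using rho_alt(2) by (simp only: nonzero_eq_divide_eq[OF s])
qed

lemma F_eq: "F = (D - m * (c - a) / c) / sqrt (a * (n - a)) + F0 * \<rho>"
proof -
  have "F0 * \<rho> = E0 * a / c / sqrt (a * (n - a))"
    unfolding rho_eq F0_def using pos by simp
  then show ?thesis unfolding F_def by (subst E) (simp add: add_divide_distrib)
qed

lemma signal_eq: "\<theta> * (a * (n - c) / n) / sqrt (a * (n - a)) = f0 * \<rho>"
proof -
  have "f0 * \<rho> = \<theta> / n * (sqrt (c * (n - c)) * sqrt (c * (n - c))) * (a / c) / sqrt (a * (n - a))"
    unfolding rho_eq f0_def by (simp only: divide_inverse mult_ac)
  also have "sqrt (c * (n - c)) * sqrt (c * (n - c)) = c * (n - c)"
    using pos(6) by (simp only: real_sqrt_mult_self abs_of_pos)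
  finally show ?thesis using pos by simp
qed

lemma f0_pos: "0 < f0" unfolding f0_def using jump pos by simp

text \<open>By \<open>F_eq\<close>, \<open>F0 \<le> F\<close> forces the loss
  \<open>F0 * (1 - \<rho>)\<close> to be paid by the noise. The loss is at least proportional to
  \<open>c - a\<close>, because \<open>F0\<close> is comparable to \<open>f0\<close>.\<close>

lemma distance_le_noise:
  assumes "F0 \<le> F" and F: "\<bar>F - f0 * \<rho>\<bar> \<le> \<mu>" and F0: "\<bar>F0 - f0\<bar> \<le> \<mu>" and \<mu>: "4 * \<mu> \<le> f0"
  shows "\<theta> * (c - a) / 8 \<le> \<bar>D\<bar> + \<bar>m\<bar> * (c - a) / c"
proof -
  \<comment> \<open>The noiseless values can be out of order by at most twice the noise, and 2 \<mu>
    is at most f0 / 2. So \<rho> is at least 1 / 2, which excludes points \<open>a\<close> near the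
    boundary.\<close>
  have "f0 - 2 * \<mu> \<le> f0 * \<rho>" using assms by linarith
  then have "f0 * (1 / 2) \<le> f0 * \<rho>" using \<mu> by linarith
  then have rho: "1 / 2 \<le> \<rho>" using f0_pos by simp
  have F0': "f0 / 2 \<le> F0" using F0 \<mu> f0_pos by linarith
  have "f0 / 2 * (n * (c - a) / (c * (n - a)) / 2) \<le> F0 * (1 - \<rho>)"
    using one_minus_rho_le(2) F0' f0_pos a pos by (intro mult_mono) auto
  also have "\<dots> \<le> (D - m * (c - a) / c) / sqrt (a * (n - a))"
    using assms(1) F_eq by (simp add: algebra_simps)
  finally have "f0 / 2 * (n * (c - a) / (c * (n - a)) / 2) * sqrt (a * (n - a)) \<le> D - m * (c - a) / c"
    using pos by (simp add: pos_le_divide_eq)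
  moreover have "f0 / 2 * (n * (c - a) / (c * (n - a)) / 2) * sqrt (a * (n - a))
    = \<theta> * (c - a) / (4 * (c * (n - a))) * (sqrt (a * (n - a)) * sqrt (c * (n - c)))"
    using pos by (simp add: f0_def)
  moreover have "\<dots> = \<theta> * (c - a) / 4 * \<rho>"
  proof -
    have "x / (4 * y) * (\<rho> * y) = x / 4 * \<rho>" if "0 < y" for x y :: real using that by simp
    then show ?thesis unfolding rho_alt(1) using pos(7) .
  qed
  moreover have "\<theta> * (c - a) / 4 * (1 / 2) \<le> \<theta> * (c - a) / 4 * \<rho>"
    using jump a rho by (intro mult_left_mono) auto
  ultimately have "\<theta> * (c - a) / 8 \<le> D - m * (c - a) / c" by linarith
  also have "\<dots> \<le> \<bar>D\<bar> + \<bar>m\<bar> * (c - a) / c"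
  proof -
    have "D + - m * ((c - a) / c) \<le> \<bar>D\<bar> + \<bar>m\<bar> * ((c - a) / c)"
      using a pos by (intro add_mono mult_right_mono) auto
    then show ?thesis by simp
  qed
  finally show ?thesis .
qed

text \<open>By \<open>F_eq\<close> the left-hand difference consists of a rescaled noise increment
  and of \<open>E0 * (1 - \<rho>)\<close>. The scaling factor tends to 1 and the second term to
  \<theta> (c - a) / 2, with all relative errors of order (c - a) / n.\<close>

lemma local_expansion:
  assumes \<gamma>: "0 < \<gamma>" "\<gamma> \<le> 1" "\<gamma> * n \<le> c" "\<gamma> * n \<le> n - c" "\<gamma> * n / 2 \<le> a"
    and E0: "\<bar>E0 - \<theta> * (c * (n - c) / n)\<bar> \<le> e"
  shows "\<bar>sqrt (c * (n - c)) * (F - F0) - (D - \<theta> * (c - a) / 2)\<bar>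
    \<le> (c - a) / (\<gamma> ^ 3 * n) * (2 * \<bar>D\<bar> + 2 * \<bar>m\<bar> + 2 * \<theta> * (c - a) + e)"
proof -
  \<comment> \<open>\<open>q\<close> compares the normalisers at \<open>c\<close> and
    \<open>a\<close>, \<open>t\<close> is the correction in the signal term, and \<open>L\<close> is
    a common scale dominating all relative errors.\<close>
  define q where "q = sqrt (c * (n - c)) / sqrt (a * (n - a))"
  define t where "t = (n - c) / (n - a)"
  define L where "L = (c - a) / (\<gamma> ^ 3 * n)"
  have ca: "0 \<le> c - a" using a by simp
  have na: "\<gamma> * n \<le> n - a" using \<gamma> a by simp
  have an: "\<gamma>\<^sup>2 * n\<^sup>2 / 2 \<le> a * (n - a)"
    using mult_mono[OF \<gamma>(5) na] \<gamma> pos a by (simp add: power2_eq_square mult_ac)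
  have cn: "\<gamma>\<^sup>2 * n\<^sup>2 \<le> c * (n - a)"
    using mult_mono[OF \<gamma>(3) na] \<gamma> pos a by (simp add: power2_eq_square mult_ac)
  have g32: "\<gamma> ^ 3 \<le> \<gamma>\<^sup>2" "\<gamma> ^ 3 \<le> \<gamma>" using \<gamma> power_decreasing[of 2 3 \<gamma>] power_decreasing[of 1 3 \<gamma>] by auto
  have L_ge: "(c - a) / (\<gamma>\<^sup>2 * n) \<le> L" "(c - a) / (\<gamma> * n) \<le> L"
    unfolding L_def using ca g32 \<gamma> pos by (auto intro!: divide_left_mono mult_right_mono)
  have L0: "0 \<le> L" unfolding L_def using ca \<gamma> pos by simp
  have q2: "q\<^sup>2 = c * (n - c) / (a * (n - a))" and q0: "0 < q"
    using pos a by (auto simp: q_def power_divide)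
  have rho1: "1 - \<rho> \<le> L"
  proof -
    have "1 - \<rho> \<le> n * (c - a) / (c * (n - a))" by (rule one_minus_rho_le)
    also have "\<dots> \<le> n * (c - a) / (\<gamma>\<^sup>2 * n\<^sup>2)"
      using cn ca pos \<gamma> by (intro divide_left_mono) auto
    also have "\<dots> = (c - a) / (\<gamma>\<^sup>2 * n)" using pos by (simp add: power2_eq_square)
    finally show ?thesis using L_ge by simp
  qed
  have q1: "\<bar>q - 1\<bar> \<le> 2 * L"
  proof -
    have "\<bar>q - 1\<bar> \<le> \<bar>q - 1\<bar> * (q + 1)" using q0 by (simp add: mult_left_le[of 1] algebra_simps)
    also have "\<dots> = \<bar>(q - 1) * (q + 1)\<bar>" using q0 by (simp add: abs_mult)
    also have "(q - 1) * (q + 1) = q\<^sup>2 - 1" by (simp add: power2_eq_square algebra_simps)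
    also have "q\<^sup>2 - 1 = (c - a) * (n - c - a) / (a * (n - a))"
      unfolding q2 using pos a by (simp add: divide_simps) (simp add: algebra_simps)
    also have "\<bar>\<dots>\<bar> = (c - a) * \<bar>n - c - a\<bar> / (a * (n - a))"
      using pos ca a by (simp add: abs_mult abs_divide)
    also have "\<dots> \<le> (c - a) * n / (\<gamma>\<^sup>2 * n\<^sup>2 / 2)"
      using an pos ca \<gamma> a c by (intro frac_le mult_left_mono) auto
    also have "\<dots> = 2 * ((c - a) / (\<gamma>\<^sup>2 * n))"
      using pos \<gamma> by (simp add: power2_eq_square divide_simps)
    finally show ?thesis using L_ge by linarith
  qed
  have q_le: "q \<le> 2 / \<gamma>\<^sup>2"
  proof -
    have "q\<^sup>2 \<le> n\<^sup>2 / (\<gamma>\<^sup>2 * n\<^sup>2 / 2)"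
      unfolding q2 using an pos \<gamma> a c by (intro frac_le) (auto simp: power2_eq_square intro!: mult_mono)
    also have "\<dots> = 2 / \<gamma>\<^sup>2" using pos by simp
    finally have *: "q\<^sup>2 \<le> 2 / \<gamma>\<^sup>2" .
    have "1 \<le> 2 / \<gamma>\<^sup>2" using \<gamma> power_le_one[of \<gamma> 2] by (simp add: pos_le_divide_eq)
    show ?thesis
    proof (cases "q \<le> 1")
      case False
      then have "q \<le> q\<^sup>2" by (simp add: power2_eq_square)
      with * show ?thesis by simp
    qed (use \<open>1 \<le> 2 / \<gamma>\<^sup>2\<close> in simp)
  qed
  have 1: "\<bar>(q - 1) * D\<bar> \<le> L * (2 * \<bar>D\<bar>)"
    using mult_right_mono[OF q1, of "\<bar>D\<bar>"] by (simp add: abs_mult mult_ac)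
  have 2: "\<bar>q * (m * (c - a) / c)\<bar> \<le> L * (2 * \<bar>m\<bar>)"
  proof -
    have "\<bar>q * (m * (c - a) / c)\<bar> = \<bar>m\<bar> * (q * ((c - a) / c))"
      using q0 ca pos by (simp add: abs_mult)
    also have "\<dots> \<le> \<bar>m\<bar> * (2 / \<gamma>\<^sup>2 * ((c - a) / (\<gamma> * n)))"
      using q_le q0 ca pos \<gamma> by (intro mult_left_mono mult_mono divide_left_mono) auto
    also have "\<dots> = L * (2 * \<bar>m\<bar>)"
      using pos \<gamma> by (simp add: L_def power2_eq_square power3_eq_cube divide_simps)
    finally show ?thesis .
  qed
  \<comment> \<open>The slope 1 / 2 arises from 1 - \<rho> = (1 - \<rho>^2) / (1 + \<rho>): the
    numerator is linear in c - a and the denominator is close to 2.\<close>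
  have 3: "\<bar>E0 * (1 - \<rho>) - \<theta> * (c - a) / 2\<bar> \<le> L * (2 * \<theta> * (c - a) + e)"
  proof -
    have "\<theta> * (c * (n - c) / n) * (1 - \<rho>) = \<theta> * (c - a) * (t / (1 + \<rho>))"
    proof -
      have "1 - \<rho> = (1 - \<rho>\<^sup>2) / (1 + \<rho>)" using rho_pos by (simp add: power2_eq_square field_simps)
      then have "\<theta> * (c * (n - c) / n) * (1 - \<rho>)
          = \<theta> * (c * (n - c) / n) * (n * (c - a) / (c * (n - a)) / (1 + \<rho>))"
        unfolding one_minus_rho_square by (rule arg_cong)
      also have "\<dots> = \<theta> * (c - a) * (t / (1 + \<rho>))"
        unfolding t_def using pos rho_pos by (simp add: divide_simps)
      finally show ?thesis .
    qed
    moreover have "\<theta> * (c - a) * (t / (1 + \<rho>)) - \<theta> * (c - a) / 2 = \<theta> * (c - a) * (t / (1 + \<rho>) - 1 / 2)"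
      by (simp only: right_diff_distrib)
    moreover have "E0 * (1 - \<rho>) = (E0 - \<theta> * (c * (n - c) / n)) * (1 - \<rho>) + \<theta> * (c * (n - c) / n) * (1 - \<rho>)"
      by (simp only: left_diff_distrib)
    ultimately have split: "E0 * (1 - \<rho>) - \<theta> * (c - a) / 2 = (E0 - \<theta> * (c * (n - c) / n)) * (1 - \<rho>)
        + \<theta> * (c - a) * (t / (1 + \<rho>) - 1 / 2)"
      by (metis add_diff_eq)
    have "\<bar>(E0 - \<theta> * (c * (n - c) / n)) * (1 - \<rho>)\<bar> \<le> e * L"
      unfolding abs_mult using E0 rho1 rho_le_1 by (intro mult_mono) auto
    moreover have "\<bar>\<theta> * (c - a) * (t / (1 + \<rho>) - 1 / 2)\<bar> \<le> \<theta> * (c - a) * (2 * L)"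
    proof -
      have t1: "1 - t = (c - a) / (n - a)" unfolding t_def using pos by (simp add: field_simps)
      also have "\<dots> \<le> (c - a) / (\<gamma> * n)" using na ca pos \<gamma> by (intro divide_left_mono) auto
      finally have t: "1 - t \<le> L" "0 \<le> 1 - t" using L_ge ca pos t1 by auto
      have "t / (1 + \<rho>) - 1 / 2 = ((1 - \<rho>) - 2 * (1 - t)) / (2 * (1 + \<rho>))"
        using rho_pos by (simp add: field_simps)
      then have "\<bar>t / (1 + \<rho>) - 1 / 2\<bar> = \<bar>(1 - \<rho>) - 2 * (1 - t)\<bar> / (2 * (1 + \<rho>))"
        using rho_pos by simp
      also have "\<dots> \<le> (2 * L) / 1"
        using t rho1 rho_le_1 rho_pos by (intro frac_le) auto
      finally show ?thesis unfolding abs_mult using jump ca by (intro mult_mono) auto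
    qed
    ultimately have "\<bar>E0 * (1 - \<rho>) - \<theta> * (c - a) / 2\<bar> \<le> e * L + \<theta> * (c - a) * (2 * L)"
      unfolding split by (rule abs_add_le)
    also have "\<dots> = L * (2 * \<theta> * (c - a) + e)" by (simp only: distrib_left mult_ac add_ac)
    finally show ?thesis .
  qed
  have "sqrt (c * (n - c)) * (F - F0) = q * (D - m * (c - a) / c) - E0 * (1 - \<rho>)"
    unfolding F_eq q_def F0_def using pos by (simp add: field_simps)
  then have "sqrt (c * (n - c)) * (F - F0) - (D - \<theta> * (c - a) / 2)
     = (q - 1) * D - q * (m * (c - a) / c) - (E0 * (1 - \<rho>) - \<theta> * (c - a) / 2)"
    by (simp add: algebra_simps)
  moreover have "\<bar>(q - 1) * D - q * (m * (c - a) / c)\<bar> \<le> L * (2 * \<bar>D\<bar>) + L * (2 * \<bar>m\<bar>)"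
    using 1 2 by (rule abs_diff_le)
  ultimately have "\<bar>sqrt (c * (n - c)) * (F - F0) - (D - \<theta> * (c - a) / 2)\<bar>
     \<le> L * (2 * \<bar>D\<bar>) + L * (2 * \<bar>m\<bar>) + L * (2 * \<theta> * (c - a) + e)"
    using 3 by (simp only: abs_diff_le)
  also have "\<dots> = L * (2 * \<bar>D\<bar> + 2 * \<bar>m\<bar> + 2 * \<theta> * (c - a) + e)" by (simp only: distrib_left add.assoc)
  finally show ?thesis unfolding L_def .
qed

end

text \<open>One realisation on the event where the noise is controlled; no probability remains.
  Noise is bounded from both ends because the normaliser of the statistic degenerates at
  both.\<close>

locale change_path =
  fixes n k0 :: nat and \<theta>1 \<theta>2 lam :: real and N y :: "nat \<Rightarrow> real"
  assumes k0: "0 < k0" "k0 < n" and jump: "\<theta>1 < \<theta>2"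
    and sums: "\<And>k. k \<le> n \<Longrightarrow> (\<Sum>i=1..k. y i) = real k * \<theta>1 + real (k - k0) * (\<theta>2 - \<theta>1) + N k"
    and N_le: "\<And>k. k \<le> n \<Longrightarrow> \<bar>N k\<bar> \<le> lam * sqrt k"
    and N_le': "\<And>k. k \<le> n \<Longrightarrow> \<bar>N n - N k\<bar> \<le> lam * sqrt (real n - real k)"
begin

definition "\<theta> = \<theta>2 - \<theta>1"
definition "numer k = real k / n * (\<Sum>i=1..n. y i) - (\<Sum>i=1..k. y i)"

lemma cusum_numer: "cusum y n k = numer k / sqrt (real k * (real n - real k))"
  by (simp add: cusum_def numer_def)

lemma lam_nonneg: "0 \<le> lam"
proof -
  have "0 \<le> lam * sqrt n" using N_le[of n] by simp
  then show ?thesis using k0 by (simp add: zero_le_mult_iff)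
qed

lemma jump_pos: "0 < \<theta>"
  using jump by (simp add: \<theta>_def)

lemma numer_sums:
  assumes "k \<le> n"
  shows "numer k = real k / n * (real n * \<theta>1 + real (n - k0) * \<theta> + N n) - (real k * \<theta>1 + real (k - k0) * \<theta> + N k)"
  unfolding numer_def sums[OF assms] sums[OF order.refl] \<theta>_def ..

lemma numer_left: "k \<le> k0 \<Longrightarrow> numer k = \<theta> * (k * (real n - k0) / n) + (k / n * N n - N k)"
  using k0 by (simp add: numer_sums of_nat_diff divide_simps) (simp add: algebra_simps)

lemma numer_right: "k0 \<le> k \<Longrightarrow> k \<le> n \<Longrightarrow> numer k = \<theta> * (k0 * (real n - k) / n) + (k / n * N n - N k)"
  using k0 by (simp add: numer_sums of_nat_diff divide_simps) (simp add: algebra_simps)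

text \<open>The centred noise is a combination of the sums before and after \<open>k\<close>, each
  weighted by the length of the other part. Thus each end uses its own bound and the factor of the
  normaliser comes out.\<close>

lemma noise_le:
  assumes "k \<le> n"
  shows "\<bar>real k / n * N n - N k\<bar> \<le> lam * (sqrt k * sqrt (real n - k)) * ((sqrt k + sqrt (real n - k)) / n)"
proof -
  have e: "real k / n * N n - N k = k / n * (N n - N k) - (real n - k) / n * N k"
    using k0 by (simp add: field_simps)
  have "\<bar>k / n * (N n - N k)\<bar> \<le> k / n * (lam * sqrt (real n - k))"
    unfolding abs_mult using mult_left_mono[OF N_le'[OF assms], of "k / n"] by simp
  moreover have "\<bar>(real n - k) / n * N k\<bar> \<le> (real n - k) / n * (lam * sqrt k)"
    unfolding abs_mult using mult_left_mono[OF N_le[OF assms], of "(real n - k) / n"] assms by simp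
  ultimately have "\<bar>real k / n * N n - N k\<bar> \<le> k / n * (lam * sqrt (real n - k)) + (real n - k) / n * (lam * sqrt k)"
    unfolding e by (rule abs_diff_le)
  also have "\<dots> = sqrt k * sqrt k / n * (lam * sqrt (real n - k))
      + sqrt (real n - k) * sqrt (real n - k) / n * (lam * sqrt k)"
    using assms by simp
  also have "\<dots> = lam * (sqrt k * sqrt (real n - k)) * ((sqrt k + sqrt (real n - k)) / n)"
    by (simp only: divide_inverse distrib_left distrib_right mult_ac)
  finally show ?thesis .
qed

lemma sqrt_sum_le:
  assumes "k \<le> n" shows "(sqrt k + sqrt (real n - k)) / n \<le> 2 / sqrt n"
proof -
  have "sqrt k + sqrt (real n - k) \<le> sqrt n + sqrt n"
    using assms by (intro add_mono) auto
  then have "(sqrt k + sqrt (real n - k)) / n \<le> 2 * sqrt n / n"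
    by (intro divide_right_mono) auto
  also have "2 * sqrt n / n = 2 / sqrt n" using k0 by (simp add: divide_simps)
  finally show ?thesis .
qed

lemma noise_normalised_le:
  assumes "0 < k" "k < n"
  shows "\<bar>real k / n * N n - N k\<bar> / sqrt (real k * (real n - k)) \<le> 2 * lam / sqrt n"
proof -
  have pos: "0 < sqrt k * sqrt (real n - k)" using assms by simp
  have "\<bar>real k / n * N n - N k\<bar> \<le> lam * (sqrt k * sqrt (real n - k)) * (2 / sqrt n)"
    using noise_le[of k] sqrt_sum_le[of k] assms pos lam_nonneg
    by (intro order.trans[OF noise_le] mult_left_mono) auto
  moreover have "x / P \<le> 2 * lam / s" if "x \<le> lam * P * (2 / s)" "0 < P" for x P s
    using that by (simp add: pos_divide_le_eq mult_ac)
  ultimately show ?thesis using pos unfolding real_sqrt_mult by blast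
qed

lemma noise_le_sqrt:
  assumes "k \<le> n" shows "\<bar>real k / n * N n - N k\<bar> \<le> 2 * lam * sqrt n"
proof -
  have "lam * (sqrt k * sqrt (real n - k)) * ((sqrt k + sqrt (real n - k)) / n)
      \<le> lam * (sqrt n * sqrt n) * (2 / sqrt n)"
    using assms lam_nonneg by (intro mult_mono sqrt_sum_le) auto
  also have "\<dots> = 2 * lam * sqrt n" using k0 by (simp add: divide_simps)
  finally show ?thesis using noise_le[OF assms] by linarith
qed

lemma N_le_sqrt: "k \<le> n \<Longrightarrow> \<bar>N k\<bar> \<le> lam * sqrt n" "k \<le> n \<Longrightarrow> \<bar>N n - N k\<bar> \<le> lam * sqrt n"
  using N_le[of k] N_le'[of k] lam_nonneg
  by (auto intro: order.trans[OF _ mult_left_mono])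

lemma left_side:
  assumes "0 < k" "k \<le> k0"
  shows "one_side n k k0 \<theta> (numer k) (numer k0) (N k0 - N k) (N k0)"
proof
  show "numer k = numer k0 * real k / real k0 + (N k0 - N k - N k0 * (real k0 - real k) / real k0)"
    unfolding numer_left[OF assms(2)] numer_left[OF order.refl] using k0
    by (simp add: divide_simps) (simp add: algebra_simps)
qed (use assms k0 jump in \<open>auto simp: \<theta>_def\<close>)

text \<open>Time reflection sends \<open>k\<close> to n - k and \<open>k0\<close> to n - k0. Noise
  is then counted from \<open>n\<close>, whence \<open>N k0 - N n\<close> in place of
  \<open>N k0\<close>.\<close>

lemma right_side:
  assumes "k0 \<le> k" "k < n"
  shows "one_side n (real n - k) (real n - k0) \<theta> (numer k) (numer k0) (N k0 - N k) (N k0 - N n)"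
proof
  show "numer k = numer k0 * (real n - k) / (real n - k0)
      + (N k0 - N k - (N k0 - N n) * (real n - k0 - (real n - k)) / (real n - k0))"
    unfolding numer_right[OF assms(1) less_imp_le[OF assms(2)]] numer_right[OF order.refl less_imp_le[OF k0(2)]]
    using k0 assms by (simp add: divide_simps) (simp add: algebra_simps)
qed (use assms k0 jump in \<open>auto simp: \<theta>_def\<close>)

lemma signal_k0: "\<bar>cusum y n k0 - \<theta> * sqrt (real k0 * (real n - k0)) / n\<bar> \<le> 2 * lam / sqrt n"
proof -
  have s: "sqrt (real k0 * (real n - k0)) > 0" using k0 by simp
  have "\<theta> * (k0 * (real n - k0) / n) / sqrt (real k0 * (real n - k0)) = \<theta> * sqrt (real k0 * (real n - k0)) / n"
    using k0 real_div_sqrt[of "real k0 * (real n - k0)"] by (simp add: field_simps)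
  then have "cusum y n k0 - \<theta> * sqrt (real k0 * (real n - k0)) / n
      = (k0 / n * N n - N k0) / sqrt (real k0 * (real n - k0))"
    unfolding cusum_numer numer_left[OF order.refl] add_divide_distrib by simp
  then show ?thesis using noise_normalised_le[OF k0] s by (simp add: abs_divide)
qed

text \<open>The signal is nonnegative at every index, so only noise can make the statistic negative.
  This excludes that a large absolute value comes from a negative one.\<close>

lemma signal_nonneg:
  assumes "0 < k" "k < n" shows "- (2 * lam / sqrt n) \<le> cusum y n k"
proof -
  have "0 \<le> numer k - (k / n * N n - N k)"
    using numer_left[of k] numer_right[of k] assms k0 jump by (cases "k \<le> k0") (auto simp: \<theta>_def)
  then have "0 \<le> (numer k - (k / n * N n - N k)) / sqrt (real k * (real n - k))"
    using assms by (intro divide_nonneg_nonneg) auto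
  then have "(k / n * N n - N k) / sqrt (real k * (real n - k)) \<le> cusum y n k"
    by (simp add: cusum_numer diff_divide_distrib)
  moreover have "\<bar>(k / n * N n - N k) / sqrt (real k * (real n - k))\<bar> \<le> 2 * lam / sqrt n"
    using noise_normalised_le[OF assms] assms by (simp add: abs_divide)
  ultimately show ?thesis by linarith
qed

theorem maximiser_near_change:
  assumes lam: "16 * lam * sqrt n \<le> \<theta> * sqrt (real k0 * (real n - k0))"
    and k: "k \<in> {1..n - 1}" "\<And>j. j \<in> {1..n - 1} \<Longrightarrow> \<bar>cusum y n j\<bar> \<le> \<bar>cusum y n k\<bar>"
  shows "\<And>j. j \<in> {1..n - 1} \<Longrightarrow> cusum y n j \<le> cusum y n k"
    and "\<theta> * \<bar>real k - real k0\<bar> / 16 \<le> \<bar>N k - N k0\<bar>"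
proof -
  let ?\<mu> = "2 * lam / sqrt n" and ?f = "\<theta> * sqrt (real k0 * (real n - k0)) / n"
  have f: "0 < ?f" using k0 jump by (simp add: \<theta>_def)
  have f8: "8 * ?\<mu> \<le> ?f"
  proof -
    have "8 * ?\<mu> = 16 * lam * sqrt n / (sqrt n * sqrt n)" using k0 by (simp add: field_simps)
    also have "\<dots> \<le> ?f" using lam by (simp add: divide_right_mono)
    finally show ?thesis .
  qed
  have \<mu>0: "0 \<le> ?\<mu>" using lam_nonneg by simp
  have k0_in: "k0 \<in> {1..n-1}" using k0 by auto
  have "?\<mu> < cusum y n k0" using signal_k0 f f8 \<mu>0 by linarith
  then have "?\<mu> < \<bar>cusum y n k\<bar>" using k(2)[OF k0_in] by linarith
  moreover have "- ?\<mu> \<le> cusum y n k" using k(1) by (intro signal_nonneg) auto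
  ultimately have pos: "\<bar>cusum y n k\<bar> = cusum y n k" by linarith
  show le: "cusum y n j \<le> cusum y n k" if "j \<in> {1..n - 1}" for j
    using k(2)[OF that] pos by linarith
  have s: "sqrt (real k0 * (real n - k0)) \<le> sqrt k0 * sqrt n" "sqrt (real k0 * (real n - k0)) \<le> sqrt (real n - k0) * sqrt n"
    unfolding real_sqrt_mult using k0 by (auto intro!: mult_left_mono simp: mult.commute)
  show "\<theta> * \<bar>real k - real k0\<bar> / 16 \<le> \<bar>N k - N k0\<bar>"
  proof (cases "k \<le> k0")
    case True
    then interpret one_side n k k0 \<theta> "numer k" "numer k0" "N k0 - N k" "N k0"
      using k by (intro left_side) auto
    have "\<theta> * (real k0 - k) / 8 \<le> \<bar>N k0 - N k\<bar> + \<bar>N k0\<bar> * (real k0 - k) / k0"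
    proof (rule distance_le_noise)
      show "F0 \<le> F" using le[OF k0_in] by (simp add: F_def F0_def cusum_numer)
      show "\<bar>F0 - f0\<bar> \<le> ?\<mu>" using signal_k0 by (simp add: F0_def f0_def cusum_numer)
      have "F - f0 * \<rho> = (numer k - \<theta> * (k * (real n - k0) / n)) / sqrt (real k * (real n - k))"
        unfolding signal_eq[symmetric] F_def diff_divide_distrib ..
      also have "\<dots> = (k / n * N n - N k) / sqrt (real k * (real n - k))"
        unfolding numer_left[OF True] by simp
      finally have "F - f0 * \<rho> = (k / n * N n - N k) / sqrt (real k * (real n - k))" .
      then show "\<bar>F - f0 * \<rho>\<bar> \<le> ?\<mu>" using noise_normalised_le[of k] k by (auto simp: abs_divide)
      show "4 * ?\<mu> \<le> f0" using f8 \<mu>0 unfolding f0_def by linarith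
    qed
    \<comment> \<open>This share of the noise is itself linear in the distance and uses up half of
      the factor 1 / 8, leaving 1 / 16.\<close>
    moreover have "\<bar>N k0\<bar> * (real k0 - k) / k0 \<le> \<theta> / 16 * (real k0 - k)"
    proof -
      have "16 * lam * sqrt n \<le> \<theta> * sqrt k0 * sqrt n"
        using order.trans[OF lam mult_left_mono[OF s(1)]] jump_pos by (simp add: mult.assoc)
      then have "16 * lam \<le> \<theta> * sqrt k0" using k0 by simp
      then have "16 * lam * sqrt k0 \<le> \<theta> * sqrt k0 * sqrt k0" by (intro mult_right_mono) auto
      then have "16 * (lam * sqrt k0) \<le> \<theta> * k0" by (simp add: mult.assoc)
      then have "\<bar>N k0\<bar> \<le> \<theta> / 16 * k0" using N_le[of k0] k0 by simp
      then have "\<bar>N k0\<bar> * ((real k0 - k) / k0) \<le> \<theta> / 16 * k0 * ((real k0 - k) / k0)"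
        using True by (intro mult_right_mono) auto
      then show ?thesis using k0 by simp
    qed
    ultimately have "\<theta> * (real k0 - k) / 16 \<le> \<bar>N k0 - N k\<bar>" by linarith
    then show ?thesis using True by (simp add: abs_minus_commute)
  next
    case False
    then interpret one_side n "real n - k" "real n - k0" \<theta> "numer k" "numer k0" "N k0 - N k" "N k0 - N n"
      using k by (intro right_side) auto
    have "\<theta> * ((real n - k0) - (real n - k)) / 8
        \<le> \<bar>N k0 - N k\<bar> + \<bar>N k0 - N n\<bar> * ((real n - k0) - (real n - k)) / (real n - k0)"
    proof (rule distance_le_noise)
      show "F0 \<le> F" using le[OF k0_in] by (simp add: F_def F0_def cusum_numer mult.commute)
      show "\<bar>F0 - f0\<bar> \<le> ?\<mu>" using signal_k0 by (simp add: F0_def f0_def cusum_numer mult.commute)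
      have kk: "k0 \<le> k" "k \<le> n" using False k by auto
      have "F - f0 * \<rho> = (numer k - \<theta> * (k0 * (real n - k) / n)) / sqrt (real k * (real n - k))"
        unfolding signal_eq[symmetric] F_def diff_divide_distrib by (simp add: mult_ac)
      also have "\<dots> = (k / n * N n - N k) / sqrt (real k * (real n - k))"
        unfolding numer_right[OF kk] by simp
      finally have "F - f0 * \<rho> = (k / n * N n - N k) / sqrt (real k * (real n - k))" .
      then show "\<bar>F - f0 * \<rho>\<bar> \<le> ?\<mu>" using noise_normalised_le[of k] k by (auto simp: abs_divide)
      have "f0 = ?f" by (simp add: f0_def mult.commute)
      then show "4 * ?\<mu> \<le> f0" using f8 \<mu>0 by linarith
    qed
    moreover have "\<bar>N k0 - N n\<bar> * (real k - k0) / (real n - k0) \<le> \<theta> / 16 * (real k - k0)"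
    proof -
      have "16 * lam * sqrt n \<le> \<theta> * sqrt (real n - k0) * sqrt n"
        using order.trans[OF lam mult_left_mono[OF s(2)]] jump_pos by (simp add: mult.assoc)
      then have "16 * lam \<le> \<theta> * sqrt (real n - k0)" using k0 by simp
      then have "16 * lam * sqrt (real n - k0) \<le> \<theta> * sqrt (real n - k0) * sqrt (real n - k0)"
        using k0 by (intro mult_right_mono) auto
      then have "16 * (lam * sqrt (real n - k0)) \<le> \<theta> * (real n - k0)"
        using k0 by (simp add: mult.assoc)
      moreover have "\<bar>N k0 - N n\<bar> \<le> lam * sqrt (real n - k0)"
        using N_le'[of k0] k0 by (simp add: abs_minus_commute)
      ultimately have "\<bar>N k0 - N n\<bar> \<le> \<theta> / 16 * (real n - k0)" by linarith
      then have "\<bar>N k0 - N n\<bar> * ((real k - k0) / (real n - k0)) \<le> \<theta> / 16 * (real n - k0) * ((real k - k0) / (real n - k0))"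
        using False k0 by (intro mult_right_mono) auto
      also have "\<theta> / 16 * (real n - k0) * ((real k - k0) / (real n - k0)) = \<theta> / 16 * (real k - k0)"
      proof -
        have *: "p * q * (z / q) = p * z" if "0 < q" for p q z :: real using that by simp
        show ?thesis by (rule *) (use k0 in simp)
      qed
      finally show ?thesis by simp
    qed
    moreover have "(real n - k0) - (real n - k) = real k - k0" by simp
    ultimately have "\<theta> * (real k - k0) / 16 \<le> \<bar>N k0 - N k\<bar>"
      by (simp only:)
    then show ?thesis using False by (simp add: abs_minus_commute)
  qed
qed

theorem local_cusum_expansion:
  fixes \<gamma> :: real
  assumes \<gamma>: "0 < \<gamma>" "\<gamma> \<le> 1" "\<gamma> * n \<le> k0" "\<gamma> * n \<le> real n - k0"
    and k: "k \<in> {1..n - 1}" "\<bar>real k - real k0\<bar> \<le> \<gamma> * n / 2"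
  shows "\<bar>sqrt (real k0 * (real n - k0)) * (cusum y n k - cusum y n k0) - (N k0 - N k - \<theta> * \<bar>real k - real k0\<bar> / 2)\<bar>
    \<le> \<bar>real k - real k0\<bar> / (\<gamma> ^ 3 * n) * (8 * lam * sqrt n + 2 * \<theta> * \<bar>real k - real k0\<bar>)"
proof -
  have D: "\<bar>N k0 - N k\<bar> \<le> lam * sqrt n + lam * sqrt n"
    using k k0 by (intro abs_diff_le N_le_sqrt) auto
  have e: "\<bar>numer k0 - \<theta> * (k0 * (real n - k0) / n)\<bar> \<le> 2 * lam * sqrt n"
    unfolding numer_left[OF order.refl] using noise_le_sqrt[of k0] k0 by simp
  \<comment> \<open>The factor 8 collects 4 from the noise increment, 2 from \<open>m\<close> and 2
    from the error of the numerator at \<open>k0\<close>.\<close>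
  have concl: "\<bar>x\<bar> / (\<gamma> ^ 3 * n) * (2 * \<bar>N k0 - N k\<bar> + 2 * \<bar>m\<bar> + 2 * \<theta> * \<bar>x\<bar> + 2 * lam * sqrt n)
      \<le> \<bar>x\<bar> / (\<gamma> ^ 3 * n) * (8 * lam * sqrt n + 2 * \<theta> * \<bar>x\<bar>)" if "\<bar>m\<bar> \<le> lam * sqrt n" for m x :: real
    using D that \<gamma> by (intro mult_left_mono) auto
  show ?thesis
  proof (cases "k \<le> k0")
    case True
    then interpret one_side n k k0 \<theta> "numer k" "numer k0" "N k0 - N k" "N k0"
      using k by (intro left_side) auto
    have "\<gamma> * n / 2 \<le> k" using k True \<gamma> by auto
    from local_expansion[OF \<gamma> this e] concl[of "N k0" "real k - real k0"] N_le_sqrt(1)[of k0] k0 True show ?thesis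
      by (simp add: F_def F0_def cusum_numer abs_minus_commute)
  next
    case False
    then interpret one_side n "real n - k" "real n - k0" \<theta> "numer k" "numer k0" "N k0 - N k" "N k0 - N n"
      using k by (intro right_side) auto
    have g: "\<gamma> * n \<le> real n - (real n - k0)" "\<gamma> * n / 2 \<le> real n - k" using k False \<gamma> by auto
    have e': "\<bar>numer k0 - \<theta> * ((real n - k0) * (real n - (real n - k0)) / n)\<bar> \<le> 2 * lam * sqrt n"
      using e by (simp add: mult.commute)
    from local_expansion[OF \<gamma>(1,2,4) g e'] concl[of "N k0 - N n" "real k - real k0"] N_le_sqrt(2)[of k0] k0 False
    show ?thesis
      by (simp add: F_def F0_def cusum_numer abs_minus_commute mult.commute[of "real n - real k" "real k"]
          mult.commute[of "real n - real k0" "real k0"])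
  qed
qed

end

section \<open>Weak limits of blocks of chi-square sums\<close>

text \<open>Adding \<open>B\<close> to \<open>A n\<close> makes the indicators converge almost
  surely, so dominated convergence applies although \<open>A n\<close> itself need not
  converge.\<close>

lemma (in prob_space) prob_limsup_le:
  assumes meas: "\<And>n. A n \<in> events" "B \<in> events"
    and ev: "AE \<omega> in M. \<omega> \<notin> B \<longrightarrow> (\<forall>\<^sub>F n in sequentially. \<omega> \<notin> A n)"
    and e: "0 < e"
  shows "\<forall>\<^sub>F n in sequentially. prob (A n) \<le> prob B + e"
proof -
  have "(\<lambda>n. expectation (indicator (A n \<union> B) :: 'a \<Rightarrow> real)) \<longlonglongrightarrow> expectation (indicator B)"
  proof (rule integral_dominated_convergence[where w = "\<lambda>_. 1"])
    show "AE \<omega> in M. (\<lambda>n. indicator (A n \<union> B) \<omega> :: real) \<longlonglongrightarrow> indicator B \<omega>"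
      using ev
    proof eventually_elim
      case (elim \<omega>)
      show ?case
      proof (cases "\<omega> \<in> B")
        case False
        then have "\<forall>\<^sub>F n in sequentially. indicator (A n \<union> B) \<omega> = (indicator B \<omega> :: real)"
          using elim by (auto elim!: eventually_mono simp: indicator_def)
        then show ?thesis by (rule tendsto_eventually)
      qed simp
    qed
  qed (use meas in \<open>auto simp: indicator_def\<close>)
  then have "(\<lambda>n. prob (A n \<union> B)) \<longlonglongrightarrow> prob B" using meas by simp
  then have "\<forall>\<^sub>F n in sequentially. prob (A n \<union> B) < prob B + e"
    using e by (intro order_tendstoD) auto
  then show ?thesis
  proof eventually_elim
    case (elim n)
    have "prob (A n) \<le> prob (A n \<union> B)" using meas by (intro finite_measure_mono) auto
    then show ?case using elim by simp
  qed
qed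

text \<open>The closed-set half of the portmanteau theorem, for sets that may vary with
  \<open>n\<close>. Independent copies of Skorohod's coupling in one dimension realise the product
  laws with coordinatewise convergence. The hypothesis \<open>closed\<close> is what lets
  coefficients depending on \<open>n\<close> pass to the limit together with the point.\<close>

lemma weak_limit_product_closed:
  fixes \<mu> :: "nat \<Rightarrow> real measure" and \<nu> :: "real measure" and I :: "'i set"
  assumes I: "finite I"
    and \<mu>: "\<And>n. real_distribution (\<mu> n)" and \<nu>: "real_distribution \<nu>"
    and conv: "weak_conv_m \<mu> \<nu>"
    and F: "\<And>n. F n \<in> sets (Pi\<^sub>M I (\<lambda>_. borel))" "G \<in> sets (Pi\<^sub>M I (\<lambda>_. borel))"
    and closed: "\<And>xs x. x \<in> extensional I \<Longrightarrow> (\<And>n. xs n \<in> extensional I) \<Longrightarrow> (\<And>i. i \<in> I \<Longrightarrow> (\<lambda>n. xs n i) \<longlonglongrightarrow> x i) \<Longrightarrow> x \<notin> G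
        \<Longrightarrow> \<forall>\<^sub>F n in sequentially. xs n \<notin> F n"
    and e: "0 < e"
  shows "\<forall>\<^sub>F n in sequentially. measure (Pi\<^sub>M I (\<lambda>_. \<mu> n)) (F n) \<le> measure (Pi\<^sub>M I (\<lambda>_. \<nu>)) G + e"
proof -
  obtain \<Omega> :: "real measure" and Y_seq :: "nat \<Rightarrow> real \<Rightarrow> real" and Y :: "real \<Rightarrow> real"
    where \<Omega>: "prob_space \<Omega>" and Y_seq: "\<And>n. Y_seq n \<in> borel_measurable \<Omega>"
      and law_seq: "\<And>n. distr \<Omega> borel (Y_seq n) = \<mu> n"
      and Y': "Y \<in> measurable \<Omega> lborel" and law: "distr \<Omega> borel Y = \<nu>"
      and lim: "\<And>x. x \<in> space \<Omega> \<Longrightarrow> (\<lambda>n. Y_seq n x) \<longlonglongrightarrow> Y x"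
    using Skorohod[OF \<mu> \<nu> conv] by metis
  have Y: "Y \<in> borel_measurable \<Omega>" using Y' by simp
  interpret \<Omega>: prob_space \<Omega> by fact
  interpret P: product_prob_space "\<lambda>_. \<Omega>" I by unfold_locales
  let ?P = "Pi\<^sub>M I (\<lambda>_. \<Omega>)"
  have prodm: "Pi\<^sub>M I (\<lambda>_. distr \<Omega> borel f) = distr ?P (Pi\<^sub>M I (\<lambda>_. borel)) (\<lambda>\<omega>. \<lambda>i\<in>I. f (\<omega> i))"
    if f: "f \<in> borel_measurable \<Omega>" for f :: "real \<Rightarrow> real"
  proof -
    let ?D = "distr \<Omega> borel f"
    have "distr ?P (Pi\<^sub>M I (\<lambda>_. ?D)) (compose I f) = Pi\<^sub>M I (\<lambda>_. distr \<Omega> ?D f)"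
      using f \<Omega>.prob_space_axioms \<Omega>.prob_space_distr[OF f]
      by (intro distr_PiM_finite_prob_space'[OF I]) auto
    moreover have "distr \<Omega> ?D f = ?D" by (rule distr_cong) auto
    moreover have "distr ?P (Pi\<^sub>M I (\<lambda>_. ?D)) (compose I f) = distr ?P (Pi\<^sub>M I (\<lambda>_. borel)) (compose I f)"
      by (intro distr_cong sets_PiM_cong) auto
    moreover have "compose I f = (\<lambda>\<omega>. \<lambda>i\<in>I. f (\<omega> i))" by (simp add: compose_def fun_eq_iff)
    ultimately show ?thesis by simp
  qed
  have meas: "(\<lambda>\<omega>. \<lambda>i\<in>I. f (\<omega> i)) \<in> measurable ?P (Pi\<^sub>M I (\<lambda>_. borel))" if f: "f \<in> borel_measurable \<Omega>" for f :: "real \<Rightarrow> real"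
    using f by measurable
  define A where "A n = (\<lambda>\<omega>. \<lambda>i\<in>I. Y_seq n (\<omega> i)) -` F n \<inter> space ?P" for n
  define B where "B = (\<lambda>\<omega>. \<lambda>i\<in>I. Y (\<omega> i)) -` G \<inter> space ?P"
  have "\<forall>\<^sub>F n in sequentially. P.prob (A n) \<le> P.prob B + e"
  proof (rule P.prob_limsup_le)
    show "A n \<in> sets ?P" for n unfolding A_def by (rule measurable_sets[OF meas[OF Y_seq] F(1)])
    show "B \<in> sets ?P" unfolding B_def by (rule measurable_sets[OF meas[OF Y] F(2)])
    show "AE \<omega> in ?P. \<omega> \<notin> B \<longrightarrow> (\<forall>\<^sub>F n in sequentially. \<omega> \<notin> A n)"
    proof (intro AE_I2 impI)
      fix \<omega> assume \<omega>: "\<omega> \<in> space ?P" "\<omega> \<notin> B"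
      then have "(\<lambda>i\<in>I. Y (\<omega> i)) \<notin> G" by (simp add: B_def)
      moreover have "(\<lambda>n. (\<lambda>i\<in>I. Y_seq n (\<omega> i)) i) \<longlonglongrightarrow> (\<lambda>i\<in>I. Y (\<omega> i)) i" if "i \<in> I" for i
        using lim[of "\<omega> i"] that \<omega> by (auto simp: space_PiM)
      ultimately have "\<forall>\<^sub>F n in sequentially. (\<lambda>i\<in>I. Y_seq n (\<omega> i)) \<notin> F n"
        by (intro closed[of "\<lambda>i\<in>I. Y (\<omega> i)"]) auto
      then show "\<forall>\<^sub>F n in sequentially. \<omega> \<notin> A n"
        by (rule eventually_mono) (simp add: A_def)
    qed
  qed fact
  then show ?thesis
    unfolding law_seq[symmetric] law[symmetric] prodm[OF Y] prodm[OF Y_seq]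
    by (simp add: measure_distr[OF meas[OF Y_seq] F(1)] measure_distr[OF meas[OF Y] F(2)] A_def B_def)
qed

section \<open>Chi-square moments and the central limit theorem for their sums\<close>

definition eta4 :: real where
  "eta4 = (LINT x|std_normal_distribution. (x\<^sup>2 - 1) ^ 4)"

lemma std_normal_eta_integrable: "integrable std_normal_distribution (\<lambda>x. (x\<^sup>2 - 1) ^ j)"
proof -
  have "(x\<^sup>2 - 1) ^ j = (\<Sum>i\<le>j. real (j choose i) * x ^ (2 * i) * (- 1) ^ (j - i))" for x :: real
    using binomial_ring[of "x\<^sup>2" "-1" j] by (simp only: diff_conv_add_uminus power_mult)
  moreover have "integrable std_normal_distribution (\<lambda>x. \<Sum>i\<le>j. real (j choose i) * x ^ (2 * i) * (- 1) ^ (j - i))"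
    by (intro Bochner_Integration.integrable_sum integrable_mult_left integrable_mult_right
        integrable_std_normal_distribution_moment)
  ultimately show ?thesis by presburger
qed

text \<open>Here x^2 - 1 is a centred chi-square variable with one degree of freedom. Its fourth
  moment stays symbolic; the lower bound is the squared variance and feeds
  \<open>moments_le\<close>.\<close>

lemma std_normal_eta_moments:
  "(LINT x|std_normal_distribution. x\<^sup>2 - 1) = 0"
  "(LINT x|std_normal_distribution. (x\<^sup>2 - 1)\<^sup>2) = 2"
  "4 \<le> eta4"
proof -
  interpret real_distribution std_normal_distribution by (rule real_dist_normal_dist)
  have m2: "(LINT x|std_normal_distribution. x\<^sup>2) = 1" and m4: "(LINT x|std_normal_distribution. x ^ 4) = 3"
    using std_normal_distribution_even_moments(1)[of 1] std_normal_distribution_even_moments(1)[of 2]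
    by (simp_all add: fact_numeral eval_nat_numeral)
  note [simp] = integrable_std_normal_distribution_moment
  show "(LINT x|std_normal_distribution. x\<^sup>2 - 1) = 0"
    using m2 prob_space by simp
  have "(LINT x|std_normal_distribution. (x\<^sup>2 - 1)\<^sup>2) = (LINT x|std_normal_distribution. x ^ 4 - 2 * x\<^sup>2 + 1)"
    by (intro Bochner_Integration.integral_cong) (auto simp: power2_diff)
  then show e2: "(LINT x|std_normal_distribution. (x\<^sup>2 - 1)\<^sup>2) = 2"
    using m2 m4 prob_space by simp
  have "0 \<le> variance (\<lambda>x. (x\<^sup>2 - 1)\<^sup>2)" by (intro Bochner_Integration.integral_nonneg) auto
  also have "\<dots> = eta4 - 4"
    using std_normal_eta_integrable[of 2] std_normal_eta_integrable[of 4] e2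
    by (subst variance_eq) (simp_all add: eta4_def flip: power_mult)
  finally show "4 \<le> eta4" by simp
qed

text \<open>Living on a canonical product space, the law depends on the block length alone. One
  limit theorem then serves every sequence of block lengths tending to infinity.\<close>

definition chisq_sum_law :: "nat \<Rightarrow> real measure" where
  "chisq_sum_law m = distr (Pi\<^sub>M {..<m} (\<lambda>_. std_normal_distribution)) borel
     (\<lambda>x. (\<Sum>i<m. (x i)\<^sup>2 - 1) / sqrt (2 * real m))"

lemma real_distribution_chisq_sum_law: "real_distribution (chisq_sum_law m)"
proof -
  interpret product_prob_space "\<lambda>_. std_normal_distribution" "{..<m}"
    using real_dist_normal_dist by (intro product_prob_spaceI) (auto simp: real_distribution_def)
  show ?thesis unfolding chisq_sum_law_def
    by (rule real_distribution_distr) measurable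
qed

lemma (in prob_space) distr_sum_eq_chisq_sum_law:
  assumes ind: "indep_vars (\<lambda>_. borel) \<xi> {..<m}" and law: "\<And>i. i < m \<Longrightarrow> distr M borel (\<xi> i) = std_normal_distribution"
    and m: "0 < m"
  shows "distr M borel (\<lambda>\<omega>. (\<Sum>i<m. (\<xi> i \<omega>)\<^sup>2 - 1) / sqrt (2 * real m)) = chisq_sum_law m"
proof -
  have rv: "\<xi> i \<in> borel_measurable M" if "i \<in> {..<m}" for i using ind that by (auto simp: indep_vars_def2)
  have "distr M (Pi\<^sub>M {..<m} (\<lambda>_. borel)) (\<lambda>\<omega>. \<lambda>i\<in>{..<m}. \<xi> i \<omega>) = Pi\<^sub>M {..<m} (\<lambda>i. distr M borel (\<xi> i))"
    using ind m rv by (subst (asm) indep_vars_iff_distr_eq_PiM') auto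
  also have "\<dots> = Pi\<^sub>M {..<m} (\<lambda>_. std_normal_distribution)"
    using law by (intro PiM_cong) auto
  finally have "chisq_sum_law m = distr (distr M (Pi\<^sub>M {..<m} (\<lambda>_. borel)) (\<lambda>\<omega>. \<lambda>i\<in>{..<m}. \<xi> i \<omega>)) borel
     (\<lambda>x. (\<Sum>i<m. (x i)\<^sup>2 - 1) / sqrt (2 * real m))"
    unfolding chisq_sum_law_def by simp
  also have "\<dots> = distr M borel (\<lambda>\<omega>. (\<Sum>i<m. ((\<lambda>i\<in>{..<m}. \<xi> i \<omega>) i)\<^sup>2 - 1) / sqrt (2 * real m))"
    by (subst distr_distr) (auto simp: o_def intro!: measurable_restrict rv)
  finally show ?thesis by simp
qed

lemma chisq_sum_law_clt: "weak_conv_m chisq_sum_law std_normal_distribution"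
proof -
  interpret N: real_distribution std_normal_distribution by (rule real_dist_normal_dist)
  let ?N = "\<lambda>_::nat. std_normal_distribution"
  interpret P: product_prob_space ?N UNIV
    by (rule product_prob_spaceI) (rule N.prob_space_axioms)
  let ?P = "Pi\<^sub>M UNIV ?N"
  have coord: "(\<lambda>x. x i) \<in> borel_measurable ?P" for i by measurable
  have law: "distr ?P borel (\<lambda>x. x i) = std_normal_distribution" for i
  proof -
    have "distr ?P borel (\<lambda>x. x i) = distr ?P std_normal_distribution (\<lambda>x. x i)" by (rule distr_cong) auto
    then show ?thesis using distr_PiM_component[of UNIV ?N i] N.prob_space_axioms by simp
  qed
  have "sets (Pi\<^sub>M (UNIV :: nat set) (\<lambda>_. borel :: real measure)) = sets ?P"
    by (intro sets_PiM_cong) auto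
  then have "distr ?P (Pi\<^sub>M UNIV (\<lambda>_. borel)) (\<lambda>x. \<lambda>i\<in>UNIV. x i) = ?P"
    by (simp add: restrict_UNIV distr_id2)
  then have ind: "P.indep_vars (\<lambda>_. borel) (\<lambda>i x. x i) UNIV"
    by (subst P.indep_vars_iff_distr_eq_PiM) (use coord in \<open>simp_all add: law\<close>)
  then have ind_eta: "P.indep_vars (\<lambda>_. borel) (\<lambda>i x. (x i)\<^sup>2 - 1) UNIV"
    using P.indep_vars_compose2[OF ind, of "\<lambda>_ x. x\<^sup>2 - 1"] by simp
  have int: "(LINT x|?P. f (x i)) = (LINT x|std_normal_distribution. f x)" if "f \<in> borel_measurable borel" for i and f :: "real \<Rightarrow> real"
    using that by (subst law[symmetric, of i], subst integral_distr) (auto intro: coord)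
  have mean: "P.expectation (\<lambda>x. (x i)\<^sup>2 - 1) = 0" for i
    using int[of "\<lambda>x. x\<^sup>2 - 1" i] std_normal_eta_moments(1) by simp
  have var: "P.expectation (\<lambda>x. ((x i)\<^sup>2 - 1)\<^sup>2) = 2" for i
    using int[of "\<lambda>x. (x\<^sup>2 - 1)\<^sup>2" i] std_normal_eta_moments(2) by simp
  have sq: "integrable ?P (\<lambda>x. ((x i)\<^sup>2 - 1)\<^sup>2)" for i
    using std_normal_eta_integrable[of 2] by (subst (asm) law[symmetric, of i], subst (asm) integrable_distr_eq) (auto intro: coord)
  have "weak_conv_m (\<lambda>n. distr ?P borel (\<lambda>x. (\<Sum>i<n. (x i)\<^sup>2 - 1) / sqrt (real n * (sqrt 2)\<^sup>2))) std_normal_distribution"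
  proof (rule P.central_limit_theorem_zero_mean[OF ind_eta mean _ sq])
    show "P.variance (\<lambda>x. (x i)\<^sup>2 - 1) = (sqrt 2)\<^sup>2" for i
      using var by (simp add: mean)
    show "distr ?P borel (\<lambda>x. (x i)\<^sup>2 - 1) = distr std_normal_distribution borel (\<lambda>x. x\<^sup>2 - 1)" for i
      by (subst law[symmetric, of i], subst distr_distr) (auto simp: o_def intro: coord)
  qed simp
  moreover have "distr ?P borel (\<lambda>x. (\<Sum>i<n. (x i)\<^sup>2 - 1) / sqrt (real n * (sqrt 2)\<^sup>2)) = chisq_sum_law n" for n
  \<comment> \<open>The normalisation divides by 0 for \<open>n = 0\<close>, but the sum is empty:
    both laws are the point mass at 0.\<close>
  proof (cases "n = 0")
    case True
    have "emeasure (Pi\<^sub>M {} ?N) (space (Pi\<^sub>M {} ?N)) = 1"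
      by (intro prob_space.emeasure_space_1 prob_space_PiM N.prob_space_axioms)
    then show ?thesis unfolding True chisq_sum_law_def
      by (intro measure_eqI) (auto simp: emeasure_distr vimage_def P.emeasure_space_1 Int_def)
  next
    case False
    then show ?thesis
      using P.distr_sum_eq_chisq_sum_law[OF P.indep_vars_subset[OF ind] law, of n] by (simp add: mult.commute)
  qed
  ultimately show ?thesis by simp
qed

lemma chisq_sum_law_conv:
  assumes "filterlim m at_top sequentially"
  shows "weak_conv_m (\<lambda>n. chisq_sum_law (m n)) std_normal_distribution"
  using chisq_sum_law_clt assms unfolding weak_conv_m_def weak_conv_def
  by (auto intro: filterlim_compose)

section \<open>Brownian motion with triangular drift\<close>

text \<open>A substitute for "outer measure zero": \<open>B\<close> quantifies over uncountably many
  times in its uses and need not be measurable. It is covered almost surely by the lower limit of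
  \<open>A n\<close>, which has probability at most \<open>e\<close>; intersecting over
  \<open>e = 1 / (j + 1)\<close> gives a null set.\<close>

lemma (in prob_space) AE_not_if_eventually_small:
  assumes "\<And>e. 0 < e \<Longrightarrow> \<exists>A. (\<forall>n. A n \<in> events \<and> prob (A n) \<le> e) \<and> (AE \<omega> in M. B \<omega> \<longrightarrow> (\<forall>\<^sub>F n in sequentially. \<omega> \<in> A n))"
  shows "AE \<omega> in M. \<not> B \<omega>"
proof -
  have "\<exists>A. (\<forall>n. A n \<in> events \<and> prob (A n) \<le> inverse (real (Suc j))) \<and>
      (AE \<omega> in M. B \<omega> \<longrightarrow> (\<forall>\<^sub>F n in sequentially. \<omega> \<in> A n))" for j
    by (rule assms) simp
  then have "\<forall>j. \<exists>A. (\<forall>n. A n \<in> events \<and> prob (A n) \<le> inverse (real (Suc j))) \<and>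
      (AE \<omega> in M. B \<omega> \<longrightarrow> (\<forall>\<^sub>F n in sequentially. \<omega> \<in> A n))" ..
  from choice[OF this] obtain A where A: "\<And>j n. A j n \<in> events" "\<And>j n. prob (A j n) \<le> inverse (real (Suc j))"
      and ev: "\<And>j. AE \<omega> in M. B \<omega> \<longrightarrow> (\<forall>\<^sub>F n in sequentially. \<omega> \<in> A j n)"
    by blast
  have inter: "(\<Inter>n\<in>{m..}. A j n) \<in> events" for j and m :: nat
    using A(1) by (intro sets.countable_INT'[of "{m..}"]) auto
  define L where "L j = (\<Union>m. \<Inter>n\<in>{m..}. A j n)" for j
  have L: "L j \<in> events" for j
    unfolding L_def by (intro sets.countable_UN image_subsetI inter)
  have prob_L: "prob (L j) \<le> inverse (real (Suc j))" for j
  proof -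
    have "(\<lambda>m. prob (\<Inter>n\<in>{m..}. A j n)) \<longlonglongrightarrow> prob (L j)"
      unfolding L_def
    proof (rule finite_Lim_measure_incseq)
      show "range (\<lambda>m. \<Inter>n\<in>{m..}. A j n) \<subseteq> events"
        by (intro image_subsetI inter)
      show "incseq (\<lambda>m. \<Inter>n\<in>{m..}. A j n)" by (auto simp: incseq_def)
    qed
    moreover have "prob (\<Inter>n\<in>{m..}. A j n) \<le> inverse (real (Suc j))" for m
    proof -
      have "prob (\<Inter>n\<in>{m..}. A j n) \<le> prob (A j m)" by (intro finite_measure_mono A(1)) auto
      then show ?thesis using A(2)[of j m] by linarith
    qed
    ultimately show ?thesis by (intro LIMSEQ_le_const2) auto
  qed
  have L_all: "(\<Inter>j. L j) \<in> events" by (intro sets.countable_INT image_subsetI L UNIV_not_empty)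
  have "prob (\<Inter>j. L j) \<le> inverse (real (Suc j))" for j
  proof -
    have "prob (\<Inter>j. L j) \<le> prob (L j)" by (intro finite_measure_mono L) auto
    then show ?thesis using prob_L[of j] by linarith
  qed
  then have "prob (\<Inter>j. L j) \<le> 0"
    using LIMSEQ_inverse_real_of_nat by (intro LIMSEQ_le_const) auto
  then have "prob (\<Inter>j. L j) = 0" using measure_nonneg[of M "\<Inter>j. L j"] by linarith
  then have "AE \<omega> in M. \<omega> \<notin> (\<Inter>j. L j)"
    using prob_eq_0[OF L_all] by simp
  moreover have "AE \<omega> in M. \<forall>j. B \<omega> \<longrightarrow> (\<forall>\<^sub>F n in sequentially. \<omega> \<in> A j n)"
    unfolding AE_all_countable using ev by blast
  ultimately show ?thesis
  proof eventually_elim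
    case (elim \<omega>)
    show "\<not> B \<omega>"
    proof
      assume "B \<omega>"
      have "\<omega> \<in> L j" for j
      proof -
        have "\<forall>\<^sub>F n in sequentially. \<omega> \<in> A j n" using elim(2) \<open>B \<omega>\<close> by simp
        then obtain m where "\<And>n. m \<le> n \<Longrightarrow> \<omega> \<in> A j n" unfolding eventually_sequentially by metis
        then show ?thesis unfolding L_def by (intro UN_I[of m] INT_I) auto
      qed
      then show False using elim(1) by blast
    qed
  qed
qed

lemma normal_density_le: "0 < \<sigma> \<Longrightarrow> normal_density \<mu> \<sigma> x \<le> 1 / \<sigma>"
proof -
  assume \<sigma>: "0 < \<sigma>"
  have "1 \<le> sqrt (2 * pi)" using pi_gt3 by simp
  then have "\<sigma> \<le> sqrt (2 * pi * \<sigma>\<^sup>2)" using \<sigma> by (simp add: real_sqrt_mult)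
  then have "1 / sqrt (2 * pi * \<sigma>\<^sup>2) * exp (- (x - \<mu>)\<^sup>2 / (2 * \<sigma>\<^sup>2)) \<le> 1 / \<sigma> * 1"
    using \<sigma> by (intro mult_mono divide_left_mono) auto
  then show ?thesis by (simp add: normal_density_def)
qed

text \<open>Given \<open>X\<close>, the variable \<open>Y\<close> must fall into an interval of
  length 2 \<epsilon>, and its density is at most 1 / \<sigma>. No information on the law of
  \<open>X\<close> enters.\<close>

lemma (in prob_space) normal_anticoncentration:
  assumes ind: "indep_var borel X borel Y" and Y: "distributed M lborel Y (normal_density 0 \<sigma>)"
    and \<sigma>: "0 < \<sigma>" and \<epsilon>: "0 \<le> \<epsilon>"
  shows "prob {\<omega> \<in> space M. \<bar>X \<omega> + Y \<omega>\<bar> \<le> \<epsilon>} \<le> 2 * \<epsilon> / \<sigma>"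
proof -
  have rv: "X \<in> borel_measurable M" "Y \<in> borel_measurable M"
    using ind by (auto dest: indep_var_rv1 indep_var_rv2)
  have lawY: "distr M borel Y = density lborel (normal_density 0 \<sigma>)"
    using distributed_distr_eq_density[OF Y] by (simp add: distr_cong[of M M borel lborel Y Y])
  interpret X: prob_space "distr M borel X" by (rule prob_space_distr) fact
  interpret Y: prob_space "distr M borel Y" by (rule prob_space_distr) fact
  define A where "A = {p :: real \<times> real. \<bar>fst p + snd p\<bar> \<le> \<epsilon>}"
  have "A = {p \<in> space (borel \<Otimes>\<^sub>M borel). \<bar>fst p + snd p\<bar> \<le> \<epsilon>}" by (simp add: A_def space_pair_measure)
  also have "\<dots> \<in> sets (borel \<Otimes>\<^sub>M borel)" by measurable
  finally have A: "A \<in> sets (borel \<Otimes>\<^sub>M borel)" .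
  have slice: "emeasure (distr M borel Y) (Pair x -` A) \<le> ennreal (2 * \<epsilon> / \<sigma>)" for x
  proof -
    have eq: "Pair x -` A = {-\<epsilon> - x..\<epsilon> - x}" by (auto simp: A_def abs_le_iff)
    have "emeasure (distr M borel Y) (Pair x -` A) = (\<integral>\<^sup>+y. ennreal (normal_density 0 \<sigma> y) * indicator {-\<epsilon> - x..\<epsilon> - x} y \<partial>lborel)"
      unfolding lawY eq by (subst emeasure_density) auto
    also have "\<dots> \<le> (\<integral>\<^sup>+y. ennreal (1 / \<sigma>) * indicator {-\<epsilon> - x..\<epsilon> - x} y \<partial>lborel)"
      using normal_density_le[OF \<sigma>] by (intro nn_integral_mono mult_right_mono ennreal_leI) auto
    also have "\<dots> = ennreal (1 / \<sigma>) * ennreal (2 * \<epsilon>)"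
      using \<epsilon> by (subst nn_integral_cmult_indicator) auto
    also have "\<dots> = ennreal (2 * \<epsilon> / \<sigma>)" using \<sigma> \<epsilon> by (simp flip: ennreal_mult)
    finally show ?thesis .
  qed
  have "{\<omega> \<in> space M. \<bar>X \<omega> + Y \<omega>\<bar> \<le> \<epsilon>} = (\<lambda>\<omega>. (X \<omega>, Y \<omega>)) -` A \<inter> space M"
    by (auto simp: A_def)
  then have "emeasure M {\<omega> \<in> space M. \<bar>X \<omega> + Y \<omega>\<bar> \<le> \<epsilon>} = emeasure (distr M (borel \<Otimes>\<^sub>M borel) (\<lambda>\<omega>. (X \<omega>, Y \<omega>))) A"
    using A rv by (subst emeasure_distr) auto
  also have "distr M (borel \<Otimes>\<^sub>M borel) (\<lambda>\<omega>. (X \<omega>, Y \<omega>)) = distr M borel X \<Otimes>\<^sub>M distr M borel Y"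
    using ind by (simp add: indep_var_distribution_eq)
  also have "emeasure (distr M borel X \<Otimes>\<^sub>M distr M borel Y) A
      = (\<integral>\<^sup>+x. emeasure (distr M borel Y) (Pair x -` A) \<partial>distr M borel X)"
    using A by (intro Y.emeasure_pair_measure_alt) simp
  also have "\<dots> \<le> (\<integral>\<^sup>+x. ennreal (2 * \<epsilon> / \<sigma>) \<partial>distr M borel X)"
    by (intro nn_integral_mono slice)
  also have "\<dots> = ennreal (2 * \<epsilon> / \<sigma>)" using X.emeasure_space_1 by simp
  finally show ?thesis using \<sigma> \<epsilon> by (simp add: emeasure_eq_measure)
qed

lemma (in prob_space) distr_normal_standardised:
  assumes Y: "distributed M lborel Y (normal_density 0 \<sigma>)" and \<sigma>: "0 < \<sigma>" and c: "\<bar>c\<bar> * \<sigma> = 1"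
  shows "distr M borel (\<lambda>\<omega>. c * Y \<omega>) = std_normal_distribution"
proof -
  have "c \<noteq> 0" using c by auto
  then have "distributed M lborel (\<lambda>\<omega>. c * Y \<omega>) std_normal_density"
    using normal_density_affine[OF Y \<sigma>, of c 0] c by simp
  then have "distr M lborel (\<lambda>\<omega>. c * Y \<omega>) = std_normal_distribution"
    by (rule distributed_distr_eq_density)
  then show ?thesis by (simp add: distr_cong[of M M borel lborel "\<lambda>\<omega>. c * Y \<omega>" "\<lambda>\<omega>. c * Y \<omega>"])
qed

lemma (in prob_space) std_normal_law_integral:
  assumes law: "distr M borel Z = std_normal_distribution" and Z: "Z \<in> borel_measurable M"
    and f: "f \<in> borel_measurable borel" and int: "integrable std_normal_distribution f"
  shows "integrable M (\<lambda>\<omega>. f (Z \<omega>))" and "expectation (\<lambda>\<omega>. f (Z \<omega>)) = (LINT x|std_normal_distribution. f x :: real)"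
  using int integrable_distr_eq[OF Z f] integral_distr[OF Z f] unfolding law by simp_all

lemma interval_grid_point:
  fixes lo hi u :: real
  assumes "lo \<le> u" "u \<le> hi" "0 < p"
  shows "\<exists>i\<le>p. \<bar>lo + (hi - lo) * real i / real p - u\<bar> \<le> (hi - lo) / real p"
proof (cases "lo = hi")
  case True
  then show ?thesis using assms by (intro exI[of _ 0]) auto
next
  case False
  then have d: "0 < hi - lo" using assms by simp
  define x where "x = (u - lo) * real p / (hi - lo)"
  have x: "0 \<le> x" "x \<le> real p" using assms d by (auto simp: x_def divide_le_eq mult_mono)
  define i where "i = nat \<lfloor>x\<rfloor>"
  have i: "real i \<le> x" "x \<le> real i + 1" using x unfolding i_def by linarith+
  have "(hi - lo) * real i / real p - (u - lo) = (real i - x) * ((hi - lo) / real p)"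
    using d assms by (simp add: x_def field_simps)
  moreover have "\<bar>\<dots>\<bar> \<le> 1 * ((hi - lo) / real p)"
    unfolding abs_mult using i d by (intro mult_mono) auto
  moreover have "i \<le> p" using i x by linarith
  ultimately show ?thesis by (intro exI[of _ i]) (simp add: algebra_simps)
qed

section \<open>Linear growth of Brownian motion\<close>

context standard_brownian_motion
begin

text \<open>The slope 1 / 4 is half of the drift 1 / 2, so the drifted process still falls at least
  like -|v| / 4. The proof applies \<open>prob_S_linear_le\<close> to the increments over finer and
  finer grids.\<close>

lemma linear_growth: "AE \<omega> in M. \<exists>T. \<forall>t>T. \<bar>W t \<omega>\<bar> \<le> t / 4"
proof -
  have "AE \<omega> in M. \<not> (\<forall>T::nat. \<exists>t>T. t / 4 < \<bar>W t \<omega>\<bar>)"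
  proof (rule AE_not_if_eventually_small)
    fix e :: real assume e: "0 < e"
    \<comment> \<open>The maximal inequality with slope 1 / 4 from time \<open>T\<close> on gives 2
      / (T (1/4)^2) = 32 / T.\<close>
    obtain T :: nat where T: "32 / e < real T" using reals_Archimedean2 by blast
    have "0 < 32 / e" using e by simp
    then have T0: "0 < T" using T by (cases T) auto
    define h where "h q = inverse (real (Suc q))" for q
    define D where "D q k \<omega> = W (real k * h q) \<omega> - W 0 \<omega>" for q k \<omega>
    \<comment> \<open>The squared number of steps lets a single index refine the mesh 1 / (q + 1)
      and push the horizon out to time q + 1.\<close>
    define A where "A q = {\<omega> \<in> space M. \<exists>k<(Suc q)\<^sup>2. T * Suc q \<le> Suc k \<and> h q / 4 * Suc k \<le> \<bar>D q (Suc k) \<omega>\<bar>}" for q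
    have h: "0 < h q" for q by (simp add: h_def)
    have prob_A: "prob (A q) \<le> e" for q
    proof -
      define X where "X i \<omega> = W (real (Suc i) * h q) \<omega> - W (real i * h q) \<omega>" for i \<omega>
      have nd: "distributed M lborel (X i) (normal_density 0 (sqrt (h q)))" for i
        using normal_increments[of "real i * h q" "real (Suc i) * h q"] h[of q]
        by (simp add: X_def[abs_def] algebra_simps)
      define Z where "Z i \<omega> = 1 / sqrt (h q) * X i \<omega>" for i \<omega>
      have law: "distr M borel (Z i) = std_normal_distribution" for i
        unfolding Z_def[abs_def] using h[of q] by (intro distr_normal_standardised[OF nd]) auto
      have rvX: "X i \<in> borel_measurable M" for i
        using distributed_measurable[OF nd[of i]] by simp
      then have rvZ: "Z i \<in> borel_measurable M" for i unfolding Z_def[abs_def] by measurable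
      have XZ: "X i \<omega> ^ j = sqrt (h q) ^ j * Z i \<omega> ^ j" for i j \<omega>
        using h[of q] by (simp add: Z_def power_mult_distrib[symmetric])
      have mom: "integrable M (\<lambda>\<omega>. Z i \<omega> ^ j)" "expectation (\<lambda>\<omega>. Z i \<omega> ^ j) = (LINT x|std_normal_distribution. x ^ j)" for i j
        using std_normal_law_integral[OF law rvZ, of "\<lambda>x. x ^ j"] integrable_std_normal_distribution_moment
        by simp_all
      interpret indep_centred M X "(Suc q)\<^sup>2" "h q" "3 * (h q)\<^sup>2"
      proof
        show "indep_vars (\<lambda>_. borel) X {..<(Suc q)\<^sup>2}"
          unfolding X_def[abs_def]
          using indep_increments[of "\<lambda>i. real i * h q" "(Suc q)\<^sup>2"] h[of q]
          by (auto simp: mono_def mult_right_mono)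
        show "integrable M (\<lambda>\<omega>. X i \<omega> ^ 4)" for i unfolding XZ using mom(1) by simp
        have "X i = (\<lambda>\<omega>. sqrt (h q) ^ 1 * Z i \<omega> ^ 1)" for i using XZ[of i _ 1] by (simp add: fun_eq_iff)
        then show "expectation (X i) = 0" for i
          using mom(2)[of i 1] integral_std_normal_distribution_moment_odd[of 1] by simp
        show "expectation (\<lambda>\<omega>. X i \<omega> ^ 2) \<le> h q" for i
          unfolding XZ using mom(2)[of i 2] std_normal_distribution_even_moments(1)[of 1] h[of q] by simp
        show "expectation (\<lambda>\<omega>. X i \<omega> ^ 4) \<le> 3 * (h q)\<^sup>2" for i
          unfolding XZ using mom(2)[of i 4] std_normal_distribution_even_moments(1)[of 2] h[of q]
          by (simp add: fact_numeral eval_nat_numeral)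
      qed (use h[of q] in auto)
      have "indep_centred.S X k \<omega> = D q k \<omega>" for k \<omega>
        unfolding D_def indep_centred.S_def[OF indep_centred_axioms] X_def
        by (subst sum_lessThan_telescope) simp
      then have "prob (A q) \<le> 2 * h q / (real (T * Suc q) * (h q / 4)\<^sup>2)"
        using prob_S_linear_le[of "h q / 4" "T * Suc q"] T0 h[of q] unfolding A_def by simp
      also have "\<dots> = 32 / (real T * (real (Suc q) * h q))"
        unfolding of_nat_mult power2_eq_square using h[of q] T0 by (simp add: field_simps del: of_nat_Suc)
      also have "real (Suc q) * h q = 1" by (simp add: h_def)
      also have "32 / (real T * 1) \<le> e" using T e T0 by (simp add: field_simps)
      finally show ?thesis .
    qed
    have meas_A: "A q \<in> events" for q
      unfolding A_def D_def using h[of q]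
      by (intro sets_Ex_less sets.sets_Collect_conj sets.sets_Collect_const borel_measurable_le
          borel_measurable_abs borel_measurable_diff borel_measurable_const random_variable_W) auto
    have "AE \<omega> in M. (\<forall>T::nat. \<exists>t>T. t / 4 < \<bar>W t \<omega>\<bar>) \<longrightarrow> (\<forall>\<^sub>F q in sequentially. \<omega> \<in> A q)"
      using start_zero continuous_paths AE_space
    proof eventually_elim
      case (elim \<omega>)
      show ?case
      proof
        assume "\<forall>T::nat. \<exists>t>T. t / 4 < \<bar>W t \<omega>\<bar>"
        then obtain t where t: "real T < t" "t / 4 < \<bar>W t \<omega>\<bar>" by blast
        have tpos: "0 < t" using t T0 by simp
        \<comment> \<open>The grid point at or just above \<open>t\<close>; by continuity it
          inherits the strict inequality for fine grids.\<close>
        define s where "s q = real (nat \<lceil>t * real (Suc q)\<rceil>) * h q" for q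
        have s: "t \<le> s q" "s q \<le> t + h q" for q
        proof -
          have "t * real (Suc q) \<le> real (nat \<lceil>t * real (Suc q)\<rceil>)" "real (nat \<lceil>t * real (Suc q)\<rceil>) \<le> t * real (Suc q) + 1"
            using tpos by (linarith, simp add: of_nat_nat del: of_nat_Suc)
          then have "t * real (Suc q) * h q \<le> s q" "s q \<le> (t * real (Suc q) + 1) * h q"
            unfolding s_def using h[of q] by (auto intro!: mult_right_mono simp del: of_nat_Suc)
          moreover have "t * real (Suc q) * h q = t" by (simp add: h_def del: of_nat_Suc)
          ultimately show "t \<le> s q" "s q \<le> t + h q" by (simp_all only: distrib_right mult_1)
        qed
        have "h \<longlonglongrightarrow> 0" unfolding h_def[abs_def] by (rule LIMSEQ_inverse_real_of_nat)
        then have "s \<longlonglongrightarrow> t"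
          using tendsto_add[OF tendsto_const[of t] \<open>h \<longlonglongrightarrow> 0\<close>] s
          by (intro tendsto_sandwich[of "\<lambda>_. t" s _ "\<lambda>q. t + h q"]) auto
        moreover have "(\<lambda>q. W (s q) \<omega>) \<longlonglongrightarrow> W t \<omega>"
        proof (rule continuous_on_tendsto_compose[OF elim(2) \<open>s \<longlonglongrightarrow> t\<close>])
          show "\<forall>\<^sub>F q in sequentially. s q \<in> {0..}"
            using order.trans[OF less_imp_le[OF tpos] s(1)] by simp
        qed (use tpos in auto)
        ultimately have "(\<lambda>q. \<bar>W (s q) \<omega>\<bar> - s q * (1 / 4)) \<longlonglongrightarrow> \<bar>W t \<omega>\<bar> - t * (1 / 4)"
          by (intro tendsto_diff tendsto_rabs tendsto_mult tendsto_const)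
        then have "(\<lambda>q. \<bar>W (s q) \<omega>\<bar> - s q / 4) \<longlonglongrightarrow> \<bar>W t \<omega>\<bar> - t / 4" by simp
        then have "\<forall>\<^sub>F q in sequentially. 0 < \<bar>W (s q) \<omega>\<bar> - s q / 4"
          using t by (intro order_tendstoD) auto
        moreover have "\<forall>\<^sub>F q in sequentially. t + 1 \<le> real (Suc q)"
          by (rule eventually_sequentiallyI[of "nat \<lceil>t\<rceil>"]) linarith
        ultimately show "\<forall>\<^sub>F q in sequentially. \<omega> \<in> A q"
        proof eventually_elim
          case (elim q)
          define k where "k = nat \<lceil>t * real (Suc q)\<rceil> - 1"
          have "0 < t * real (Suc q)" using tpos by simp
          then have k: "Suc k = nat \<lceil>t * real (Suc q)\<rceil>" unfolding k_def by linarith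
          have sk: "s q = real (Suc k) * h q" unfolding s_def k ..
          have "real (Suc k) \<le> t * real (Suc q) + 1" unfolding k using tpos by (simp add: of_nat_nat del: of_nat_Suc)
          also have "\<dots> \<le> (t + 1) * real (Suc q)" by (simp add: algebra_simps)
          also have "\<dots> \<le> real (Suc q) * real (Suc q)" using elim by (intro mult_right_mono) auto
          finally have "real (Suc k) \<le> real (Suc q * Suc q)" unfolding of_nat_mult .
          then have "Suc k \<le> Suc q * Suc q" by (simp only: of_nat_le_iff)
          then have "k < (Suc q)\<^sup>2" by (simp add: power2_eq_square)
          moreover have "real (T * Suc q) \<le> t * real (Suc q)"
            unfolding of_nat_mult using t by (intro mult_right_mono) auto
          then have "T * Suc q \<le> Suc k" unfolding k by linarith
          moreover have "h q / 4 * Suc k \<le> \<bar>D q (Suc k) \<omega>\<bar>"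
            using elim \<open>W 0 \<omega> = 0\<close> unfolding sk D_def by (simp add: mult.commute)
          ultimately show ?case using \<open>\<omega> \<in> space M\<close> unfolding A_def by blast
        qed
      qed
    qed
    then show "\<exists>A. (\<forall>n. A n \<in> events \<and> prob (A n) \<le> e) \<and>
        (AE \<omega> in M. (\<forall>T::nat. \<exists>t>T. t / 4 < \<bar>W t \<omega>\<bar>) \<longrightarrow> (\<forall>\<^sub>F n in sequentially. \<omega> \<in> A n))"
      using meas_A prob_A by blast
  qed
  then show ?thesis by (rule eventually_mono) (metis linorder_not_less)
qed

end

text \<open>What is used of a typical path of the limit process, so that arguments about its
  maximiser become deterministic.\<close>

locale peaked =
  fixes g :: "real \<Rightarrow> real" and V :: real
  assumes cont: "continuous_on UNIV g"
    and tail: "\<exists>T. \<forall>v. T < \<bar>v\<bar> \<longrightarrow> g v \<le> - (\<bar>v\<bar> / 4)"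
    and max: "\<And>v. g v \<le> g V"
    and unique: "\<And>v. g v = g V \<Longrightarrow> v = V"
begin

lemma near: "0 < \<epsilon> \<Longrightarrow> \<exists>\<delta>>0. \<forall>s. \<bar>s - V\<bar> < \<delta> \<longrightarrow> g V - \<epsilon> < g s"
proof -
  assume "0 < \<epsilon>"
  then obtain \<delta> where "\<delta> > 0" "\<And>s. dist s V < \<delta> \<Longrightarrow> dist (g s) (g V) < \<epsilon>"
    using cont unfolding continuous_on_iff by (metis UNIV_I)
  then show ?thesis by (intro exI[of _ \<delta>]) (force simp: dist_real_def)
qed

text \<open>The maximum is well separated: far out the tail bound gives a gap of 1, and on the
  remaining compact part a maximum over \<open>S\<close> is attained and is strictly smaller by
  uniqueness.\<close>

lemma gap:
  assumes S: "closed S" "V \<notin> S"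
  shows "\<exists>\<gamma>>0. \<forall>s\<in>S. g s \<le> g V - \<gamma>"
proof -
  obtain T where T: "\<And>v. T < \<bar>v\<bar> \<Longrightarrow> g v \<le> - (\<bar>v\<bar> / 4)" using tail by blast
  define R where "R = max (max T 0) (4 * (1 - g V))"
  have far: "g v \<le> g V - 1" if "R < \<bar>v\<bar>" for v
  proof -
    have "T < \<bar>v\<bar>" "4 * (1 - g V) < \<bar>v\<bar>" using that by (simp_all add: R_def)
    with T[OF this(1)] show ?thesis by argo
  qed
  show ?thesis
  proof (cases "S \<inter> {-R..R} = {}")
    case True
    have "g s \<le> g V - 1" if "s \<in> S" for s
    proof (rule far)
      have "s \<notin> {-R..R}" using True that by blast
      then show "R < \<bar>s\<bar>" by auto
    qed
    then show ?thesis by (intro exI[of _ 1]) auto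
  next
    case False
    have "compact (S \<inter> {-R..R})" using S(1) by (intro closed_Int_compact) auto
    then obtain m where m: "m \<in> S \<inter> {-R..R}" "\<And>s. s \<in> S \<inter> {-R..R} \<Longrightarrow> g s \<le> g m"
      using continuous_attains_sup[OF _ False, of g] continuous_on_subset[OF cont] by blast
    have "g m < g V" using max[of m] unique[of m] m S(2) by (cases "g m = g V") auto
    moreover have "g s \<le> g V - min 1 (g V - g m)" if "s \<in> S" for s
    proof (cases "R < \<bar>s\<bar>")
      case False
      then have "s \<in> S \<inter> {-R..R}" using that by auto
      from m(2)[OF this] show ?thesis by linarith
    qed (use far[of s] in linarith)
    ultimately show ?thesis by (intro exI[of _ "min 1 (g V - g m)"]) auto
  qed
qed

text \<open>Almost maximisers over fine grids converge to \<open>V\<close>. A grid point within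
  three cells of \<open>S\<close> is eventually bounded away from \<open>V\<close>, so it loses a
  fixed amount against the grid point next to \<open>V\<close>.\<close>

lemma grid_maximiser_near:
  assumes S: "closed S" "V \<notin> S"
    and h: "h \<longlonglongrightarrow> 0" "\<And>q. 0 < h q" and c: "c \<longlonglongrightarrow> 0" and J: "\<And>q. 0 < J q"
    and K: "filterlim (\<lambda>q. real (J q) * h q) at_top sequentially"
  shows "\<forall>\<^sub>F q in sequentially. \<not> (\<exists>j\<le>2 * J q. (\<exists>s\<in>S. \<bar>(real j - real (J q)) * h q - s\<bar> \<le> 3 * h q) \<and>
      (\<forall>i\<le>2 * J q. g ((real i - real (J q)) * h q) \<le> g ((real j - real (J q)) * h q) + c q))"
proof -
  have "open (- S)" "V \<in> - S" using S by auto
  then obtain \<eta> where \<eta>: "0 < \<eta>" "\<And>s. \<bar>s - V\<bar> < \<eta> \<Longrightarrow> s \<notin> S"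
    unfolding open_dist dist_real_def by (metis ComplD)
  have "closed {v. \<eta> / 2 \<le> \<bar>v - V\<bar>}" by (intro closed_Collect_le continuous_intros)
  then obtain \<gamma> where \<gamma>: "0 < \<gamma>" "\<And>v. \<eta> / 2 \<le> \<bar>v - V\<bar> \<Longrightarrow> g v \<le> g V - \<gamma>"
    using gap[of "{v. \<eta> / 2 \<le> \<bar>v - V\<bar>}"] \<eta>(1) by auto
  obtain \<delta> where \<delta>: "0 < \<delta>" "\<And>s. \<bar>s - V\<bar> < \<delta> \<Longrightarrow> g V - \<gamma> / 2 < g s"
    using near[of "\<gamma> / 2"] \<gamma>(1) by auto
  have "\<forall>\<^sub>F q in sequentially. h q < min \<delta> (\<eta> / 6)"
    using h(1) \<delta>(1) \<eta>(1) by (intro order_tendstoD) auto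
  moreover have "\<forall>\<^sub>F q in sequentially. c q < \<gamma> / 2"
    using c \<gamma>(1) by (intro order_tendstoD) auto
  moreover have "\<forall>\<^sub>F q in sequentially. \<bar>V\<bar> \<le> real (J q) * h q"
    using K by (simp add: filterlim_at_top)
  ultimately show ?thesis
  proof eventually_elim
    case (elim q)
    have V: "- (real (J q) * h q) \<le> V" "V \<le> real (J q) * h q" using elim(3) by linarith+
    obtain i where i: "i \<le> 2 * J q"
      "\<bar>- (real (J q) * h q) + (real (J q) * h q - - (real (J q) * h q)) * real i / real (2 * J q) - V\<bar>
        \<le> (real (J q) * h q - - (real (J q) * h q)) / real (2 * J q)"
      using interval_grid_point[OF V, of "2 * J q"] J[of q] by auto
    have "(real (J q) * h q - - (real (J q) * h q)) * real i / real (2 * J q) = real i * h q"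
      "(real (J q) * h q - - (real (J q) * h q)) / real (2 * J q) = h q"
      using J[of q] by (simp_all add: field_simps)
    with i have "\<bar>(real i - real (J q)) * h q - V\<bar> \<le> h q" by (simp add: algebra_simps)
    then have gi: "g V - \<gamma> / 2 < g ((real i - real (J q)) * h q)" using elim(1) by (intro \<delta>(2)) auto
    show ?case
    proof
      assume "\<exists>j\<le>2 * J q. (\<exists>s\<in>S. \<bar>(real j - real (J q)) * h q - s\<bar> \<le> 3 * h q) \<and>
        (\<forall>i\<le>2 * J q. g ((real i - real (J q)) * h q) \<le> g ((real j - real (J q)) * h q) + c q)"
      then obtain j s where j: "s \<in> S" "\<bar>(real j - real (J q)) * h q - s\<bar> \<le> 3 * h q"
        "\<And>i. i \<le> 2 * J q \<Longrightarrow> g ((real i - real (J q)) * h q) \<le> g ((real j - real (J q)) * h q) + c q"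
        by blast
      have "\<eta> \<le> \<bar>s - V\<bar>" using \<eta>(2)[of s] j(1) by (auto simp: not_less[symmetric])
      then have "\<eta> / 2 \<le> \<bar>(real j - real (J q)) * h q - V\<bar>" using j(2) elim(1) by linarith
      from \<gamma>(2)[OF this] j(3)[OF i(1)] gi elim(2) show False by linarith
    qed
  qed
qed

end

text \<open>Merges the increments of two independent Brownian motions into one independent
  family.\<close>

lemma (in prob_space) indep_vars_case_sum:
  fixes X Y :: "'i \<Rightarrow> 'a \<Rightarrow> real"
  assumes X: "indep_vars (\<lambda>_. borel) X I" and Y: "indep_vars (\<lambda>_. borel) Y J"
    and I: "finite I" "I \<noteq> {}" and J: "finite J" "J \<noteq> {}"
    and XY: "indep_var (Pi\<^sub>M I (\<lambda>_. borel)) (\<lambda>\<omega>. \<lambda>i\<in>I. X i \<omega>) (Pi\<^sub>M J (\<lambda>_. borel)) (\<lambda>\<omega>. \<lambda>i\<in>J. Y i \<omega>)"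
  shows "indep_vars (\<lambda>_. borel) (case_sum X Y) (I <+> J)"
proof -
  have rv: "case_sum X Y k \<in> borel_measurable M" if "k \<in> I <+> J" for k
    using X Y that by (auto simp: indep_vars_def2)
  show ?thesis
  proof (subst indep_vars_finite[where E = "\<lambda>_. sets borel"])
    show "\<forall>A\<in>I <+> J \<rightarrow> sets borel. prob (\<Inter>k\<in>I <+> J. case_sum X Y k -` A k \<inter> space M)
        = (\<Prod>k\<in>I <+> J. prob (case_sum X Y k -` A k \<inter> space M))"
    proof
      fix A assume "A \<in> I <+> J \<rightarrow> sets (borel :: real measure)"
      then have A: "\<And>i. i \<in> I \<Longrightarrow> A (Inl i) \<in> sets borel" "\<And>j. j \<in> J \<Longrightarrow> A (Inr j) \<in> sets borel" by auto
      define C D where "C = Pi\<^sub>E I (\<lambda>i. A (Inl i))" and "D = Pi\<^sub>E J (\<lambda>j. A (Inr j))"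
      have C: "C \<in> sets (Pi\<^sub>M I (\<lambda>_. borel))" and D: "D \<in> sets (Pi\<^sub>M J (\<lambda>_. borel))"
        unfolding C_def D_def using A I J by (auto intro!: sets_PiM_I_finite)
      have preC: "(\<lambda>\<omega>. \<lambda>i\<in>I. X i \<omega>) -` C \<inter> space M = (\<Inter>i\<in>I. X i -` A (Inl i) \<inter> space M)"
        and preD: "(\<lambda>\<omega>. \<lambda>i\<in>J. Y i \<omega>) -` D \<inter> space M = (\<Inter>j\<in>J. Y j -` A (Inr j) \<inter> space M)"
        using I J by (auto simp: C_def D_def)
      have "(\<Inter>k\<in>I <+> J. case_sum X Y k -` A k \<inter> space M)
          = (\<lambda>\<omega>. (\<lambda>i\<in>I. X i \<omega>, \<lambda>i\<in>J. Y i \<omega>)) -` (C \<times> D) \<inter> space M"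
      proof -
        have "(\<Inter>k\<in>I <+> J. F k) = (\<Inter>i\<in>I. F (Inl i)) \<inter> (\<Inter>j\<in>J. F (Inr j))" for F :: "'i + 'i \<Rightarrow> 'a set"
          unfolding Plus_def by blast
        then have "(\<Inter>k\<in>I <+> J. case_sum X Y k -` A k \<inter> space M)
          = (\<Inter>i\<in>I. X i -` A (Inl i) \<inter> space M) \<inter> (\<Inter>j\<in>J. Y j -` A (Inr j) \<inter> space M)"
          by (simp only: sum.case)
        also have "\<dots> = ((\<lambda>\<omega>. \<lambda>i\<in>I. X i \<omega>) -` C \<inter> space M) \<inter> ((\<lambda>\<omega>. \<lambda>i\<in>J. Y i \<omega>) -` D \<inter> space M)"
          unfolding preC preD ..
        finally show ?thesis by auto
      qed
      then have "prob (\<Inter>k\<in>I <+> J. case_sum X Y k -` A k \<inter> space M)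
          = prob (\<Inter>i\<in>I. X i -` A (Inl i) \<inter> space M) * prob (\<Inter>j\<in>J. Y j -` A (Inr j) \<inter> space M)"
        using indep_varD[OF XY C D] unfolding preC preD by simp
      also have "\<dots> = (\<Prod>i\<in>I. prob (X i -` A (Inl i) \<inter> space M)) * (\<Prod>j\<in>J. prob (Y j -` A (Inr j) \<inter> space M))"
        using indep_varsD_finite[OF X I(2,1), of "\<lambda>i. A (Inl i)"] indep_varsD_finite[OF Y J(2,1), of "\<lambda>j. A (Inr j)"] A
        by simp
      also have "\<dots> = (\<Prod>k\<in>I <+> J. prob (case_sum X Y k -` A k \<inter> space M))"
        using I J by (simp add: prod.Plus)
      finally show "prob (\<Inter>k\<in>I <+> J. case_sum X Y k -` A k \<inter> space M)
        = (\<Prod>k\<in>I <+> J. prob (case_sum X Y k -` A k \<inter> space M))" .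
    qed
    show "sets (borel :: real measure) = sigma_sets (space borel) (sets borel)"
      by (rule sets.sigma_sets_eq[symmetric])
    show "Int_stable (sets (borel :: real measure))" by (rule sets.Int_stable)
    show "sets (borel :: real measure) \<subseteq> Pow (space borel)" by (rule sets.space_closed)
    show "space borel \<in> sets (borel :: real measure)" by (rule sets.top)
  qed (use I J rv in auto)
qed

text \<open>The index \<open>J\<close> stands for time 0. The sum starts at the left end, so the
  path is shifted by a constant common to all \<open>j\<close>, which comparisons of its values do
  not see.\<close>

definition drifted_path :: "(nat \<Rightarrow> real) \<Rightarrow> real \<Rightarrow> nat \<Rightarrow> nat \<Rightarrow> (nat \<Rightarrow> real) \<Rightarrow> real" where
  "drifted_path a h J j x = (\<Sum>l<j. a l * x l) - \<bar>real j - real J\<bar> * h / 2"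

text \<open>The slack \<open>c\<close> absorbs all approximation errors. With weak inequalities over
  finitely many indices, the set is closed under coordinatewise limits.\<close>

definition almost_max :: "(nat \<Rightarrow> real) \<Rightarrow> real \<Rightarrow> nat \<Rightarrow> real \<Rightarrow> nat set \<Rightarrow> (nat \<Rightarrow> real) set" where
  "almost_max a h J c A = {x \<in> extensional {..<2 * J}. \<exists>j\<in>A. \<forall>i\<le>2 * J. drifted_path a h J i x \<le> drifted_path a h J j x + c}"

text \<open>The tolerance \<open>3 * h\<close> covers both the position of the estimator inside its
  block and the rounding of the block length to an integer.\<close>

definition near_grid :: "real set \<Rightarrow> real \<Rightarrow> nat \<Rightarrow> nat set" where
  "near_grid S h J = {j. j \<le> 2 * J \<and> (\<exists>s\<in>S. \<bar>(real j - real J) * h - s\<bar> \<le> 3 * h)}"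

text \<open>The factor \<open>- sqrt h\<close> is the limit of the block coefficients, see
  \<open>coef_tendsto\<close>.\<close>

definition almost_max_prob :: "real \<Rightarrow> nat \<Rightarrow> real \<Rightarrow> nat set \<Rightarrow> real" where
  "almost_max_prob h J c A = measure (Pi\<^sub>M {..<2 * J} (\<lambda>_. std_normal_distribution)) (almost_max (\<lambda>_. - sqrt h) h J c A)"

lemma near_grid_subset: "near_grid S h J \<subseteq> {..2 * J}"
  by (auto simp: near_grid_def)

lemma drifted_path_measurable:
  "j \<le> 2 * J \<Longrightarrow> drifted_path a h J j \<in> borel_measurable (Pi\<^sub>M {..<2 * J} (\<lambda>_. borel))"
  unfolding drifted_path_def[abs_def]
  by (intro borel_measurable_diff borel_measurable_sum borel_measurable_times borel_measurable_const
      measurable_component_singleton) auto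

lemma almost_max_measurable:
  assumes "A \<subseteq> {..2 * J}"
  shows "almost_max a h J c A \<in> sets (Pi\<^sub>M {..<2 * J} (\<lambda>_. borel))"
proof -
  have "almost_max a h J c A = (\<Union>j\<in>A. \<Inter>i\<in>{..2 * J}. {x \<in> space (Pi\<^sub>M {..<2 * J} (\<lambda>_. borel)).
      drifted_path a h J i x \<le> drifted_path a h J j x + c})"
    by (auto simp: almost_max_def space_PiM PiE_def)
  also have "\<dots> \<in> sets (Pi\<^sub>M {..<2 * J} (\<lambda>_. borel))"
    using assms
    by (intro sets.finite_UN sets.finite_INT borel_measurable_le borel_measurable_add borel_measurable_const
        drifted_path_measurable) (auto intro: finite_subset)
  finally show ?thesis .
qed

section \<open>Two-sided Brownian motion and regularity of its paths\<close>

lemma case_bool_Not: "(\<lambda>i. case_bool a b (\<not> i)) = case_bool b a"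
  by (auto simp: fun_eq_iff split: bool.split)

locale two_sided_bm = B1: standard_brownian_motion N W1 + B2: standard_brownian_motion N W2
  for N :: "'b measure" and W1 W2 +
  assumes indep: "indep_processes N W1 W2"
begin

text \<open>Exchanging the two motions reflects time. Hence ties need excluding only across gaps on
  the nonnegative axis.\<close>

lemma swapped: "two_sided_bm N W2 W1"
proof unfold_locales
  let ?P = "Pi\<^sub>M {0..} (\<lambda>_. borel) :: (real \<Rightarrow> real) measure"
  have "B1.indep_vars (case_bool ?P ?P) (case_bool (\<lambda>\<omega>. \<lambda>t\<in>{0..}. W1 t \<omega>) (\<lambda>\<omega>. \<lambda>t\<in>{0..}. W2 t \<omega>)) (range Not)"
    using indep surjI[of Not Not] unfolding indep_processes_def B1.indep_var_def by simp
  from B1.indep_vars_reindex[OF _ this]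
  have "B1.indep_vars (\<lambda>i. case_bool ?P ?P (\<not> i))
      (\<lambda>i. case_bool (\<lambda>\<omega>. \<lambda>t\<in>{0..}. W1 t \<omega>) (\<lambda>\<omega>. \<lambda>t\<in>{0..}. W2 t \<omega>) (\<not> i)) UNIV"
    by (simp add: inj_def)
  then show "indep_processes N W2 W1"
    unfolding indep_processes_def B1.indep_var_def case_bool_Not .
qed

definition incr :: "(nat \<Rightarrow> real) \<Rightarrow> (nat \<Rightarrow> real) \<Rightarrow> nat + nat \<Rightarrow> 'b \<Rightarrow> real" where
  "incr t1 t2 = case_sum (\<lambda>i \<omega>. W1 (t1 (Suc i)) \<omega> - W1 (t1 i) \<omega>) (\<lambda>i \<omega>. W2 (t2 (Suc i)) \<omega> - W2 (t2 i) \<omega>)"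

lemma indep_incr:
  assumes t: "0 \<le> t1 0" "mono t1" "0 \<le> t2 0" "mono t2" and m: "0 < m" "0 < m'"
  shows "B1.indep_vars (\<lambda>_. borel) (incr t1 t2) ({..<m} <+> {..<m'})"
  unfolding incr_def
proof (rule B1.indep_vars_case_sum)
  have meas: "(\<lambda>p. \<lambda>i\<in>{..<k}. p (t (Suc i)) - p (t i) :: real) \<in> measurable (Pi\<^sub>M {0..} (\<lambda>_. borel)) (Pi\<^sub>M {..<k} (\<lambda>_. borel))"
    if "0 \<le> t 0" "mono t" for t :: "nat \<Rightarrow> real" and k
  proof -
    have "0 \<le> t i" for i using that monoD[OF that(2), of 0 i] by linarith
    then show ?thesis
      by (intro measurable_restrict borel_measurable_diff measurable_component_singleton) auto
  qed
  have eq: "(\<lambda>p. \<lambda>i\<in>{..<k}. p (t (Suc i)) - p (t i) :: real) \<circ> (\<lambda>\<omega>. \<lambda>s\<in>{0..}. W s \<omega>)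
      = (\<lambda>\<omega>. \<lambda>i\<in>{..<k}. W (t (Suc i)) \<omega> - W (t i) \<omega>)"
    if "0 \<le> t 0" "mono t" for t :: "nat \<Rightarrow> real" and k and W :: "real \<Rightarrow> 'b \<Rightarrow> real"
  proof -
    have "0 \<le> t i" for i using that monoD[OF that(2), of 0 i] by linarith
    then show ?thesis by (simp add: fun_eq_iff)
  qed
  show "B1.indep_var (Pi\<^sub>M {..<m} (\<lambda>_. borel)) (\<lambda>\<omega>. \<lambda>i\<in>{..<m}. W1 (t1 (Suc i)) \<omega> - W1 (t1 i) \<omega>)
     (Pi\<^sub>M {..<m'} (\<lambda>_. borel)) (\<lambda>\<omega>. \<lambda>i\<in>{..<m'}. W2 (t2 (Suc i)) \<omega> - W2 (t2 i) \<omega>)"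
    using B1.indep_var_compose[OF indep[unfolded indep_processes_def] meas[OF t(1,2)] meas[OF t(3,4)]]
    unfolding eq[OF t(1,2)] eq[OF t(3,4)] .
qed (use m t B1.indep_increments B2.indep_increments in auto)

definition G :: "real \<Rightarrow> 'b \<Rightarrow> real" where
  "G v \<omega> = two_sided W1 W2 v \<omega> - \<bar>v\<bar> / 2"

lemma G_measurable: "G v \<in> borel_measurable N"
proof (cases "v < 0")
  case True
  then have "G v = (\<lambda>\<omega>. W1 (- v) \<omega> - \<bar>v\<bar> / 2)" by (simp add: G_def two_sided_def fun_eq_iff)
  then show ?thesis using B1.random_variable_W[of "- v"] True by simp
next
  case False
  then have "G v = (\<lambda>\<omega>. W2 v \<omega> - \<bar>v\<bar> / 2)" by (simp add: G_def two_sided_def fun_eq_iff)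
  then show ?thesis using B2.random_variable_W[of v] False by simp
qed

text \<open>The start values are 0 only almost surely; where this fails, the two branches need not
  fit together at 0.\<close>

definition regular :: "'b \<Rightarrow> bool" where
  "regular \<omega> \<longleftrightarrow> W1 0 \<omega> = 0 \<and> W2 0 \<omega> = 0 \<and> continuous_on UNIV (\<lambda>v. G v \<omega>) \<and>
     (\<exists>T. \<forall>v. T < \<bar>v\<bar> \<longrightarrow> G v \<omega> \<le> - (\<bar>v\<bar> / 4))"

lemma AE_regular: "AE \<omega> in N. regular \<omega>"
  using B1.start_zero B2.start_zero B1.continuous_paths B2.continuous_paths B1.linear_growth B2.linear_growth
proof eventually_elim
  case (elim \<omega>)
  have "continuous_on UNIV (\<lambda>v. if v \<le> 0 then W1 (- v) \<omega> else W2 v \<omega>)"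
  proof (rule continuous_on_cases_le)
    show "continuous_on {t \<in> UNIV. t \<le> 0} (\<lambda>v. W1 (- v) \<omega>)"
      by (rule continuous_on_compose2[OF elim(3)]) (auto intro!: continuous_intros)
    show "continuous_on {t \<in> UNIV. 0 \<le> t} (\<lambda>v. W2 v \<omega>)"
      by (rule continuous_on_subset[OF elim(4)]) auto
  qed (use elim in \<open>auto intro!: continuous_intros\<close>)
  moreover have "(\<lambda>v. G v \<omega>) = (\<lambda>v. (if v \<le> 0 then W1 (- v) \<omega> else W2 v \<omega>) - \<bar>v\<bar> / 2)"
    using elim by (auto simp: G_def two_sided_def fun_eq_iff)
  ultimately have cont: "continuous_on UNIV (\<lambda>v. G v \<omega>)"
    by (simp only:) (intro continuous_on_diff continuous_on_divide continuous_on_rabs continuous_on_id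
        continuous_on_const; simp)
  obtain T1 T2 where T: "\<And>t. T1 < t \<Longrightarrow> \<bar>W1 t \<omega>\<bar> \<le> t / 4" "\<And>t. T2 < t \<Longrightarrow> \<bar>W2 t \<omega>\<bar> \<le> t / 4"
    using elim by blast
  have "G v \<omega> \<le> - (\<bar>v\<bar> / 4)" if "max T1 T2 < \<bar>v\<bar>" for v
    using T(1)[of "- v"] T(2)[of v] that by (auto simp: G_def two_sided_def)
  with cont elim show ?case unfolding regular_def by blast
qed

end

section \<open>Ties between maxima over disjoint intervals\<close>

context two_sided_bm
begin

lemma G_0: "regular \<omega> \<Longrightarrow> G 0 \<omega> = 0"
  by (simp add: G_def two_sided_def regular_def)

lemma G_left: "regular \<omega> \<Longrightarrow> 0 \<le> t \<Longrightarrow> G (- t) \<omega> = W1 t \<omega> - t / 2"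
  by (auto simp: G_def two_sided_def regular_def)

lemma G_right: "0 \<le> t \<Longrightarrow> G t \<omega> = W2 t \<omega> - t / 2"
  by (auto simp: G_def two_sided_def)

text \<open>The grids on both sides of \<open>[b, c]\<close> are refined while the increment over \<open>[b, c]\<close> is kept whole. Measured from
  \<open>b\<close> and from \<open>c\<close>, the two grid maxima are independent of that increment, so anticoncentration bounds the
  probability of a near tie uniformly in the mesh.\<close>

lemma AE_no_tie:
  assumes bc: "0 \<le> b" "b < c" "c < K"
  shows "AE \<omega> in N. \<not> (\<exists>u\<in>{-K..b}. \<exists>v\<in>{c..K}. (\<forall>s\<in>{-K..b}. G s \<omega> \<le> G u \<omega>) \<and>
      (\<forall>s\<in>{c..K}. G s \<omega> \<le> G v \<omega>) \<and> G u \<omega> = G v \<omega>)"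
    (is "AE \<omega> in N. \<not> ?tie \<omega>")
proof (rule B1.AE_not_if_eventually_small)
  fix e :: real assume e: "0 < e"
  define \<sigma> where "\<sigma> = sqrt (c - b)"
  define \<epsilon> where "\<epsilon> = e * \<sigma> / 2"
  have \<sigma>: "0 < \<sigma>" and \<epsilon>: "0 < \<epsilon>" using bc e by (auto simp: \<sigma>_def \<epsilon>_def)
  define t1 where "t1 p i = K * real i / real p" for p i
  \<comment> \<open>The indices up to \<open>p\<close> divide [0, b] and those from
    \<open>p + 1\<close> to \<open>2 * p + 1\<close> divide [c, K], so increment number
    \<open>p\<close> spans exactly [b, c].\<close>
  define t2 where "t2 p i = (if i \<le> p then b * real i / real p else c + (K - c) * (real i - real p - 1) / real p)" for p i
  define y where "y p = incr (t1 p) (t2 p)" for p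
  define a1 where "a1 p j x = (\<Sum>l<j. x (Inl l :: nat + nat)) - t1 p j / 2" for p j and x :: "nat + nat \<Rightarrow> real"
  define a2 where "a2 p j x = (\<Sum>l<j. x (Inr l :: nat + nat)) - t2 p j / 2" for p j and x :: "nat + nat \<Rightarrow> real"
  define a3 where "a3 p j x = (\<Sum>l=p+1..<p+1+j. x (Inr l :: nat + nat)) - t2 p (p + 1 + j) / 2" for p j and x :: "nat + nat \<Rightarrow> real"
  \<comment> \<open>\<open>L\<close> is the left grid maximum relative to \<open>W2 b\<close> and
    \<open>R\<close> the right one relative to \<open>W2 c\<close>. Neither contains increment
    number \<open>p\<close>, and \<open>R - L\<close> plus that increment is the difference of the
    two maxima.\<close>
  define L where "L p x = Max ((\<lambda>j. max (a1 p j x) (a2 p j x)) ` {..p}) - (\<Sum>l<p. x (Inr l))" for p x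
  define R where "R p x = Max ((\<lambda>j. a3 p j x) ` {..p})" for p x
  define A where "A q = {\<omega> \<in> space N. \<bar>(R (Suc q) (\<lambda>i. y (Suc q) i \<omega>) - L (Suc q) (\<lambda>i. y (Suc q) i \<omega>)) + y (Suc q) (Inr (Suc q)) \<omega>\<bar> \<le> \<epsilon>}" for q
  have t1: "0 \<le> t1 p i" "mono (t1 p)" for p i
    using bc unfolding t1_def by (auto intro!: monoI divide_right_mono mult_left_mono)
  have t2: "0 \<le> t2 p i" "mono (t2 p)" for p i
  proof -
    have le_b: "b * real i / real p \<le> b" if "i \<le> p" for i
      using that bc by (cases "p = 0") (auto simp: field_simps mult_left_mono)
    have ge_c: "c \<le> c + (K - c) * (real i - real p - 1) / real p" if "\<not> i \<le> p" for i
      using that bc by auto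
    show "mono (t2 p)"
    proof (rule monoI)
      fix i j :: nat assume ij: "i \<le> j"
      consider "j \<le> p" | "i \<le> p" "\<not> j \<le> p" | "\<not> i \<le> p" using ij by linarith
      then show "t2 p i \<le> t2 p j"
      proof cases
        case 1
        then show ?thesis using ij bc by (auto simp: t2_def intro!: divide_right_mono mult_left_mono)
      next
        case 2
        then have "t2 p i \<le> b" "c \<le> t2 p j" using le_b[of i] ge_c[of j] by (simp_all add: t2_def)
        then show ?thesis using bc by linarith
      next
        case 3
        then show ?thesis using ij bc by (auto simp: t2_def intro!: divide_right_mono mult_left_mono)
      qed
    qed
    show "0 \<le> t2 p i" using bc ge_c[of i] by (auto simp: t2_def)
  qed
  have t2_p: "t2 p p = b" "t2 p (p + 1) = c" if "0 < p" for p using that by (simp_all add: t2_def)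
  have t2_tail: "t2 p (p + 1 + i) = c + (K - c) * real i / real p" for p i by (simp add: t2_def)
  let ?I = "\<lambda>p. {..<p} <+> {..<2 * p + 1}"
  have prob_A: "B1.prob (A q) \<le> e" and meas_A: "A q \<in> B1.events" for q
  proof -
    define p where "p = Suc q"
    have p: "0 < p" by (simp add: p_def)
    define I where "I = ?I p - {Inr p}"
    have mem: "l < p \<Longrightarrow> Inl l \<in> I" "l < p \<Longrightarrow> Inr l \<in> I" "p + 1 \<le> l \<Longrightarrow> l < 2 * p + 1 \<Longrightarrow> Inr l \<in> I" for l
      by (auto simp: I_def)
    have ind: "B1.indep_vars (\<lambda>_. borel) (y p) (?I p)"
      unfolding y_def using t1 t2 p by (intro indep_incr) auto
    have rv: "y p i \<in> borel_measurable N" if "i \<in> ?I p" for i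
      using ind that by (auto simp: B1.indep_vars_def2)
    have "B1.indep_var (Pi\<^sub>M I (\<lambda>_. borel)) (\<lambda>\<omega>. \<lambda>i\<in>I. y p i \<omega>) (Pi\<^sub>M {Inr p} (\<lambda>_. borel)) (\<lambda>\<omega>. \<lambda>i\<in>{Inr p}. y p i \<omega>)"
      by (rule B1.indep_var_restrict[OF ind]) (auto simp: I_def)
    moreover have RL: "(\<lambda>x. R p x - L p x) \<in> borel_measurable (Pi\<^sub>M I (\<lambda>_. borel))"
    proof -
      have comp: "(\<lambda>x. x i :: real) \<in> borel_measurable (Pi\<^sub>M I (\<lambda>_. borel))" if "i \<in> I" for i
        using that by (rule measurable_component_singleton)
      show ?thesis unfolding R_def L_def
      proof (intro borel_measurable_diff borel_measurable_Max borel_measurable_sum finite_atMost finite_lessThan)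
        fix j assume "j \<in> {..p}"
        then show "a3 p j \<in> borel_measurable (Pi\<^sub>M I (\<lambda>_. borel))"
          "(\<lambda>x. max (a1 p j x) (a2 p j x)) \<in> borel_measurable (Pi\<^sub>M I (\<lambda>_. borel))"
          unfolding a1_def a2_def a3_def[abs_def]
          by (intro borel_measurable_max borel_measurable_diff borel_measurable_sum borel_measurable_const comp mem; simp)+
      qed (use mem comp in auto)
    qed
    moreover have "(\<lambda>x. x (Inr p) :: real) \<in> borel_measurable (Pi\<^sub>M {Inr p} (\<lambda>_. borel))"
      by (rule measurable_component_singleton) simp
    ultimately have "B1.indep_var borel ((\<lambda>x. R p x - L p x) \<circ> (\<lambda>\<omega>. \<lambda>i\<in>I. y p i \<omega>)) borel ((\<lambda>x. x (Inr p)) \<circ> (\<lambda>\<omega>. \<lambda>i\<in>{Inr p}. y p i \<omega>))"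
      by (rule B1.indep_var_compose)
    moreover have "((\<lambda>x. R p x - L p x) \<circ> (\<lambda>\<omega>. \<lambda>i\<in>I. y p i \<omega>)) = (\<lambda>\<omega>. R p (\<lambda>i. y p i \<omega>) - L p (\<lambda>i. y p i \<omega>))"
    proof -
      have "a1 p j (\<lambda>i\<in>I. z i) = a1 p j z" "a2 p j (\<lambda>i\<in>I. z i) = a2 p j z" "a3 p j (\<lambda>i\<in>I. z i) = a3 p j z" if "j \<le> p" for j z
        using that mem unfolding a1_def a2_def a3_def by (auto intro!: sum.cong)
      moreover have "(\<Sum>l<p. (\<lambda>i\<in>I. z i) (Inr l)) = (\<Sum>l<p. z (Inr l))" for z
        using mem by (intro sum.cong) auto
      ultimately have "R p (\<lambda>i\<in>I. z i) = R p z" "L p (\<lambda>i\<in>I. z i) = L p z" for z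
        unfolding R_def L_def by (auto intro!: arg_cong[where f = Max] arg_cong2[where f = minus] image_cong)
      then show ?thesis by (simp add: fun_eq_iff)
    qed
    ultimately have iv: "B1.indep_var borel (\<lambda>\<omega>. R p (\<lambda>i. y p i \<omega>) - L p (\<lambda>i. y p i \<omega>)) borel (y p (Inr p))"
      by (simp add: o_def)
    have nd: "distributed N lborel (y p (Inr p)) (normal_density 0 \<sigma>)"
      using B2.normal_increments[of b c] bc t2_p[OF p] by (simp add: y_def incr_def \<sigma>_def)
    have "B1.prob {\<omega> \<in> space N. \<bar>(R p (\<lambda>i. y p i \<omega>) - L p (\<lambda>i. y p i \<omega>)) + y p (Inr p) \<omega>\<bar> \<le> \<epsilon>} \<le> 2 * \<epsilon> / \<sigma>"
      using \<epsilon> by (intro B1.normal_anticoncentration[OF iv nd \<sigma>]) simp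
    also have "2 * \<epsilon> / \<sigma> = e" using \<sigma> by (simp add: \<epsilon>_def)
    finally show "B1.prob (A q) \<le> e" by (simp add: A_def p_def)
    have "(\<lambda>\<omega>. R p (\<lambda>i. y p i \<omega>) - L p (\<lambda>i. y p i \<omega>)) \<in> borel_measurable N" "y p (Inr p) \<in> borel_measurable N"
      using iv B1.indep_var_rv1 B1.indep_var_rv2 by auto
    then show "A q \<in> B1.events" unfolding A_def p_def[symmetric] by measurable
  qed
  \<comment> \<open>Grid maxima approach the true maxima from below. At a tie both therefore lie
    within \<epsilon> below a common value and differ by at most \<epsilon>.\<close>
  have ev: "\<forall>\<^sub>F q in sequentially. \<omega> \<in> A q" if \<omega>: "\<omega> \<in> space N" "regular \<omega>" and tie: "?tie \<omega>" for \<omega>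
  proof -
    obtain u v where u: "u \<in> {-K..b}" "\<And>s. s \<in> {-K..b} \<Longrightarrow> G s \<omega> \<le> G u \<omega>"
      and v: "v \<in> {c..K}" "\<And>s. s \<in> {c..K} \<Longrightarrow> G s \<omega> \<le> G v \<omega>" and eq: "G u \<omega> = G v \<omega>"
      using tie by blast
    have near: "\<exists>\<delta>>0. \<forall>s. \<bar>s - w\<bar> < \<delta> \<longrightarrow> G w \<omega> - \<epsilon> < G s \<omega>" for w
    proof -
      obtain \<delta> where "\<delta> > 0" "\<And>s. dist s w < \<delta> \<Longrightarrow> dist (G s \<omega>) (G w \<omega>) < \<epsilon>"
        using \<omega>(2) \<epsilon> unfolding regular_def continuous_on_iff by (metis UNIV_I)
      then show ?thesis by (intro exI[of _ \<delta>]) (force simp: dist_real_def)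
    qed
    obtain \<delta>u where \<delta>u: "0 < \<delta>u" "\<And>s. \<bar>s - u\<bar> < \<delta>u \<Longrightarrow> G u \<omega> - \<epsilon> < G s \<omega>" using near[of u] by blast
    obtain \<delta>v where \<delta>v: "0 < \<delta>v" "\<And>s. \<bar>s - v\<bar> < \<delta>v \<Longrightarrow> G v \<omega> - \<epsilon> < G s \<omega>" using near[of v] by blast
    have "(\<lambda>q. K * inverse (real (Suc q))) \<longlonglongrightarrow> K * 0"
      by (intro tendsto_mult tendsto_const LIMSEQ_inverse_real_of_nat)
    then have "\<forall>\<^sub>F q in sequentially. K * inverse (real (Suc q)) < min \<delta>u \<delta>v"
      using \<delta>u(1) \<delta>v(1) by (intro order_tendstoD) auto
    then show ?thesis
    proof eventually_elim
      case (elim q)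
      define p where "p = Suc q"
      have p: "0 < p" by (simp add: p_def)
      have Kp: "K / real p < \<delta>u" "K / real p < \<delta>v" using elim by (simp_all add: p_def divide_inverse)
      define z where "z i = y p i \<omega>" for i
      have W0: "W1 0 \<omega> = 0" "W2 0 \<omega> = 0" using \<omega>(2) by (auto simp: regular_def)
      have t0: "t1 p 0 = 0" "t2 p 0 = 0" by (simp_all add: t1_def t2_def)
      have sum1: "(\<Sum>l<j. z (Inl l)) = W1 (t1 p j) \<omega>" for j
        unfolding z_def y_def incr_def sum.case using sum_lessThan_telescope[of "\<lambda>i. W1 (t1 p i) \<omega>" j] W0 t0 by simp
      have sum2: "(\<Sum>l<j. z (Inr l)) = W2 (t2 p j) \<omega>" for j
        unfolding z_def y_def incr_def sum.case using sum_lessThan_telescope[of "\<lambda>i. W2 (t2 p i) \<omega>" j] W0 t0 by simp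
      have sum3: "(\<Sum>l=p+1..<p+1+j. z (Inr l)) = W2 (t2 p (p + 1 + j)) \<omega> - W2 c \<omega>" for j
        unfolding z_def y_def incr_def sum.case t2_p(2)[OF p, symmetric]
        using sum_Suc_diff'[of "p+1" "p+1+j" "\<lambda>i. W2 (t2 p i) \<omega>"] by simp
      have a1: "a1 p j z = G (- t1 p j) \<omega>" for j
        unfolding a1_def sum1 using G_left[OF \<omega>(2) t1(1)] by simp
      have a2: "a2 p j z = G (t2 p j) \<omega>" for j
        unfolding a2_def sum2 using G_right[OF t2(1)] by simp
      have a3: "a3 p j z = G (t2 p (p + 1 + j)) \<omega> - W2 c \<omega>" for j
        unfolding a3_def sum3 using G_right[OF t2(1)] by simp
      have L: "L p z = Max ((\<lambda>j. max (G (- t1 p j) \<omega>) (G (t2 p j) \<omega>)) ` {..p}) - W2 b \<omega>"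
        unfolding L_def a1 a2 sum2 t2_p(1)[OF p] ..
      have yp: "y p (Inr p) \<omega> = W2 c \<omega> - W2 b \<omega>"
        using t2_p[OF p] by (simp add: y_def incr_def)
      define mL where "mL = Max ((\<lambda>j. max (G (- t1 p j) \<omega>) (G (t2 p j) \<omega>)) ` {..p})"
      define mR where "mR = Max ((\<lambda>j. G (t2 p (p + 1 + j)) \<omega> - W2 c \<omega>) ` {..p})"
      have t1K: "t1 p j \<le> K" and t2b: "t2 p j \<le> b" and t3: "t2 p (p + 1 + j) \<in> {c..K}" if "j \<le> p" for j
      proof -
        have r: "real j / real p \<le> 1" "0 \<le> real j / real p" using that p by auto
        show "t1 p j \<le> K" using mult_left_mono[OF r(1), of K] bc by (simp add: t1_def)
        show "t2 p j \<le> b" using mult_left_mono[OF r(1), of b] bc that by (simp add: t2_def)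
        show "t2 p (p + 1 + j) \<in> {c..K}"
          using mult_left_mono[OF r(1), of "K - c"] mult_left_mono[OF r(2), of "K - c"] bc unfolding t2_tail by simp
      qed
      have "mL \<le> G u \<omega>"
        unfolding mL_def
      proof (rule Max.boundedI)
        fix x assume "x \<in> (\<lambda>j. max (G (- t1 p j) \<omega>) (G (t2 p j) \<omega>)) ` {..p}"
        then obtain j where j: "j \<le> p" "x = max (G (- t1 p j) \<omega>) (G (t2 p j) \<omega>)" by auto
        have "- t1 p j \<in> {-K..b}" "t2 p j \<in> {-K..b}"
          using t1K[OF j(1)] t2b[OF j(1)] t1(1)[of p j] t2(1)[of p j] bc by auto
        then show "x \<le> G u \<omega>" using u(2) j(2) by auto
      qed auto
      moreover have "G u \<omega> - \<epsilon> \<le> mL"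
      proof -
        have "\<exists>j\<le>p. G u \<omega> - \<epsilon> < max (G (- t1 p j) \<omega>) (G (t2 p j) \<omega>)"
        proof (cases "u < 0")
          case True
          obtain j where j: "j \<le> p" "\<bar>0 + (K - 0) * real j / real p - (- u)\<bar> \<le> (K - 0) / real p"
            using interval_grid_point[of 0 "- u" K p] u(1) True p by auto
          from j(2) have "\<bar>K * real j / real p + u\<bar> \<le> K / real p" by simp
          then have "\<bar>- t1 p j - u\<bar> < \<delta>u" using Kp(1) unfolding t1_def by linarith
          from \<delta>u(2)[OF this] show ?thesis using j(1) by (intro exI[of _ j]) auto
        next
          case False
          obtain j where j: "j \<le> p" "\<bar>0 + (b - 0) * real j / real p - u\<bar> \<le> (b - 0) / real p"
            using interval_grid_point[of 0 u b p] u(1) False p by auto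
          have "b / real p \<le> K / real p" using bc by (intro divide_right_mono) auto
          then have "\<bar>t2 p j - u\<bar> < \<delta>u" using Kp(1) j unfolding t2_def by auto
          from \<delta>u(2)[OF this] show ?thesis using j(1) by (intro exI[of _ j]) auto
        qed
        then obtain j where j: "j \<le> p" "G u \<omega> - \<epsilon> < max (G (- t1 p j) \<omega>) (G (t2 p j) \<omega>)" by blast
        have "max (G (- t1 p j) \<omega>) (G (t2 p j) \<omega>) \<le> mL" unfolding mL_def using j(1) by (intro Max_ge) auto
        with j(2) show ?thesis by linarith
      qed
      moreover have "mR \<le> G v \<omega> - W2 c \<omega>"
        unfolding mR_def
      proof (rule Max.boundedI)
        fix x assume "x \<in> (\<lambda>j. G (t2 p (p + 1 + j)) \<omega> - W2 c \<omega>) ` {..p}"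
        then obtain j where "j \<le> p" "x = G (t2 p (p + 1 + j)) \<omega> - W2 c \<omega>" by auto
        then show "x \<le> G v \<omega> - W2 c \<omega>" using v(2)[OF t3] by simp
      qed auto
      moreover have "G v \<omega> - \<epsilon> - W2 c \<omega> \<le> mR"
      proof -
        obtain j where j: "j \<le> p" "\<bar>c + (K - c) * real j / real p - v\<bar> \<le> (K - c) / real p"
          using interval_grid_point[of c v K p] v(1) p by auto
        have "(K - c) / real p \<le> K / real p" using bc by (intro divide_right_mono) auto
        then have "\<bar>t2 p (p + 1 + j) - v\<bar> < \<delta>v" using Kp(2) j unfolding t2_tail by linarith
        from \<delta>v(2)[OF this] have "G v \<omega> - \<epsilon> - W2 c \<omega> \<le> G (t2 p (p + 1 + j)) \<omega> - W2 c \<omega>" by simp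
        also have "\<dots> \<le> mR" unfolding mR_def using j(1) by (intro Max_ge) auto
        finally show ?thesis .
      qed
      ultimately have "\<bar>(mR - (mL - W2 b \<omega>)) + (W2 c \<omega> - W2 b \<omega>)\<bar> \<le> \<epsilon>" using eq unfolding abs_le_iff by linarith
      moreover have "R p z = mR" unfolding R_def a3 mR_def ..
      ultimately have "\<bar>(R p z - L p z) + y p (Inr p) \<omega>\<bar> \<le> \<epsilon>" unfolding L yp mL_def[symmetric] by simp
      then show ?case using \<omega>(1) unfolding A_def p_def[symmetric] z_def by simp
    qed
  qed
  have "AE \<omega> in N. ?tie \<omega> \<longrightarrow> (\<forall>\<^sub>F q in sequentially. \<omega> \<in> A q)"
    using AE_regular AE_space by eventually_elim (use ev in blast)
  then show "\<exists>A. (\<forall>n. A n \<in> B1.events \<and> B1.prob (A n) \<le> e) \<and> (AE \<omega> in N. ?tie \<omega> \<longrightarrow> (\<forall>\<^sub>F q in sequentially. \<omega> \<in> A q))"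
    using meas_A prob_A by blast
qed

end

section \<open>The unique maximiser and its law on grids\<close>

context two_sided_bm
begin

lemma regular_has_max:
  assumes "regular \<omega>" shows "\<exists>V. \<forall>v. G v \<omega> \<le> G V \<omega>"
proof -
  obtain T where T: "\<And>v. T < \<bar>v\<bar> \<Longrightarrow> G v \<omega> \<le> - (\<bar>v\<bar> / 4)" using assms unfolding regular_def by blast
  define R where "R = max T 0"
  have "compact {-R..R}" "{-R..R} \<noteq> {}" by (auto simp: R_def)
  then obtain V where V: "\<And>s. s \<in> {-R..R} \<Longrightarrow> G s \<omega> \<le> G V \<omega>"
    using continuous_attains_sup[of "{-R..R}" "\<lambda>v. G v \<omega>"] assms unfolding regular_def
    by (meson continuous_on_subset subset_UNIV)
  have "G v \<omega> \<le> G V \<omega>" for v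
  proof (cases "v \<in> {-R..R}")
    case False
    then have "R < \<bar>v\<bar>" by auto
    then have "G v \<omega> \<le> - (\<bar>v\<bar> / 4)" by (intro T) (simp add: R_def)
    moreover have "0 \<le> G V \<omega>" using V[of 0] G_0[OF assms] by (simp add: R_def)
    ultimately show ?thesis by linarith
  qed (rule V)
  then show ?thesis by blast
qed

lemma AE_no_rational_tie:
  "AE \<omega> in N. \<forall>(b::rat) (c::rat) (K::nat). 0 \<le> b \<longrightarrow> b < c \<longrightarrow> real_of_rat c < real K \<longrightarrow>
      \<not> (\<exists>u\<in>{-real K..of_rat b}. \<exists>v\<in>{of_rat c..real K}. (\<forall>s\<in>{-real K..of_rat b}. G s \<omega> \<le> G u \<omega>) \<and>
      (\<forall>s\<in>{of_rat c..real K}. G s \<omega> \<le> G v \<omega>) \<and> G u \<omega> = G v \<omega>)" (is "AE \<omega> in N. \<forall>b c K. ?P b c K \<omega>")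
  unfolding AE_all_countable
proof (intro allI)
  fix b c :: rat and K :: nat
  show "AE \<omega> in N. ?P b c K \<omega>"
  proof (cases "0 \<le> b \<and> b < c \<and> real_of_rat c < real K")
    case True
    then have "0 \<le> real_of_rat b" "real_of_rat b < of_rat c" "of_rat c < real K" by (auto simp: of_rat_less)
    from AE_no_tie[OF this] show ?thesis by eventually_elim blast
  qed (rule AE_I2, blast)
qed

text \<open>Two maximisers are separated by rationals b < c. If the larger one is positive,
  \<open>b\<close> can be taken nonnegative; otherwise both are at most 0 and the reflected process
  has the forbidden tie.\<close>

lemma AE_unique_max: "AE \<omega> in N. \<exists>V. peaked (\<lambda>v. G v \<omega>) V"
proof -
  interpret S: two_sided_bm N W2 W1 by (rule swapped)
  note tie = AE_no_rational_tie and tie' = S.AE_no_rational_tie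
  show ?thesis
    using tie tie' AE_regular
  proof eventually_elim
    case (elim \<omega>)
    obtain V where V: "\<And>v. G v \<omega> \<le> G V \<omega>" using regular_has_max[OF elim(3)] by blast
    have SG: "S.G s \<omega> = G (- s) \<omega>" for s
      using elim(3) by (auto simp: G_def S.G_def two_sided_def regular_def)
    have no: "\<not> (u < v \<and> (\<forall>s. G s \<omega> \<le> G u \<omega>) \<and> (\<forall>s. G s \<omega> \<le> G v \<omega>))" for u v
    proof
      assume uv: "u < v \<and> (\<forall>s. G s \<omega> \<le> G u \<omega>) \<and> (\<forall>s. G s \<omega> \<le> G v \<omega>)"
      then have eq: "G u \<omega> = G v \<omega>" by (meson order_antisym)
      obtain K :: nat where K: "\<bar>u\<bar> + \<bar>v\<bar> < real K" using reals_Archimedean2 by blast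
      show False
      proof (cases "0 < v")
        case True
        then have "max u 0 < v" using uv by simp
        then obtain b :: rat where b: "max u 0 < of_rat b" "of_rat b < v" using of_rat_dense by blast
        then obtain c :: rat where c: "real_of_rat b < of_rat c" "of_rat c < v" using of_rat_dense by blast
        have "0 \<le> b" using b(1) zero_le_of_rat_iff[where 'a=real, of b] by simp
        moreover have "b < c" using c(1) by (simp add: of_rat_less)
        moreover have "real_of_rat c < real K" using c(2) K by linarith
        moreover have "u \<in> {-real K..of_rat b}" "v \<in> {of_rat c..real K}" using b c K by auto
        ultimately show False using elim(1) uv eq by blast
      next
        case False
        then have "- v < - u" using uv by simp
        then obtain b :: rat where b: "- v < of_rat b" "of_rat b < - u" using of_rat_dense by blast
        then obtain c :: rat where c: "real_of_rat b < of_rat c" "of_rat c < - u" using of_rat_dense by blast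
        have "0 < real_of_rat b" using b(1) False by linarith
        then have "0 \<le> b" by simp
        moreover have "b < c" using c(1) by (simp add: of_rat_less)
        moreover have "real_of_rat c < real K" using c(2) K by linarith
        moreover have "- v \<in> {-real K..of_rat b}" "- u \<in> {of_rat c..real K}" using b c K by auto
        moreover have "\<forall>s. S.G s \<omega> \<le> S.G (- v) \<omega>" "\<forall>s. S.G s \<omega> \<le> S.G (- u) \<omega>" "S.G (- v) \<omega> = S.G (- u) \<omega>"
          using uv eq by (simp_all add: SG)
        ultimately show False using elim(2) by blast
      qed
    qed
    have "peaked (\<lambda>v. G v \<omega>) V"
    proof
      show "v = V" if "G v \<omega> = G V \<omega>" for v
        using no[of v V] no[of V v] V that by (metis linorder_neqE_linordered_idom)
    qed (use elim(3) V in \<open>auto simp: regular_def\<close>)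
    then show ?case by blast
  qed
qed

text \<open>Expresses the position of the maximiser through countably many values of the process;
  this is how the argmax becomes measurable. The margin 1 / (n + 1) records the gap over the closed
  half-line.\<close>

lemma peaked_less_iff:
  assumes "peaked (\<lambda>v. G v \<omega>) V"
  shows "V < x \<longleftrightarrow> (\<exists>q\<in>\<rat> \<inter> {..<x}. \<exists>n::nat. \<forall>p\<in>\<rat> \<inter> {x..}. G p \<omega> \<le> G q \<omega> - 1 / real (Suc n))"
proof -
  interpret peaked "\<lambda>v. G v \<omega>" V by fact
  show ?thesis
  proof
    assume "V < x"
    then obtain \<gamma> where \<gamma>: "0 < \<gamma>" "\<And>s. x \<le> s \<Longrightarrow> G s \<omega> \<le> G V \<omega> - \<gamma>" using gap[of "{x..}"] by auto
    obtain \<delta> where \<delta>: "0 < \<delta>" "\<And>s. \<bar>s - V\<bar> < \<delta> \<Longrightarrow> G V \<omega> - \<gamma> / 2 < G s \<omega>"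
      using near[of "\<gamma> / 2"] \<gamma>(1) by auto
    have "V < min x (V + \<delta>)" using \<open>V < x\<close> \<delta>(1) by simp
    then obtain q where q: "q \<in> \<rat>" "V < q" "q < min x (V + \<delta>)" using Rats_dense_in_real by blast
    obtain n :: nat where n: "1 / real (Suc n) < \<gamma> / 2"
      using reals_Archimedean[of "\<gamma> / 2"] \<gamma>(1) by (auto simp: inverse_eq_divide)
    have "G V \<omega> - \<gamma> / 2 < G q \<omega>" using q by (intro \<delta>(2)) auto
    then have "\<forall>p\<in>\<rat> \<inter> {x..}. G p \<omega> \<le> G q \<omega> - 1 / real (Suc n)" using \<gamma>(2) n by force
    then show "\<exists>q\<in>\<rat> \<inter> {..<x}. \<exists>n::nat. \<forall>p\<in>\<rat> \<inter> {x..}. G p \<omega> \<le> G q \<omega> - 1 / real (Suc n)"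
      using q by (intro bexI[of _ q]) auto
  next
    assume "\<exists>q\<in>\<rat> \<inter> {..<x}. \<exists>n::nat. \<forall>p\<in>\<rat> \<inter> {x..}. G p \<omega> \<le> G q \<omega> - 1 / real (Suc n)"
    then obtain q n where q: "\<And>p. p \<in> \<rat> \<Longrightarrow> x \<le> p \<Longrightarrow> G p \<omega> \<le> G q \<omega> - 1 / real (Suc n)" by blast
    show "V < x"
    proof (rule ccontr)
      assume "\<not> V < x"
      obtain \<delta> where \<delta>: "0 < \<delta>" "\<And>s. \<bar>s - V\<bar> < \<delta> \<Longrightarrow> G V \<omega> - 1 / real (Suc n) < G s \<omega>"
        using near[of "1 / real (Suc n)"] by auto
      obtain p where p: "p \<in> \<rat>" "V < p" "p < V + \<delta>" using Rats_dense_in_real[of V "V + \<delta>"] \<delta>(1) by auto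
      have "G V \<omega> - 1 / real (Suc n) < G p \<omega>" using p by (intro \<delta>(2)) auto
      moreover have "G p \<omega> \<le> G q \<omega> - 1 / real (Suc n)" using p \<open>\<not> V < x\<close> by (intro q) auto
      ultimately show False using max[of q] by linarith
    qed
  qed
qed

lemma argmax_measurable: "\<exists>V\<in>borel_measurable N. AE \<omega> in N. peaked (\<lambda>v. G v \<omega>) (V \<omega>)"
proof -
  obtain N0 where N0: "{\<omega> \<in> space N. \<not> (\<exists>V. peaked (\<lambda>v. G v \<omega>) V)} \<subseteq> N0" "emeasure N N0 = 0" "N0 \<in> sets N"
    using AE_unique_max by (rule AE_E)
  \<comment> \<open>The exceptional set may fail to be measurable, so the argmax is set to 0 on a
    measurable null set containing it.\<close>
  have "\<forall>\<omega>. \<exists>V. \<omega> \<in> space N \<longrightarrow> (if \<omega> \<in> N0 then V = 0 else peaked (\<lambda>v. G v \<omega>) V)"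
    using N0(1) by auto
  from choice[OF this] obtain V
    where V: "\<And>\<omega>. \<omega> \<in> space N \<Longrightarrow> if \<omega> \<in> N0 then V \<omega> = 0 else peaked (\<lambda>v. G v \<omega>) (V \<omega>)" by blast
  have "V \<in> borel_measurable N"
    unfolding borel_measurable_iff_less
  proof
    fix x :: real
    define E where "E = (\<Union>q\<in>\<rat> \<inter> {..<x}. \<Union>n::nat. \<Inter>p\<in>\<rat> \<inter> {x..}. {\<omega> \<in> space N. G p \<omega> \<le> G q \<omega> - 1 / real (Suc n)})"
    have ne: "\<rat> \<inter> {x..} \<noteq> {}"
      using Rats_dense_in_real[of x "x + 1"] by auto
    have E: "E \<in> sets N"
      unfolding E_def
      by (intro sets.countable_UN' sets.countable_UN image_subsetI sets.countable_INT'' sets.countable_INT' ne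
          borel_measurable_le borel_measurable_diff borel_measurable_const G_measurable
          countable_Int1 countable_rat)
    have "{\<omega> \<in> space N. V \<omega> < x} = (E - N0) \<union> (if 0 < x then N0 \<inter> space N else {})"
    proof -
      have "V \<omega> < x \<longleftrightarrow> \<omega> \<in> (E - N0) \<union> (if 0 < x then N0 \<inter> space N else {})" if "\<omega> \<in> space N" for \<omega>
      proof (cases "\<omega> \<in> N0")
        case True
        then show ?thesis using V[OF that] that by auto
      next
        case False
        then have "peaked (\<lambda>v. G v \<omega>) (V \<omega>)" using V[OF that] by simp
        from peaked_less_iff[OF this, of x] show ?thesis using False that ne unfolding E_def by auto
      qed
      moreover have "E \<subseteq> space N" using sets.sets_into_space[OF E] .
      ultimately show ?thesis by auto
    qed
    also have "\<dots> \<in> sets N" using E N0(3) by auto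
    finally show "{\<omega> \<in> space N. V \<omega> < x} \<in> sets N" .
  qed
  moreover have "AE \<omega> in N. peaked (\<lambda>v. G v \<omega>) (V \<omega>)"
    using AE_not_in[of N0 N] N0 AE_space V by (auto simp: null_sets_def elim!: eventually_elim2)
  ultimately show ?thesis by blast
qed

text \<open>Standardised increments of the two-sided motion over the grid are independent standard
  normal, and the drifted path built from them is \<open>G\<close> on the grid up to a random shift
  independent of \<open>j\<close>.\<close>

lemma almost_max_law:
  assumes h: "0 < h" and J: "0 < J" and A: "A \<subseteq> {..2 * J}"
  shows "almost_max_prob h J c A
    = measure N {\<omega> \<in> space N. \<exists>j\<in>A. \<forall>i\<le>2 * J. G ((real i - real J) * h) \<omega> \<le> G ((real j - real J) * h) \<omega> + c}"
proof -
  define t where "t i = real i * h" for i :: nat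
  have t: "0 \<le> t 0" "mono t" using h by (auto simp: t_def mono_def)
  \<comment> \<open>Left of 0 the increments of \<open>W1\<close> are traversed backwards and so
    change sign. The sign in \<open>z\<close> compensates for this and for the factor
    \<open>- sqrt h\<close>.\<close>
  define f where "f i = (if i < J then Inl (J - 1 - i) else Inr (i - J))" for i :: nat
  define z where "z i \<omega> = (if i < J then 1 else -1) / sqrt h * incr t t (f i) \<omega>" for i \<omega>
  have inj: "inj_on f {..<2 * J}" by (auto simp: inj_on_def f_def split: if_splits)
  have img: "f ` {..<2 * J} \<subseteq> {..<J} <+> {..<J}" by (auto simp: f_def)
  have "B1.indep_vars (\<lambda>_. borel) (incr t t) (f ` {..<2 * J})"
    using indep_incr[OF t t J J] img by (rule B1.indep_vars_subset)
  from B1.indep_vars_reindex[OF inj this]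
  have "B1.indep_vars (\<lambda>_. borel) (\<lambda>i \<omega>. (\<lambda>x. (if i < J then 1 else -1) / sqrt h * x) (incr t t (f i) \<omega>)) {..<2 * J}"
    by (rule B1.indep_vars_compose2) measurable
  then have ind: "B1.indep_vars (\<lambda>_. borel) z {..<2 * J}" by (simp add: z_def[abs_def])
  have law: "distr N borel (z i) = std_normal_distribution" for i
  proof -
    have tt: "0 \<le> t i" "t i < t (Suc i)" "t (Suc i) - t i = h" for i using h by (auto simp: t_def algebra_simps)
    have "distributed N lborel (incr t t k) (normal_density 0 (sqrt h))" for k
      using B1.normal_increments[OF tt(1,2)] B2.normal_increments[OF tt(1,2)] tt(3)
      by (cases k) (simp_all add: incr_def)
    then show ?thesis unfolding z_def[abs_def] using h by (intro B1.distr_normal_standardised) auto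
  qed
  have rv: "z i \<in> borel_measurable N" if "i \<in> {..<2 * J}" for i using ind that by (auto simp: B1.indep_vars_def2)
  have "distr N (Pi\<^sub>M {..<2 * J} (\<lambda>_. borel)) (\<lambda>\<omega>. \<lambda>i\<in>{..<2 * J}. z i \<omega>) = Pi\<^sub>M {..<2 * J} (\<lambda>i. distr N borel (z i))"
    using ind J rv by (subst (asm) B1.indep_vars_iff_distr_eq_PiM') (auto simp: lessThan_empty_iff)
  then have eq: "Pi\<^sub>M {..<2 * J} (\<lambda>_. std_normal_distribution) = distr N (Pi\<^sub>M {..<2 * J} (\<lambda>_. borel)) (\<lambda>\<omega>. \<lambda>i\<in>{..<2 * J}. z i \<omega>)"
    by (simp add: law)
  let ?R = "\<lambda>\<omega>. \<lambda>i\<in>{..<2 * J}. z i \<omega>" and ?D = "almost_max (\<lambda>_. - sqrt h) h J c A"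
  have mR: "?R \<in> measurable N (Pi\<^sub>M {..<2 * J} (\<lambda>_. borel))" using rv by (rule measurable_restrict)
  note D = almost_max_measurable[OF A, of "\<lambda>_. - sqrt h" h c]
  have path: "drifted_path (\<lambda>_. - sqrt h) h J j (?R \<omega>) = G ((real j - real J) * h) \<omega> - two_sided W1 W2 (- (real J * h)) \<omega>"
    if "regular \<omega>" "j \<le> 2 * J" for \<omega> j
  proof -
    have W0: "W1 0 \<omega> = 0" "W2 0 \<omega> = 0" using that(1) by (auto simp: regular_def)
    have "(\<Sum>l<j. - sqrt h * ?R \<omega> l) = two_sided W1 W2 ((real j - real J) * h) \<omega> - two_sided W1 W2 (- (real J * h)) \<omega>"
      using that(2)
    proof (induction j)
      case (Suc j)
      have "- sqrt h * ?R \<omega> j = two_sided W1 W2 ((real (Suc j) - real J) * h) \<omega> - two_sided W1 W2 ((real j - real J) * h) \<omega>"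
      proof (cases "j < J")
        case True
        have 1: "(real j - real J) * h < 0" using True h by (simp add: mult_less_0_iff)
        have 2: "- ((real j - real J) * h) = t (Suc (J - 1 - j))"
          using True by (simp add: t_def of_nat_diff algebra_simps)
        have 3: "two_sided W1 W2 ((real (Suc j) - real J) * h) \<omega> = W1 (t (J - 1 - j)) \<omega>"
        proof (cases "Suc j = J")
          case True
          then show ?thesis using W0 by (simp add: two_sided_def t_def)
        next
          case False
          then have "(real (Suc j) - real J) * h < 0" using \<open>j < J\<close> h by (simp add: mult_less_0_iff)
          moreover have "- ((real (Suc j) - real J) * h) = t (J - 1 - j)"
            using \<open>j < J\<close> False by (simp add: t_def of_nat_diff algebra_simps)
          ultimately show ?thesis by (simp add: two_sided_def)
        qed
        have "- sqrt h * ?R \<omega> j = - incr t t (f j) \<omega>" using True h by (simp add: z_def)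
        then show ?thesis unfolding 3 using 1 2 True by (simp add: two_sided_def f_def incr_def)
      next
        case False
        have 1: "\<not> (real j - real J) * h < 0" "\<not> (real (Suc j) - real J) * h < 0"
          using False h by (simp_all add: mult_less_0_iff)
        have 2: "(real j - real J) * h = t (j - J)" "(real (Suc j) - real J) * h = t (Suc (j - J))"
          using False by (simp_all add: t_def of_nat_diff algebra_simps)
        have "- sqrt h * ?R \<omega> j = incr t t (f j) \<omega>" using False h Suc.prems by (simp add: z_def)
        then show ?thesis using 1 2 False by (simp add: two_sided_def f_def incr_def)
      qed
      then show ?case using Suc by simp
    qed simp
    then show ?thesis
      using h by (simp add: drifted_path_def G_def abs_mult)
  qed
  have "almost_max_prob h J c A = measure N (?R -` ?D \<inter> space N)"
    unfolding almost_max_prob_def eq by (rule measure_distr[OF mR D])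
  also have "\<dots> = measure N {\<omega> \<in> space N. \<exists>j\<in>A. \<forall>i\<le>2 * J. G ((real i - real J) * h) \<omega> \<le> G ((real j - real J) * h) \<omega> + c}"
  proof (rule B1.finite_measure_eq_AE)
    show "AE \<omega> in N. (\<omega> \<in> ?R -` ?D \<inter> space N) =
        (\<omega> \<in> {\<omega> \<in> space N. \<exists>j\<in>A. \<forall>i\<le>2 * J. G ((real i - real J) * h) \<omega> \<le> G ((real j - real J) * h) \<omega> + c})"
      using AE_regular
    proof eventually_elim
      case (elim \<omega>)
      have "?R \<omega> \<in> ?D \<longleftrightarrow> (\<exists>j\<in>A. \<forall>i\<le>2 * J. drifted_path (\<lambda>_. - sqrt h) h J i (?R \<omega>) \<le> drifted_path (\<lambda>_. - sqrt h) h J j (?R \<omega>) + c)"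
        by (simp add: almost_max_def)
      also have "\<dots> \<longleftrightarrow> (\<exists>j\<in>A. \<forall>i\<le>2 * J. G ((real i - real J) * h) \<omega> \<le> G ((real j - real J) * h) \<omega> + c)"
      proof (rule bex_cong[OF refl])
        fix j assume "j \<in> A"
        then have j: "j \<le> 2 * J" using A by auto
        show "(\<forall>i\<le>2 * J. drifted_path (\<lambda>_. - sqrt h) h J i (?R \<omega>) \<le> drifted_path (\<lambda>_. - sqrt h) h J j (?R \<omega>) + c)
          \<longleftrightarrow> (\<forall>i\<le>2 * J. G ((real i - real J) * h) \<omega> \<le> G ((real j - real J) * h) \<omega> + c)"
          using path[OF elim] j by simp
      qed
      finally show ?case by blast
    qed
    show "?R -` ?D \<inter> space N \<in> sets N" by (rule measurable_sets[OF mR D])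
    have "{\<omega> \<in> space N. \<exists>j\<in>A. \<forall>i\<le>2 * J. G ((real i - real J) * h) \<omega> \<le> G ((real j - real J) * h) \<omega> + c}
       = (\<Union>j\<in>A. \<Inter>i\<in>{..2 * J}. {\<omega> \<in> space N. G ((real i - real J) * h) \<omega> \<le> G ((real j - real J) * h) \<omega> + c})" by auto
    also have "\<dots> \<in> sets N"
      using finite_subset[OF A]
      by (intro sets.finite_UN sets.finite_INT borel_measurable_le borel_measurable_add borel_measurable_const G_measurable) auto
    finally show "{\<omega> \<in> space N. \<exists>j\<in>A. \<forall>i\<le>2 * J. G ((real i - real J) * h) \<omega> \<le> G ((real j - real J) * h) \<omega> + c} \<in> sets N" .
  qed
  finally show ?thesis .
qed

lemma almost_max_limit:
  assumes V: "V \<in> borel_measurable N" "AE \<omega> in N. peaked (\<lambda>v. G v \<omega>) (V \<omega>)"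
    and S: "closed S" and h: "h \<longlonglongrightarrow> 0" "\<And>q. 0 < h q" and c: "c \<longlonglongrightarrow> 0" and J: "\<And>q. 0 < J q"
    and K: "filterlim (\<lambda>q. real (J q) * h q) at_top sequentially" and e: "0 < e"
  shows "\<forall>\<^sub>F q in sequentially. almost_max_prob (h q) (J q) (c q) (near_grid S (h q) (J q))
    \<le> measure N (V -` S \<inter> space N) + e"
proof -
  define A where "A q = near_grid S (h q) (J q)" for q
  define E where "E q = {\<omega> \<in> space N. \<exists>j\<in>A q. \<forall>i\<le>2 * J q. G ((real i - real (J q)) * h q) \<omega> \<le> G ((real j - real (J q)) * h q) \<omega> + c q}" for q
  have A: "A q \<subseteq> {..2 * J q}" for q unfolding A_def by (rule near_grid_subset)
  have "\<forall>\<^sub>F q in sequentially. B1.prob (E q) \<le> B1.prob (V -` S \<inter> space N) + e"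
  proof (rule B1.prob_limsup_le)
    show "E q \<in> sets N" for q
    proof -
      have "E q = (\<Union>j\<in>A q. \<Inter>i\<in>{..2 * J q}. {\<omega> \<in> space N. G ((real i - real (J q)) * h q) \<omega> \<le> G ((real j - real (J q)) * h q) \<omega> + c q})"
        by (auto simp: E_def)
      also have "\<dots> \<in> sets N"
        using finite_subset[OF A[of q]]
        by (intro sets.finite_UN sets.finite_INT borel_measurable_le borel_measurable_add borel_measurable_const G_measurable) auto
      finally show ?thesis .
    qed
    show "V -` S \<inter> space N \<in> sets N" using V(1) S by (intro measurable_sets) auto
    show "AE \<omega> in N. \<omega> \<notin> V -` S \<inter> space N \<longrightarrow> (\<forall>\<^sub>F q in sequentially. \<omega> \<notin> E q)"
      using V(2) AE_space
    proof eventually_elim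
      case (elim \<omega>)
      interpret peaked "\<lambda>v. G v \<omega>" "V \<omega>" by fact
      show ?case
      proof
        assume "\<omega> \<notin> V -` S \<inter> space N"
        then have "V \<omega> \<notin> S" using elim by auto
        from grid_maximiser_near[OF S this h c J K]
        show "\<forall>\<^sub>F q in sequentially. \<omega> \<notin> E q"
          by (rule eventually_mono) (auto simp: E_def A_def near_grid_def)
      qed
    qed
  qed fact
  then show ?thesis
    using almost_max_law[OF h(2) J A] unfolding E_def A_def[symmetric] by simp
qed

end

section \<open>The change point estimator\<close>

locale euler_change_model = standard_brownian_motion M W
  for M :: "'a measure" and W +
  fixes b \<sigma> :: "real \<Rightarrow> real" and x0 T \<tau> \<theta>0 :: real and \<theta>1 \<theta>2 \<Delta> :: "nat \<Rightarrow> real"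
    and X :: "nat \<Rightarrow> nat \<Rightarrow> 'a \<Rightarrow> real" and k_hat :: "nat \<Rightarrow> 'a \<Rightarrow> nat"
  assumes \<sigma>_pos: "\<And>x. 0 < \<sigma> x"
    and T: "0 < T" and Delta: "\<And>n. 0 < n \<Longrightarrow> real n * \<Delta> n = T"
    and tau: "0 < \<tau>" "\<tau> < 1"
    and theta0: "0 < \<theta>0" and theta_pos: "\<And>n. 0 < \<theta>1 n" "\<And>n. 0 < \<theta>2 n"
    and theta_lim: "\<theta>1 \<longlonglongrightarrow> \<theta>0" "\<theta>2 \<longlonglongrightarrow> \<theta>0"
    and jump_rate: "filterlim (\<lambda>n. sqrt (real n) * (\<theta>2 n - \<theta>1 n) / sqrt (ln (real n))) at_top sequentially"
    and euler: "\<And>n \<omega>. \<omega> \<in> space M \<Longrightarrow>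
          euler_scheme b \<sigma> x0 (\<Delta> n) (\<lambda>i. if i \<le> change_index \<tau> n then \<theta>1 n else \<theta>2 n) n
            (\<lambda>t. W t \<omega>) (\<lambda>i. X n i \<omega>)"
    and k_hat_measurable: "\<And>n. k_hat n \<in> measurable M (count_space UNIV)"
    and k_hat: "\<And>n \<omega>. 2 \<le> n \<Longrightarrow> \<omega> \<in> space M \<Longrightarrow>
          least_squares_change_point (normalised_increment b \<sigma> (\<Delta> n) (\<lambda>i. X n i \<omega>)) n (k_hat n \<omega>)"
begin

definition "k0 n = change_index \<tau> n"
definition "\<delta> n = \<theta>2 n - \<theta>1 n"
text \<open>One observation step has length \<open>a n\<close> on the time axis of the limit process.\<close>

definition "a n = (\<delta> n)\<^sup>2 / (2 * \<theta>0\<^sup>2)"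
text \<open>Counted from 0: \<open>\<xi> n i\<close> drives step \<open>Suc i\<close>. Hence
  \<open>noise\<close> tests \<open>i < k0 n\<close> where the scheme tests
  \<open>i \<le> change_index \<tau> n\<close>.\<close>

definition "\<xi> n i \<omega> = 1 / sqrt (\<Delta> n) * (W (real (Suc i) * \<Delta> n) \<omega> - W (real i * \<Delta> n) \<omega>)"
definition "noise n i \<omega> = (if i < k0 n then \<theta>1 n else \<theta>2 n) * ((\<xi> n i \<omega>)\<^sup>2 - 1)"
definition "walk n k \<omega> = (\<Sum>i<k. noise n i \<omega>)"
definition "y n \<omega> i = (normalised_increment b \<sigma> (\<Delta> n) (\<lambda>i. X n i \<omega>) i)\<^sup>2"

lemma Delta_pos: "0 < n \<Longrightarrow> 0 < \<Delta> n"
  using Delta[of n] T by (metis of_nat_0_less_iff zero_less_mult_pos)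

lemma \<xi>_law:
  assumes "0 < n"
  shows "distr M borel (\<xi> n i) = std_normal_distribution" and "\<xi> n i \<in> borel_measurable M"
    and "indep_vars (\<lambda>_. borel) (\<xi> n) {..<m}"
proof -
  note D = Delta_pos[OF assms]
  have nd: "distributed M lborel (\<lambda>\<omega>. W (real (Suc i) * \<Delta> n) \<omega> - W (real i * \<Delta> n) \<omega>) (normal_density 0 (sqrt (\<Delta> n)))"
    using normal_increments[of "real i * \<Delta> n" "real (Suc i) * \<Delta> n"] D by (simp add: algebra_simps)
  then show "distr M borel (\<xi> n i) = std_normal_distribution"
    unfolding \<xi>_def[abs_def] using D by (intro distr_normal_standardised) auto
  show "\<xi> n i \<in> borel_measurable M"
    unfolding \<xi>_def[abs_def] using distributed_measurable[OF nd] by simp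
  have "indep_vars (\<lambda>_. borel) (\<lambda>i \<omega>. W (real (Suc i) * \<Delta> n) \<omega> - W (real i * \<Delta> n) \<omega>) {..<m}"
    using indep_increments[of "\<lambda>i. real i * \<Delta> n" m] D by (auto simp: mono_def mult_right_mono)
  then show "indep_vars (\<lambda>_. borel) (\<xi> n) {..<m}"
    using indep_vars_compose2[of "\<lambda>_. borel" "\<lambda>i \<omega>. W (real (Suc i) * \<Delta> n) \<omega> - W (real i * \<Delta> n) \<omega>" "{..<m}"
      "\<lambda>_ x. 1 / sqrt (\<Delta> n) * x" "\<lambda>_. borel"]
    by (simp add: \<xi>_def[abs_def])
qed

text \<open>The drift is subtracted exactly and \<open>\<sigma>\<close> cancels at whatever state
  the scheme has reached, so the coefficients disappear from the problem.\<close>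

lemma y_eq:
  assumes n: "0 < n" and \<omega>: "\<omega> \<in> space M" and i: "i < n"
  shows "y n \<omega> (Suc i) = (if i < k0 n then \<theta>1 n else \<theta>2 n) * (\<xi> n i \<omega>)\<^sup>2"
proof -
  let ?\<theta> = "if i < k0 n then \<theta>1 n else \<theta>2 n"
  have \<theta>: "0 < ?\<theta>" using theta_pos by simp
  have "Suc i \<in> {1..n}" using i by simp
  with euler[OF \<omega>, of n] have "X n (Suc i) \<omega> = X n i \<omega> + b (X n i \<omega>) * \<Delta> n
      + sqrt ?\<theta> * \<sigma> (X n i \<omega>) * (W (real (Suc i) * \<Delta> n) \<omega> - W (real i * \<Delta> n) \<omega>)"
    unfolding euler_scheme_def k0_def by (auto simp: Suc_le_eq dest!: bspec[of _ _ "Suc i"])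
  then have "X n (Suc i) \<omega> - X n i \<omega> - b (X n i \<omega>) * \<Delta> n
      = sqrt ?\<theta> * \<sigma> (X n i \<omega>) * (W (real (Suc i) * \<Delta> n) \<omega> - W (real i * \<Delta> n) \<omega>)" by linarith
  then have "normalised_increment b \<sigma> (\<Delta> n) (\<lambda>i. X n i \<omega>) (Suc i) = sqrt ?\<theta> * \<xi> n i \<omega>"
    using \<sigma>_pos[of "X n i \<omega>"] Delta_pos[OF n] unfolding normalised_increment_def \<xi>_def by simp
  then show ?thesis unfolding y_def using \<theta> by (simp add: power_mult_distrib)
qed

lemma sum_y:
  assumes n: "0 < n" and \<omega>: "\<omega> \<in> space M" and k: "k \<le> n"
  shows "(\<Sum>i=1..k. y n \<omega> i) = real k * \<theta>1 n + real (k - k0 n) * (\<theta>2 n - \<theta>1 n) + walk n k \<omega>"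
  using k
proof (induction k)
  case (Suc k)
  then have "(\<Sum>i=1..Suc k. y n \<omega> i) = real k * \<theta>1 n + real (k - k0 n) * (\<theta>2 n - \<theta>1 n) + walk n k \<omega> + y n \<omega> (Suc k)"
    by simp
  also have "\<dots> = real (Suc k) * \<theta>1 n + real (Suc k - k0 n) * (\<theta>2 n - \<theta>1 n) + walk n (Suc k) \<omega>"
    using y_eq[OF n \<omega>, of k] Suc.prems
    by (cases "k < k0 n") (simp_all add: walk_def noise_def Suc_diff_le algebra_simps)
  finally show ?case .
qed (simp add: walk_def)

text \<open>The crude bound 2 \<theta>0 holds for large \<open>n\<close>. It gives variance at most
  (2 \<theta>0)^2 times 2 and fourth moment at most (2 \<theta>0)^4 \<open>eta4\<close>; then
  \<open>moments_le\<close> reduces to 4 \<le> \<open>eta4\<close>.\<close>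

lemma noise_centred:
  assumes n: "0 < n" and B: "\<theta>1 n \<le> 2 * \<theta>0" "\<theta>2 n \<le> 2 * \<theta>0"
  shows "indep_centred M (noise n) n (8 * \<theta>0\<^sup>2) (16 * \<theta>0 ^ 4 * eta4)"
proof
  have eta: "integrable M (\<lambda>\<omega>. ((\<xi> n i \<omega>)\<^sup>2 - 1) ^ j)"
    "expectation (\<lambda>\<omega>. ((\<xi> n i \<omega>)\<^sup>2 - 1) ^ j) = (LINT x|std_normal_distribution. (x\<^sup>2 - 1) ^ j)" for i j
    using std_normal_law_integral[OF \<xi>_law(1,2)[OF n], of "\<lambda>x. (x\<^sup>2 - 1) ^ j"] std_normal_eta_integrable by simp_all
  let ?\<theta> = "\<lambda>i. if i < k0 n then \<theta>1 n else \<theta>2 n"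
  have \<theta>: "0 \<le> ?\<theta> i" "?\<theta> i \<le> 2 * \<theta>0" for i using theta_pos[of n] B by auto
  have pow: "noise n i \<omega> ^ j = ?\<theta> i ^ j * ((\<xi> n i \<omega>)\<^sup>2 - 1) ^ j" for i j \<omega>
    by (simp add: noise_def power_mult_distrib)
  show "indep_vars (\<lambda>_. borel) (noise n) {..<n}"
    using indep_vars_compose2[OF \<xi>_law(3)[OF n], of n "\<lambda>i x. ?\<theta> i * (x\<^sup>2 - 1)" "\<lambda>_. borel"]
    by (simp add: noise_def[abs_def])
  show "integrable M (\<lambda>\<omega>. noise n i \<omega> ^ 4)" for i unfolding pow by (intro integrable_mult_right eta)
  show "expectation (noise n i) = 0" for i
    using eta(2)[of i 1] std_normal_eta_moments(1) by (simp add: noise_def[abs_def])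
  show "expectation (\<lambda>\<omega>. noise n i \<omega> ^ 2) \<le> 8 * \<theta>0\<^sup>2" for i
    unfolding pow using eta(2)[of i 2] std_normal_eta_moments(2) power_mono[OF \<theta>(2,1), of i 2]
    by (simp add: power_mult_distrib)
  have e4: "0 \<le> eta4" using std_normal_eta_moments(3) by simp
  have "expectation (\<lambda>\<omega>. noise n i \<omega> ^ 4) = ?\<theta> i ^ 4 * eta4" for i
    unfolding pow using eta(2)[of i 4] by (simp add: eta4_def)
  also have "\<dots> i \<le> (2 * \<theta>0) ^ 4 * eta4" for i
    using power_mono[OF \<theta>(2,1), of i 4] e4 by (intro mult_right_mono) auto
  finally show "expectation (\<lambda>\<omega>. noise n i \<omega> ^ 4) \<le> 16 * \<theta>0 ^ 4 * eta4" for i by (simp add: power_mult_distrib)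
  show "(8 * \<theta>0\<^sup>2)\<^sup>2 \<le> 16 * \<theta>0 ^ 4 * eta4"
    using std_normal_eta_moments(3) mult_left_mono[of 4 eta4 "16 * \<theta>0 ^ 4"] by (simp add: power_mult_distrib)
qed simp

text \<open>The geometric mean of \<open>\<surd>ln n\<close>, the order of the largest normalised partial sum, and \<open>\<surd>n \<delta> n\<close>, the order of the
  signal.\<close>

definition "lam n = sqrt (ln (real n)) * sqrt (sqrt (real n) * \<delta> n / sqrt (ln (real n)))"

text \<open>Off this event the noise satisfies both bounds of \<open>change_path\<close>.\<close>

definition "bad_sqrt n = {\<omega> \<in> space M. \<exists>k<n. lam n * sqrt (Suc k) \<le> \<bar>walk n (Suc k) \<omega>\<bar> \<or>
    lam n * sqrt (Suc k) \<le> \<bar>walk n n \<omega> - walk n (n - Suc k) \<omega>\<bar>}"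

text \<open>The slope \<open>\<delta> n / 16\<close> is that of
  \<open>maximiser_near_change\<close>: off this event the maximiser found there is closer than
  \<open>t\<close> to the change.\<close>

definition "bad_linear n t = {\<omega> \<in> space M. \<exists>k\<le>n. t \<le> \<bar>real k - real (k0 n)\<bar> \<and>
    \<delta> n / 16 * \<bar>real k - real (k0 n)\<bar> \<le> \<bar>walk n k \<omega> - walk n (k0 n) \<omega>\<bar>}"

definition "bad_block n \<kappa> m r \<epsilon> = {\<omega> \<in> space M. \<exists>l<r. \<exists>k<m. \<epsilon> \<le> \<bar>walk n (\<kappa> + l * m + Suc k) \<omega> - walk n (\<kappa> + l * m) \<omega>\<bar>}"

lemma walk_measurable: "0 < n \<Longrightarrow> walk n k \<in> borel_measurable M"
  unfolding walk_def[abs_def] noise_def using \<xi>_law(2)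
  by (intro borel_measurable_sum borel_measurable_times borel_measurable_diff borel_measurable_power borel_measurable_const) auto

lemma prob_bad_sqrt:
  assumes n: "0 < n" and B: "\<theta>1 n \<le> 2 * \<theta>0" "\<theta>2 n \<le> 2 * \<theta>0" and lam: "0 < lam n"
  shows "bad_sqrt n \<in> events" "prob (bad_sqrt n) \<le> 16 * \<theta>0\<^sup>2 * (1 + ln (real n)) / (lam n)\<^sup>2"
proof -
  interpret C: indep_centred M "noise n" n "8 * \<theta>0\<^sup>2" "16 * \<theta>0 ^ 4 * eta4" by (rule noise_centred) fact+
  \<comment> \<open>Reversed noise: its partial sums are those counted back from
    \<open>n\<close>.\<close>
  interpret R: indep_centred M "\<lambda>i. noise n (n - Suc i)" n "8 * \<theta>0\<^sup>2" "16 * \<theta>0 ^ 4 * eta4"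
    by (rule C.reindexed) (auto simp: inj_on_def)
  have CS: "C.S k \<omega> = walk n k \<omega>" for k \<omega> by (simp add: C.S_def walk_def)
  have RS: "R.S k \<omega> = walk n n \<omega> - walk n (n - k) \<omega>" if "k \<le> n" for k \<omega>
    using that
  proof (induction k)
    case (Suc k)
    have "walk n (n - k) \<omega> = walk n (n - Suc k) \<omega> + noise n (n - Suc k) \<omega>"
      using Suc.prems by (simp add: walk_def Suc_diff_Suc[symmetric])
    then show ?case using Suc by (simp add: R.S_Suc)
  qed simp
  define A B where "A = {\<omega> \<in> space M. \<exists>k<n. lam n * sqrt (Suc k) \<le> \<bar>C.S (Suc k) \<omega>\<bar>}"
    and "B = {\<omega> \<in> space M. \<exists>k<n. lam n * sqrt (Suc k) \<le> \<bar>R.S (Suc k) \<omega>\<bar>}"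
  have eq: "bad_sqrt n = A \<union> B" unfolding A_def B_def bad_sqrt_def CS using RS by (auto simp: Suc_le_eq)
  have A: "A \<in> events" unfolding A_def
    by (intro sets_Ex_less borel_measurable_le borel_measurable_abs borel_measurable_const C.random_variable_S) auto
  have B: "B \<in> events" unfolding B_def
    by (intro sets_Ex_less borel_measurable_le borel_measurable_abs borel_measurable_const R.random_variable_S) auto
  show "bad_sqrt n \<in> events" unfolding eq using A B by simp
  have "prob (bad_sqrt n) \<le> prob A + prob B" unfolding eq using A B by (rule measure_Un_le)
  also have "\<dots> \<le> 8 * \<theta>0\<^sup>2 * (1 + ln n) / (lam n)\<^sup>2 + 8 * \<theta>0\<^sup>2 * (1 + ln n) / (lam n)\<^sup>2"
    unfolding A_def B_def by (intro add_mono C.prob_max_S_sqrt_le R.prob_max_S_sqrt_le lam n)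
  finally show "prob (bad_sqrt n) \<le> 16 * \<theta>0\<^sup>2 * (1 + ln (real n)) / (lam n)\<^sup>2" by (simp add: mult_ac)
qed

text \<open>The linear inequality is applied to the noise after the change and to the reversed noise
  before it. Each side contributes 2 (8 \<theta>0^2) 16^2, whence 8192.\<close>

lemma prob_bad_linear:
  assumes n: "0 < n" and B: "\<theta>1 n \<le> 2 * \<theta>0" "\<theta>2 n \<le> 2 * \<theta>0" and \<delta>: "0 < \<delta> n" and t: "0 < t" and k0: "k0 n < n"
  shows "bad_linear n (real t) \<in> events" "prob (bad_linear n (real t)) \<le> 8192 * \<theta>0\<^sup>2 / (t * (\<delta> n)\<^sup>2)"
proof -
  interpret C: indep_centred M "noise n" n "8 * \<theta>0\<^sup>2" "16 * \<theta>0 ^ 4 * eta4" by (rule noise_centred) fact+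
  interpret R: indep_centred M "\<lambda>i. noise n (k0 n + i)" "n - k0 n" "8 * \<theta>0\<^sup>2" "16 * \<theta>0 ^ 4 * eta4"
    by (rule C.reindexed) auto
  interpret L: indep_centred M "\<lambda>i. noise n (k0 n - Suc i)" "k0 n" "8 * \<theta>0\<^sup>2" "16 * \<theta>0 ^ 4 * eta4"
    using k0 by (intro C.reindexed) (auto simp: inj_on_def)
  have RS: "R.S k \<omega> = walk n (k0 n + k) \<omega> - walk n (k0 n) \<omega>" for k \<omega>
    by (induction k) (simp_all add: R.S_Suc walk_def)
  have LS: "L.S k \<omega> = walk n (k0 n) \<omega> - walk n (k0 n - k) \<omega>" if "k \<le> k0 n" for k \<omega>
    using that
  proof (induction k)
    case (Suc k)
    have "walk n (k0 n - k) \<omega> = walk n (k0 n - Suc k) \<omega> + noise n (k0 n - Suc k) \<omega>"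
      using Suc.prems by (simp add: walk_def Suc_diff_Suc[symmetric])
    then show ?case using Suc by (simp add: L.S_Suc)
  qed simp
  define A B where "A = {\<omega> \<in> space M. \<exists>k<n - k0 n. t \<le> Suc k \<and> \<delta> n / 16 * Suc k \<le> \<bar>R.S (Suc k) \<omega>\<bar>}"
    and "B = {\<omega> \<in> space M. \<exists>k<k0 n. t \<le> Suc k \<and> \<delta> n / 16 * Suc k \<le> \<bar>L.S (Suc k) \<omega>\<bar>}"
  have sub: "bad_linear n (real t) \<subseteq> A \<union> B"
  proof
    fix \<omega> assume "\<omega> \<in> bad_linear n (real t)"
    then obtain k where \<omega>: "\<omega> \<in> space M" and k: "k \<le> n" "real t \<le> \<bar>real k - real (k0 n)\<bar>"
      "\<delta> n / 16 * \<bar>real k - real (k0 n)\<bar> \<le> \<bar>walk n k \<omega> - walk n (k0 n) \<omega>\<bar>"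
      unfolding bad_linear_def by blast
    show "\<omega> \<in> A \<union> B"
    proof (cases "k0 n \<le> k")
      case True
      define j where "j = k - k0 n - 1"
      have "k \<noteq> k0 n" using k(2) t by auto
      then have j: "k = k0 n + Suc j" "j < n - k0 n" using True k(1) by (auto simp: j_def)
      have "\<omega> \<in> A" unfolding A_def RS using k \<omega> j by (auto intro!: exI[of _ j])
      then show ?thesis by simp
    next
      case False
      define j where "j = k0 n - k - 1"
      have j: "k = k0 n - Suc j" "j < k0 n" "real (k0 n) - real k = Suc j" using False by (auto simp: j_def of_nat_diff)
      have "\<bar>real k - real (k0 n)\<bar> = real (Suc j)" using j(3) by linarith
      then have "\<omega> \<in> B" unfolding B_def using k \<omega> j LS[of "Suc j" \<omega>]
        by (auto intro!: exI[of _ j] simp: abs_minus_commute simp del: of_nat_Suc)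
      then show ?thesis by simp
    qed
  qed
  have A: "A \<in> events" unfolding A_def
    by (intro sets_Ex_less sets.sets_Collect_conj sets.sets_Collect_const borel_measurable_le
        borel_measurable_abs borel_measurable_const R.random_variable_S) auto
  have B: "B \<in> events" unfolding B_def
    by (intro sets_Ex_less sets.sets_Collect_conj sets.sets_Collect_const borel_measurable_le
        borel_measurable_abs borel_measurable_const L.random_variable_S) auto
  show "bad_linear n (real t) \<in> events"
    unfolding bad_linear_def less_Suc_eq_le[symmetric]
    by (intro sets_Ex_less sets.sets_Collect_conj sets.sets_Collect_const borel_measurable_le
        borel_measurable_abs borel_measurable_diff borel_measurable_const walk_measurable n)
  have "prob (bad_linear n (real t)) \<le> prob (A \<union> B)" using A B by (intro finite_measure_mono sub) simp
  also have "\<dots> \<le> prob A + prob B" using A B by (rule measure_Un_le)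
  also have "\<dots> \<le> 2 * (8 * \<theta>0\<^sup>2) / (t * (\<delta> n / 16)\<^sup>2) + 2 * (8 * \<theta>0\<^sup>2) / (t * (\<delta> n / 16)\<^sup>2)"
    unfolding A_def B_def using \<delta> t by (intro add_mono R.prob_S_linear_le L.prob_S_linear_le) auto
  also have "\<dots> = 8192 * \<theta>0\<^sup>2 / (t * (\<delta> n)\<^sup>2)" using \<delta> t by (simp add: power_divide)
  finally show "prob (bad_linear n (real t)) \<le> 8192 * \<theta>0\<^sup>2 / (t * (\<delta> n)\<^sup>2)" .
qed

lemma prob_bad_block:
  assumes n: "0 < n" and B: "\<theta>1 n \<le> 2 * \<theta>0" "\<theta>2 n \<le> 2 * \<theta>0" and \<epsilon>: "0 < \<epsilon>" and le: "\<kappa> + r * m \<le> n"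
  shows "bad_block n \<kappa> m r \<epsilon> \<in> events" "prob (bad_block n \<kappa> m r \<epsilon>) \<le> real r * (48 * \<theta>0 ^ 4 * eta4 * (real m)\<^sup>2 / \<epsilon> ^ 4)"
proof -
  interpret C: indep_centred M "noise n" n "8 * \<theta>0\<^sup>2" "16 * \<theta>0 ^ 4 * eta4" by (rule noise_centred) fact+
  define A where "A l = {\<omega> \<in> space M. \<exists>k<m. \<epsilon> \<le> \<bar>walk n (\<kappa> + l * m + Suc k) \<omega> - walk n (\<kappa> + l * m) \<omega>\<bar>}" for l
  have eq: "bad_block n \<kappa> m r \<epsilon> = (\<Union>l\<in>{..<r}. A l)" by (auto simp: bad_block_def A_def)
  have A: "A l \<in> events" for l unfolding A_def
    by (intro sets_Ex_less borel_measurable_le borel_measurable_abs borel_measurable_diff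
        borel_measurable_const walk_measurable n)
  have pA: "prob (A l) \<le> 48 * \<theta>0 ^ 4 * eta4 * (real m)\<^sup>2 / \<epsilon> ^ 4" if l: "l < r" for l
  proof -
    have "\<kappa> + l * m + m \<le> \<kappa> + r * m" using mult_le_mono1[of "Suc l" r m] l by simp
    then interpret R: indep_centred M "\<lambda>i. noise n (\<kappa> + l * m + i)" m "8 * \<theta>0\<^sup>2" "16 * \<theta>0 ^ 4 * eta4"
      using le by (intro C.reindexed) auto
    have RS: "R.S k \<omega> = walk n (\<kappa> + l * m + k) \<omega> - walk n (\<kappa> + l * m) \<omega>" for k \<omega>
      by (induction k) (simp_all add: R.S_Suc walk_def)
    show ?thesis using R.prob_max_S_le[OF \<epsilon>] unfolding RS A_def by simp
  qed
  show "bad_block n \<kappa> m r \<epsilon> \<in> events" unfolding eq using A by (intro sets.finite_UN) auto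
  have "prob (bad_block n \<kappa> m r \<epsilon>) \<le> (\<Sum>l<r. prob (A l))"
    unfolding eq using A by (intro measure_UNION_le) auto
  also have "\<dots> \<le> (\<Sum>l<r. 48 * \<theta>0 ^ 4 * eta4 * (real m)\<^sup>2 / \<epsilon> ^ 4)" by (intro sum_mono pA) auto
  finally show "prob (bad_block n \<kappa> m r \<epsilon>) \<le> real r * (48 * \<theta>0 ^ 4 * eta4 * (real m)\<^sup>2 / \<epsilon> ^ 4)" by simp
qed

end

section \<open>Block sums and the reduction to almost maximisers\<close>

context euler_change_model
begin

definition "block_sum n \<kappa> m l \<omega> = (\<Sum>i<m. (\<xi> n (\<kappa> + l * m + i) \<omega>)\<^sup>2 - 1) / sqrt (2 * real m)"

text \<open>Disjoint blocks make the joint law an exact product for every \<open>n\<close>, so only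
  a one-dimensional limit theorem is required.\<close>

lemma block_sum_law:
  assumes n: "0 < n" and m: "0 < m" and r: "0 < r"
  shows "distr M (Pi\<^sub>M {..<r} (\<lambda>_. borel)) (\<lambda>\<omega>. \<lambda>l\<in>{..<r}. block_sum n \<kappa> m l \<omega>) = Pi\<^sub>M {..<r} (\<lambda>_. chisq_sum_law m)"
    and "(\<lambda>\<omega>. \<lambda>l\<in>{..<r}. block_sum n \<kappa> m l \<omega>) \<in> measurable M (Pi\<^sub>M {..<r} (\<lambda>_. borel))"
proof -
  define B where "B l = {\<kappa> + l * m..<\<kappa> + l * m + m}" for l
  have sub: "B l \<subseteq> {..<\<kappa> + r * m}" if "l < r" for l
    using mult_le_mono1[of "Suc l" r m] that by (auto simp: B_def)
  have disj: "disjoint_family_on B {..<r}"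
  proof -
    have "B l \<inter> B l' = {}" if "l < l'" for l l'
      using mult_le_mono1[of "Suc l" l' m] that by (auto simp: B_def)
    then show ?thesis unfolding disjoint_family_on_def by (metis Int_commute nat_neq_iff)
  qed
  have "indep_vars (\<lambda>l. Pi\<^sub>M (B l) (\<lambda>_. borel)) (\<lambda>l \<omega>. \<lambda>i\<in>B l. \<xi> n i \<omega>) {..<r}"
    using sub disj by (intro indep_vars_restrict[OF \<xi>_law(3)[OF n, of "\<kappa> + r * m"]]) auto
  then have "indep_vars (\<lambda>_. borel) (\<lambda>l \<omega>. (\<lambda>x. (\<Sum>i<m. (x (\<kappa> + l * m + i))\<^sup>2 - 1) / sqrt (2 * real m)) (\<lambda>i\<in>B l. \<xi> n i \<omega>)) {..<r}"
  proof (rule indep_vars_compose2)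
    fix l
    show "(\<lambda>x. (\<Sum>i<m. (x (\<kappa> + l * m + i))\<^sup>2 - 1) / sqrt (2 * real m)) \<in> borel_measurable (Pi\<^sub>M (B l) (\<lambda>_. borel :: real measure))"
      by (intro borel_measurable_divide borel_measurable_sum borel_measurable_diff borel_measurable_power borel_measurable_const
          measurable_component_singleton) (auto simp: B_def)
  qed
  moreover have "(\<lambda>l \<omega>. (\<lambda>x. (\<Sum>i<m. (x (\<kappa> + l * m + i))\<^sup>2 - 1) / sqrt (2 * real m)) (\<lambda>i\<in>B l. \<xi> n i \<omega>)) = block_sum n \<kappa> m"
    by (auto simp: fun_eq_iff block_sum_def B_def intro!: sum.cong arg_cong2[where f = divide])
  ultimately have ind: "indep_vars (\<lambda>_. borel) (block_sum n \<kappa> m) {..<r}" by simp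
  have law: "distr M borel (block_sum n \<kappa> m l) = chisq_sum_law m" for l
    unfolding block_sum_def[abs_def]
  proof (rule distr_sum_eq_chisq_sum_law)
    show "indep_vars (\<lambda>_. borel) (\<lambda>i. \<xi> n (\<kappa> + l * m + i)) {..<m}"
      by (rule indep_vars_reindex[OF _ indep_vars_subset[OF \<xi>_law(3)[OF n, of "\<kappa> + l * m + m"]]]) auto
  qed (use m \<xi>_law[OF n] in auto)
  have rv: "block_sum n \<kappa> m l \<in> borel_measurable M" if "l \<in> {..<r}" for l using ind that by (auto simp: indep_vars_def2)
  show "(\<lambda>\<omega>. \<lambda>l\<in>{..<r}. block_sum n \<kappa> m l \<omega>) \<in> measurable M (Pi\<^sub>M {..<r} (\<lambda>_. borel))"
    using rv by (rule measurable_restrict)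
  show "distr M (Pi\<^sub>M {..<r} (\<lambda>_. borel)) (\<lambda>\<omega>. \<lambda>l\<in>{..<r}. block_sum n \<kappa> m l \<omega>) = Pi\<^sub>M {..<r} (\<lambda>_. chisq_sum_law m)"
    using ind r rv by (subst (asm) indep_vars_iff_distr_eq_PiM') (auto simp: law lessThan_empty_iff)
qed

text \<open>Negative because the statistic involves \<open>walk n (k0 n) - walk n k\<close>.\<close>

definition "coef n m J l = - (\<delta> n / (2 * \<theta>0\<^sup>2) * (if l < J then \<theta>1 n else \<theta>2 n) * sqrt (2 * real m))"

text \<open>The change lies on a block boundary, so each block carries a single variance parameter
  and can be standardised as a whole.\<close>

lemma walk_blocks:
  assumes k0: "k0 n = \<kappa> + J * m" and m: "0 < m"
  shows "(\<Sum>l<j. coef n m J l * block_sum n \<kappa> m l \<omega>) = - (\<delta> n / (2 * \<theta>0\<^sup>2) * (walk n (\<kappa> + j * m) \<omega> - walk n \<kappa> \<omega>))"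
proof (induction j)
  case (Suc j)
  have "walk n (\<kappa> + Suc j * m) \<omega> = walk n (\<kappa> + j * m) \<omega> + (\<Sum>i<m. noise n (\<kappa> + j * m + i) \<omega>)"
    using sum.nat_group[of "\<lambda>i. i" 0 0] sum.atLeastLessThan_concat[of 0 "\<kappa> + j * m" "\<kappa> + j * m + m" "\<lambda>i. noise n i \<omega>"]
      sum.shift_bounds_nat_ivl[of "\<lambda>i. noise n i \<omega>" 0 "\<kappa> + j * m" m]
    by (simp add: walk_def atLeast0LessThan add_ac)
  also have "(\<Sum>i<m. noise n (\<kappa> + j * m + i) \<omega>) = (\<Sum>i<m. (if j < J then \<theta>1 n else \<theta>2 n) * ((\<xi> n (\<kappa> + j * m + i) \<omega>)\<^sup>2 - 1))"
  proof (rule sum.cong[OF refl])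
    fix i assume "i \<in> {..<m}"
    then have "\<kappa> + j * m + i < k0 n \<longleftrightarrow> j < J"
    proof (cases "j < J")
      case True
      then show ?thesis using mult_le_mono1[of "Suc j" J m] \<open>i \<in> {..<m}\<close> unfolding k0 by simp
    next
      case False
      then have "J * m \<le> j * m" by simp
      then have "\<not> \<kappa> + j * m + i < \<kappa> + J * m" by linarith
      then show ?thesis using False unfolding k0 by blast
    qed
    then show "noise n (\<kappa> + j * m + i) \<omega> = (if j < J then \<theta>1 n else \<theta>2 n) * ((\<xi> n (\<kappa> + j * m + i) \<omega>)\<^sup>2 - 1)"
      by (simp add: noise_def)
  qed
  also have "\<dots> = (if j < J then \<theta>1 n else \<theta>2 n) * (sqrt (2 * real m) * block_sum n \<kappa> m j \<omega>)"
  proof -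
    have "(\<Sum>i<m. (\<xi> n (\<kappa> + j * m + i) \<omega>)\<^sup>2 - 1) = sqrt (2 * real m) * block_sum n \<kappa> m j \<omega>"
      using m by (simp add: block_sum_def)
    then show ?thesis by (simp only: sum_distrib_left[symmetric])
  qed
  finally have "walk n (\<kappa> + Suc j * m) \<omega> - walk n \<kappa> \<omega> = walk n (\<kappa> + j * m) \<omega> - walk n \<kappa> \<omega>
      + (if j < J then \<theta>1 n else \<theta>2 n) * (sqrt (2 * real m) * block_sum n \<kappa> m j \<omega>)" by simp
  then show ?case using Suc unfolding sum.lessThan_Suc coef_def by (simp only: distrib_left) (simp add: mult_ac)
qed simp

text \<open>The deterministic core: off the bad events, an estimator with scaled position in
  \<open>S\<close> makes the block containing it an almost maximiser of the discretised path. The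
  slack \<open>6 * \<epsilon>\<close> has room for 2 \<epsilon> from the expansion of the statistic,
  2 \<epsilon> from replacing the estimator by a block boundary, and \<epsilon> from the mismatch
  between \<open>a n * m\<close> and \<open>h\<close>.\<close>

lemma snapshot:
  fixes \<gamma> h \<epsilon> :: real
  assumes n: "2 \<le> n" and J: "0 < J" and h: "0 < h" "h \<le> \<epsilon>"
    and \<gamma>: "0 < \<gamma>" "\<gamma> \<le> 1" "\<gamma> * n \<le> k0 n" "\<gamma> * n \<le> real n - k0 n"
    and \<delta>: "0 < \<delta> n" and lam: "16 * lam n * sqrt n \<le> \<delta> n * sqrt (real (k0 n) * (real n - k0 n))"
    and m: "0 < m" "real J * m \<le> \<gamma> * n / 2" "a n * m \<le> h" "real J * \<bar>a n * m - h\<bar> \<le> h"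
    and err: "\<delta> n / (2 * \<theta>0\<^sup>2) * (real J * m / (\<gamma> ^ 3 * n) * (8 * lam n * sqrt n + 2 * \<delta> n * (real J * m))) \<le> \<epsilon>"
    and \<omega>: "\<omega> \<in> space M" "\<omega> \<notin> bad_sqrt n" "\<omega> \<notin> bad_linear n (real (J * m))"
      "\<omega> \<notin> bad_block n (k0 n - J * m) m (2 * J) (2 * \<theta>0\<^sup>2 * \<epsilon> / \<delta> n)"
    and S: "a n * (real (k_hat n \<omega>) - real (k0 n)) \<in> S"
  shows "(\<lambda>l\<in>{..<2 * J}. block_sum n (k0 n - J * m) m l \<omega>) \<in> almost_max (coef n m J) h J (6 * \<epsilon>)
      (near_grid S h J)"
proof -
  define \<kappa> where "\<kappa> = k0 n - J * m"
  have n0: "0 < n" using n by simp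
  have gn: "0 < \<gamma> * n" using \<gamma>(1) n0 by simp
  have Jm_lt: "real (J * m) < k0 n" "real (k0 n) + real (J * m) < n" using m(2) \<gamma>(3,4) gn by simp_all
  have "J * m < k0 n" using Jm_lt(1) by (simp only: of_nat_less_iff)
  then have k0: "k0 n = \<kappa> + J * m" "0 < \<kappa>" by (simp_all add: \<kappa>_def)
  have k0n: "0 < k0 n" "k0 n < n" using Jm_lt \<gamma>(4) gn by linarith+
  have "k0 n + J * m < n" using Jm_lt(2) by (simp only: of_nat_less_iff flip: of_nat_add)
  then have end_lt: "\<kappa> + 2 * J * m < n" using k0(1) by simp
  have lam_bounds: "\<bar>walk n k \<omega>\<bar> \<le> lam n * sqrt k" "\<bar>walk n n \<omega> - walk n k \<omega>\<bar> \<le> lam n * sqrt (real n - k)" if "k \<le> n" for k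
  proof -
    have *: "\<bar>walk n (Suc k) \<omega>\<bar> < lam n * sqrt (Suc k)" "\<bar>walk n n \<omega> - walk n (n - Suc k) \<omega>\<bar> < lam n * sqrt (Suc k)"
      if "k < n" for k using \<omega>(1,2) that unfolding bad_sqrt_def by (auto simp: not_le)
    show "\<bar>walk n k \<omega>\<bar> \<le> lam n * sqrt k" using *(1)[of "k - 1"] that by (cases k) (auto simp: walk_def)
    have "\<bar>walk n n \<omega> - walk n (n - i) \<omega>\<bar> \<le> lam n * sqrt i" if "i \<le> n" for i
      using *(2)[of "i - 1"] that by (cases i) (auto simp: walk_def)
    from this[of "n - k"] that show "\<bar>walk n n \<omega> - walk n k \<omega>\<bar> \<le> lam n * sqrt (real n - k)" by (simp add: of_nat_diff)
  qed
  interpret P: change_path n "k0 n" "\<theta>1 n" "\<theta>2 n" "lam n" "\<lambda>k. walk n k \<omega>" "y n \<omega>"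
  proof
    show "\<theta>1 n < \<theta>2 n" using \<delta> by (simp add: \<delta>_def)
  qed (fact k0n lam_bounds sum_y[OF n0 \<omega>(1)])+
  have P\<theta>: "P.\<theta> = \<delta> n" by (simp add: P.\<theta>_def \<delta>_def)
  define k where "k = k_hat n \<omega>"
  note LS = least_squares_maximises_cusum[OF k_hat[OF n \<omega>(1)], folded y_def k_def]
  have k: "k \<in> {1..n - 1}" and cus_abs: "\<And>j. j \<in> {1..n - 1} \<Longrightarrow> \<bar>cusum (y n \<omega>) n j\<bar> \<le> \<bar>cusum (y n \<omega>) n k\<bar>"
    using LS by blast+
  have cus_le: "\<And>j. j \<in> {1..n - 1} \<Longrightarrow> cusum (y n \<omega>) n j \<le> cusum (y n \<omega>) n k"
    and dist: "\<delta> n * \<bar>real k - real (k0 n)\<bar> / 16 \<le> \<bar>walk n k \<omega> - walk n (k0 n) \<omega>\<bar>"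
    using P.maximiser_near_change[OF lam[folded P\<theta>] k cus_abs] unfolding P\<theta> by blast+
  have near: "\<bar>real k - real (k0 n)\<bar> < real (J * m)"
  proof (rule ccontr)
    assume "\<not> ?thesis"
    then have "\<omega> \<in> bad_linear n (real (J * m))"
      unfolding bad_linear_def using \<omega>(1) k dist by (auto intro!: exI[of _ k])
    with \<omega>(3) show False by simp
  qed
  have k_ge: "\<kappa> \<le> k" and k_lt: "k < \<kappa> + 2 * J * m"
  proof -
    have "real (k0 n) = real \<kappa> + real (J * m)" using k0(1) by simp
    then have "real \<kappa> < real k" "real k < real \<kappa> + real (J * m) + real (J * m)" using near by linarith+
    then have "\<kappa> < k" "k < \<kappa> + J * m + J * m" by (simp_all only: of_nat_less_iff flip: of_nat_add)
    then show "\<kappa> \<le> k" "k < \<kappa> + 2 * J * m" by simp_all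
  qed
  define i t where "i = (k - \<kappa>) div m" and "t = (k - \<kappa>) mod m"
  have k_eq: "k = \<kappa> + i * m + t" and t: "t < m" using k_ge m(1) by (simp_all add: i_def t_def)
  have i: "i < 2 * J" using k_lt k_ge m(1) unfolding i_def by (intro less_mult_imp_div_less) simp
  \<comment> \<open>With this factor the drift \<delta> per step becomes \<open>a n\<close>, and the
    noise gets variance about \<open>a n\<close> per step.\<close>
  define \<beta> where "\<beta> = \<delta> n / (2 * \<theta>0\<^sup>2)"
  have \<beta>: "0 < \<beta>" using \<delta> theta0 by (simp add: \<beta>_def)
  have \<beta>\<delta>: "\<beta> * \<delta> n = a n" by (simp add: \<beta>_def a_def power2_eq_square)
  have a0: "0 < a n" using \<delta> theta0 by (simp add: a_def)
  define H where "H k = \<beta> * (walk n (k0 n) \<omega> - walk n k \<omega> - \<delta> n * \<bar>real k - real (k0 n)\<bar> / 2)" for k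
  let ?C = "\<lambda>j. sqrt (real (k0 n) * (real n - k0 n)) * (cusum (y n \<omega>) n j - cusum (y n \<omega>) n (k0 n))"
  have expand: "\<bar>\<beta> * ?C j - H j\<bar> \<le> \<epsilon>" if j: "j \<in> {1..n - 1}" "\<bar>real j - real (k0 n)\<bar> \<le> real J * m" for j
  proof -
    let ?T = "walk n (k0 n) \<omega> - walk n j \<omega> - \<delta> n * \<bar>real j - real (k0 n)\<bar> / 2"
    have "\<bar>?C j - ?T\<bar> \<le> \<bar>real j - real (k0 n)\<bar> / (\<gamma> ^ 3 * n) * (8 * lam n * sqrt n + 2 * \<delta> n * \<bar>real j - real (k0 n)\<bar>)"
      using P.local_cusum_expansion[OF \<gamma> j(1)] j(2) m(2) unfolding P\<theta> by simp
    also have "\<dots> \<le> real J * m / (\<gamma> ^ 3 * n) * (8 * lam n * sqrt n + 2 * \<delta> n * (real J * m))"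
      using j(2) \<gamma> n0 \<delta> P.lam_nonneg by (intro mult_mono divide_right_mono add_mono mult_left_mono) auto
    finally have "\<beta> * \<bar>?C j - ?T\<bar> \<le> \<beta> * (real J * m / (\<gamma> ^ 3 * n) * (8 * lam n * sqrt n + 2 * \<delta> n * (real J * m)))"
      using \<beta> by (intro mult_left_mono) auto
    also have "\<dots> \<le> \<epsilon>" using err by (simp add: \<beta>_def)
    also have "\<beta> * \<bar>?C j - ?T\<bar> = \<bar>\<beta> * ?C j - H j\<bar>"
      unfolding H_def right_diff_distrib[symmetric] using \<beta> by (simp add: abs_mult)
    finally show ?thesis .
  qed
  have grid_dist: "\<bar>real (\<kappa> + j * m) - real (k0 n)\<bar> = \<bar>real j - real J\<bar> * m" for j
  proof -
    have "real (\<kappa> + j * m) - real (k0 n) = (real j - real J) * m" using k0 by (simp add: algebra_simps)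
    then show ?thesis by (simp add: abs_mult)
  qed
  have grid_in: "\<kappa> + j * m \<in> {1..n - 1}" "\<bar>real (\<kappa> + j * m) - real (k0 n)\<bar> \<le> real J * m" if "j \<le> 2 * J" for j
  proof -
    have "\<kappa> + j * m < n" using mult_le_mono1[OF that, of m] end_lt by linarith
    then show "\<kappa> + j * m \<in> {1..n - 1}" using k0(2) by simp
    show "\<bar>real (\<kappa> + j * m) - real (k0 n)\<bar> \<le> real J * m"
      unfolding grid_dist using that by (intro mult_right_mono) auto
  qed
  have H_le: "H (\<kappa> + j * m) \<le> H k + 2 * \<epsilon>" if "j \<le> 2 * J" for j
  proof -
    have "\<beta> * ?C (\<kappa> + j * m) \<le> \<beta> * ?C k"
      using cus_le[OF grid_in(1)[OF that]] \<beta> k0n by (intro mult_left_mono) auto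
    moreover have "\<bar>real k - real (k0 n)\<bar> \<le> real J * m" using near by simp
    moreover have "v \<le> z + 2 * \<epsilon>" if "\<bar>u - v\<bar> \<le> \<epsilon>" "\<bar>w - z\<bar> \<le> \<epsilon>" "u \<le> w" for u v w z :: real
      using that by linarith
    ultimately show ?thesis using expand[OF grid_in[OF that]] expand[OF k] by blast
  qed
  \<comment> \<open>Moving to the left end of the block changes the noise part by at most
    \<epsilon>, off \<open>bad_block\<close>, and the drift part by at most h / 2.\<close>
  have H_block: "H k \<le> H (\<kappa> + i * m) + 2 * \<epsilon>"
  proof -
    have "\<bar>walk n k \<omega> - walk n (\<kappa> + i * m) \<omega>\<bar> \<le> 2 * \<theta>0\<^sup>2 * \<epsilon> / \<delta> n"
    proof (cases t)
      case 0
      then show ?thesis using k_eq \<delta> h theta0 by simp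
    next
      case (Suc t')
      then have "\<not> 2 * \<theta>0\<^sup>2 * \<epsilon> / \<delta> n \<le> \<bar>walk n (\<kappa> + i * m + Suc t') \<omega> - walk n (\<kappa> + i * m) \<omega>\<bar>"
        using \<omega>(1,4) i t unfolding bad_block_def \<kappa>_def[symmetric] by auto
      then show ?thesis using k_eq Suc by simp
    qed
    then have "\<beta> * \<bar>walk n k \<omega> - walk n (\<kappa> + i * m) \<omega>\<bar> \<le> \<beta> * (2 * \<theta>0\<^sup>2 * \<epsilon> / \<delta> n)" using \<beta> by (intro mult_left_mono) auto
    also have "\<dots> = \<epsilon>" using \<delta> theta0 by (simp add: \<beta>_def)
    finally have 1: "\<bar>\<beta> * (walk n (\<kappa> + i * m) \<omega> - walk n k \<omega>)\<bar> \<le> \<epsilon>" using \<beta> by (simp add: abs_mult abs_minus_commute)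
    have "\<bar>real (\<kappa> + i * m) - real (k0 n)\<bar> - \<bar>real k - real (k0 n)\<bar> \<le> m" using k_eq t by simp
    then have "\<beta> * \<delta> n * (\<bar>real (\<kappa> + i * m) - real (k0 n)\<bar> - \<bar>real k - real (k0 n)\<bar>) \<le> \<beta> * \<delta> n * m"
      using \<beta> \<delta> by (intro mult_left_mono) auto
    then have 2: "a n * (\<bar>real (\<kappa> + i * m) - real (k0 n)\<bar> - \<bar>real k - real (k0 n)\<bar>) \<le> h" using m(3) unfolding \<beta>\<delta> by linarith
    have d: "H k - H (\<kappa> + i * m) = \<beta> * (walk n (\<kappa> + i * m) \<omega> - walk n k \<omega>)
        + \<beta> * \<delta> n * (\<bar>real (\<kappa> + i * m) - real (k0 n)\<bar> - \<bar>real k - real (k0 n)\<bar>) / 2"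
    proof -
      have "B * (p - q - d * x / 2) - B * (p - r - d * z / 2) = B * (r - q) + B * d * (z - x) / 2" for B p q r d x z :: real
        by (simp add: field_simps)
      then show ?thesis unfolding H_def .
    qed
    have "u \<le> v + 2 * \<epsilon>" if "u - v = p + q / 2" "\<bar>p\<bar> \<le> \<epsilon>" "q \<le> h" for u v p q :: real
      using that h by linarith
    from this[OF d[unfolded \<beta>\<delta>] 1 2] show ?thesis .
  qed
  \<comment> \<open>The last summand corrects the cell width: a block has length
    \<open>a n * m\<close> while the limit grid has mesh \<open>h\<close>. The preceding constants
    do not depend on \<open>j\<close>.\<close>
  have path: "drifted_path (coef n m J) h J j (\<lambda>l\<in>{..<2 * J}. block_sum n \<kappa> m l \<omega>)
      = H (\<kappa> + j * m) - H \<kappa> - a n * (real J * m) / 2 + (a n * m - h) * \<bar>real j - real J\<bar> / 2" if "j \<le> 2 * J" for j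
  proof -
    have "(\<Sum>l<j. coef n m J l * (\<lambda>l\<in>{..<2 * J}. block_sum n \<kappa> m l \<omega>) l) = (\<Sum>l<j. coef n m J l * block_sum n \<kappa> m l \<omega>)"
      using that by (intro sum.cong) auto
    also have "\<dots> = - (\<beta> * (walk n (\<kappa> + j * m) \<omega> - walk n \<kappa> \<omega>))"
      unfolding \<beta>_def by (rule walk_blocks[OF k0(1) m(1)])
    finally have s: "(\<Sum>l<j. coef n m J l * (\<lambda>l\<in>{..<2 * J}. block_sum n \<kappa> m l \<omega>) l) = - (\<beta> * (walk n (\<kappa> + j * m) \<omega> - walk n \<kappa> \<omega>))" .
    have H\<kappa>: "H \<kappa> = \<beta> * (walk n (k0 n) \<omega> - walk n \<kappa> \<omega> - \<delta> n * (real J * m) / 2)"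
      unfolding H_def using grid_dist[of 0] by simp
    have "- (B * (q - r)) - x * h / 2 = B * (p - q - d * (x * m) / 2) - B * (p - r - d * (z * m) / 2)
        - B * d * (z * m) / 2 + (B * d * m - h) * x / 2" for B p q r d x z :: real
      by (simp add: field_simps)
    then show ?thesis unfolding drifted_path_def s \<beta>\<delta>[symmetric] H\<kappa> unfolding H_def grid_dist .
  qed
  have slack: "\<bar>(a n * m - h) * \<bar>real j - real J\<bar> / 2\<bar> \<le> \<epsilon> / 2" if "j \<le> 2 * J" for j
  proof -
    have "\<bar>(a n * m - h) * \<bar>real j - real J\<bar>\<bar> \<le> \<bar>a n * m - h\<bar> * real J"
      unfolding abs_mult abs_abs using that by (intro mult_left_mono) auto
    then show ?thesis using m(4) h by (simp add: mult.commute)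
  qed
  have i_le: "i \<le> 2 * J" using i by simp
  have "drifted_path (coef n m J) h J j (\<lambda>l\<in>{..<2 * J}. block_sum n \<kappa> m l \<omega>)
      \<le> drifted_path (coef n m J) h J i (\<lambda>l\<in>{..<2 * J}. block_sum n \<kappa> m l \<omega>) + 6 * \<epsilon>" if "j \<le> 2 * J" for j
  proof -
    have "p - c - d + x \<le> r - c - d + z + 6 * \<epsilon>"
      if "p \<le> q + 2 * \<epsilon>" "q \<le> r + 2 * \<epsilon>" "x \<le> \<epsilon> / 2" "- z \<le> \<epsilon> / 2" for p q r c d x z :: real
      using that h by linarith
    from this[OF H_le[OF that] H_block abs_le_D1[OF slack[OF that]] abs_le_D2[OF slack[OF i_le]]]
    show ?thesis unfolding path[OF that] path[OF i_le] .
  qed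
  moreover have "\<bar>(real i - real J) * h - a n * (real k - real (k0 n))\<bar> \<le> 3 * h"
  proof -
    have "real k = real \<kappa> + real i * real m + real t" "real (k0 n) = real \<kappa> + real J * real m"
      by (simp_all only: k_eq k0(1) of_nat_add of_nat_mult)
    then have kk: "real k - real (k0 n) = (real i - real J) * m + t" by (simp only: left_diff_distrib)
    have "(real i - real J) * h - a n * (real k - real (k0 n)) = - ((real i - real J) * (a n * m - h)) - a n * t"
      unfolding kk by (simp add: algebra_simps)
    moreover have "\<bar>(real i - real J) * (a n * m - h)\<bar> \<le> h"
    proof -
      have "\<bar>(real i - real J) * (a n * m - h)\<bar> \<le> real J * \<bar>a n * m - h\<bar>"
        unfolding abs_mult using i_le by (intro mult_right_mono) auto
      then show ?thesis using m(4) by linarith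
    qed
    moreover have "0 \<le> a n * t" "a n * t \<le> a n * m" using a0 t by auto
    ultimately show ?thesis using m(3) h by linarith
  qed
  ultimately show ?thesis
    unfolding almost_max_def near_grid_def \<kappa>_def[symmetric] using S i_le unfolding k_def by auto
qed

end

lemma drifted_path_tendsto:
  assumes "\<And>l. l < 2 * J \<Longrightarrow> (\<lambda>n. cs n l) \<longlonglongrightarrow> c l" "\<And>l. l < 2 * J \<Longrightarrow> (\<lambda>n. xs n l) \<longlonglongrightarrow> x l" "j \<le> 2 * J"
  shows "(\<lambda>n. drifted_path (cs n) h J j (xs n)) \<longlonglongrightarrow> drifted_path c h J j x"
  unfolding drifted_path_def using assms by (intro tendsto_diff tendsto_sum tendsto_mult tendsto_const) auto

text \<open>Failure to be an almost maximiser means a strict inequality for each of finitely many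
  indices, and strict inequalities survive small changes of both the point and the
  coefficients.\<close>

lemma almost_max_closed:
  assumes "\<And>l. l < 2 * J \<Longrightarrow> (\<lambda>n. cs n l) \<longlonglongrightarrow> c l" "\<And>l. l < 2 * J \<Longrightarrow> (\<lambda>n. xs n l) \<longlonglongrightarrow> x l"
    and A: "A \<subseteq> {..2 * J}" and x: "x \<in> extensional {..<2 * J}" "x \<notin> almost_max c h J e A"
  shows "\<forall>\<^sub>F n in sequentially. xs n \<notin> almost_max (cs n) h J e A"
proof -
  note lim = drifted_path_tendsto[OF assms(1,2), where h = h]
  have "\<forall>\<^sub>F n in sequentially. \<exists>i\<le>2 * J. drifted_path (cs n) h J j (xs n) + e < drifted_path (cs n) h J i (xs n)"
    if j: "j \<in> A" for j
  proof -
    obtain i where i: "i \<le> 2 * J" "drifted_path c h J j x + e < drifted_path c h J i x"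
      using x j unfolding almost_max_def by (auto simp: not_le)
    have "(\<lambda>n. drifted_path (cs n) h J i (xs n) - drifted_path (cs n) h J j (xs n))
        \<longlonglongrightarrow> drifted_path c h J i x - drifted_path c h J j x"
      using A j i by (intro tendsto_diff lim) auto
    then have "\<forall>\<^sub>F n in sequentially. e < drifted_path (cs n) h J i (xs n) - drifted_path (cs n) h J j (xs n)"
      using i by (intro order_tendstoD) auto
    then show ?thesis by (rule eventually_mono) (use i in \<open>auto intro!: exI[of _ i]\<close>)
  qed
  then have "\<forall>\<^sub>F n in sequentially. \<forall>j\<in>A. \<exists>i\<le>2 * J. drifted_path (cs n) h J j (xs n) + e < drifted_path (cs n) h J i (xs n)"
    using finite_subset[OF A] by (intro eventually_ball_finite) auto
  then show ?thesis
    by (rule eventually_mono) (force simp: almost_max_def not_le)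
qed

section \<open>Asymptotic orders of the parameters\<close>

context euler_change_model
begin

lemma ln_ge_1: "3 \<le> n \<Longrightarrow> 1 \<le> ln (real n)"
proof -
  assume n: "3 \<le> n"
  then have "exp 1 \<le> real n" using exp_le by linarith
  then show ?thesis using n by (simp add: ln_ge_iff)
qed

definition "rate n = sqrt (real n) * \<delta> n / sqrt (ln (real n))"

lemma rate_at_top: "filterlim rate at_top sequentially"
  using jump_rate unfolding rate_def[abs_def] \<delta>_def .

lemma ev_rate_pos: "\<forall>\<^sub>F n in sequentially. 0 < rate n \<and> 3 \<le> n"
  using filterlim_at_top_dense[THEN iffD1, OF rate_at_top] eventually_ge_at_top by (intro eventually_conj) auto

text \<open>The rate diverges to plus infinity, not merely in absolute value; this fixes the sign of
  the jump.\<close>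

lemma ev_delta_pos: "\<forall>\<^sub>F n in sequentially. 0 < \<delta> n"
  using ev_rate_pos
proof eventually_elim
  case (elim n)
  then have "0 < sqrt (ln (real n))" using ln_ge_1[of n] by simp
  then have "0 < sqrt (real n) * \<delta> n" using elim unfolding rate_def by (auto simp: zero_less_divide_iff)
  then show ?case by (auto simp: zero_less_mult_iff)
qed

lemma signal_at_top: "filterlim (\<lambda>n. sqrt (real n) * \<delta> n) at_top sequentially"
proof (rule filterlim_at_top_mono[OF rate_at_top])
  show "\<forall>\<^sub>F n in sequentially. rate n \<le> sqrt (real n) * \<delta> n"
    using ev_rate_pos ev_delta_pos
  proof eventually_elim
    case (elim n)
    have "1 \<le> sqrt (ln (real n))" using ln_ge_1[of n] elim by simp
    then have "sqrt (real n) * \<delta> n / sqrt (ln (real n)) \<le> sqrt (real n) * \<delta> n / 1"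
      using elim by (intro divide_left_mono) auto
    then show ?case by (simp add: rate_def)
  qed
qed

text \<open>\<open>lam n\<close> is sqrt (ln n) times the square root of \<open>rate n\<close>, and
  the signal is sqrt (ln n) times \<open>rate n\<close>, so the quotient is 1 / sqrt (rate
  n).\<close>

lemma lam_over_signal: "(\<lambda>n. lam n / (sqrt (real n) * \<delta> n)) \<longlonglongrightarrow> 0"
proof -
  have "(\<lambda>n. inverse (sqrt (rate n))) \<longlonglongrightarrow> 0"
    by (intro tendsto_inverse_0_at_top filterlim_compose[OF sqrt_at_top rate_at_top])
  moreover have "\<forall>\<^sub>F n in sequentially. inverse (sqrt (rate n)) = lam n / (sqrt (real n) * \<delta> n)"
    using ev_rate_pos
  proof eventually_elim
    case (elim n)
    define s where "s = sqrt (ln (real n))"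
    have s: "0 < s" using ln_ge_1[of n] elim by (simp add: s_def)
    have D: "sqrt (real n) * \<delta> n = rate n * s" using s by (simp add: rate_def s_def)
    have l: "lam n = s * sqrt (rate n)" by (simp add: lam_def rate_def s_def)
    have "lam n / (sqrt (real n) * \<delta> n) = sqrt (rate n) / rate n" unfolding D l using s by simp
    also have "\<dots> = inverse (sqrt (rate n))" using elim by (simp add: sqrt_divide_self_eq)
    finally show ?case by simp
  qed
  ultimately show ?thesis by (rule Lim_transform_eventually)
qed

text \<open>Since lam^2 is ln n times the rate, the logarithm of the maximal inequality cancels and
  a bound of order 1 / rate remains.\<close>

lemma prob_bad_sqrt_tendsto: "(\<lambda>n. 16 * \<theta>0\<^sup>2 * (1 + ln (real n)) / (lam n)\<^sup>2) \<longlonglongrightarrow> 0"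
proof (rule tendsto_sandwich[of "\<lambda>_. 0"])
  have "(\<lambda>n. 32 * \<theta>0\<^sup>2 * inverse (rate n)) \<longlonglongrightarrow> 32 * \<theta>0\<^sup>2 * 0"
    by (intro tendsto_mult tendsto_const tendsto_inverse_0_at_top rate_at_top)
  then show "(\<lambda>n. 32 * \<theta>0\<^sup>2 * inverse (rate n)) \<longlonglongrightarrow> 0" by simp
  show "\<forall>\<^sub>F n in sequentially. 0 \<le> 16 * \<theta>0\<^sup>2 * (1 + ln (real n)) / (lam n)\<^sup>2"
    using ev_rate_pos by eventually_elim (use ln_ge_1 in force)
  show "\<forall>\<^sub>F n in sequentially. 16 * \<theta>0\<^sup>2 * (1 + ln (real n)) / (lam n)\<^sup>2 \<le> 32 * \<theta>0\<^sup>2 * inverse (rate n)"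
    using ev_rate_pos
  proof eventually_elim
    case (elim n)
    have l1: "1 \<le> ln (real n)" using ln_ge_1 elim by simp
    have l: "(lam n)\<^sup>2 = ln (real n) * rate n"
      using l1 elim by (simp add: lam_def rate_def[symmetric] power_mult_distrib)
    have "16 * \<theta>0\<^sup>2 * (1 + ln (real n)) / (lam n)\<^sup>2 \<le> 16 * \<theta>0\<^sup>2 * (2 * ln (real n)) / (lam n)\<^sup>2"
      using l1 by (intro divide_right_mono mult_left_mono) auto
    also have "\<dots> = 32 * \<theta>0\<^sup>2 * inverse (rate n)" unfolding l using l1 elim by (simp add: divide_simps)
    finally show ?case .
  qed
qed simp

lemma delta_tendsto: "\<delta> \<longlonglongrightarrow> 0"
  using tendsto_diff[OF theta_lim(2,1)] by (simp add: \<delta>_def[abs_def])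

lemma a_tendsto: "a \<longlonglongrightarrow> 0"
proof -
  have "(\<lambda>n. (\<delta> n)\<^sup>2 / (2 * \<theta>0\<^sup>2)) \<longlonglongrightarrow> 0\<^sup>2 / (2 * \<theta>0\<^sup>2)"
    using theta0 by (intro tendsto_divide tendsto_power delta_tendsto tendsto_const) auto
  then show ?thesis by (simp add: a_def[abs_def])
qed

lemma ev_a_pos: "\<forall>\<^sub>F n in sequentially. 0 < a n"
  using ev_delta_pos by eventually_elim (use theta0 in \<open>simp add: a_def\<close>)

lemma inverse_signal_square: "(\<lambda>n. 1 / (real n * (\<delta> n)\<^sup>2)) \<longlonglongrightarrow> 0"
proof -
  have "(\<lambda>n. (inverse (sqrt (real n) * \<delta> n))\<^sup>2) \<longlonglongrightarrow> 0\<^sup>2"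
    by (intro tendsto_power tendsto_inverse_0_at_top signal_at_top)
  then show ?thesis by (simp add: power_mult_distrib inverse_eq_divide power_divide)
qed

text \<open>Half the distance of \<tau> from the ends of the unit interval; the other half leaves
  room for the integer part in \<open>k0\<close>.\<close>

definition "\<gamma> = min \<tau> (1 - \<tau>) / 2"

lemma gamma: "0 < \<gamma>" "\<gamma> \<le> 1" using tau by (auto simp: \<gamma>_def)

lemma k0_bounds: "real n * \<tau> - 1 \<le> real (k0 n)" "real (k0 n) \<le> real n * \<tau>"
proof -
  have "0 \<le> real n * \<tau>" using tau by simp
  then show "real n * \<tau> - 1 \<le> real (k0 n)" "real (k0 n) \<le> real n * \<tau>"
    unfolding k0_def change_index_def by linarith+
qed

lemma ev_k0: "\<forall>\<^sub>F n in sequentially. \<gamma> * n \<le> k0 n \<and> \<gamma> * n \<le> real n - k0 n"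
proof -
  have "\<forall>\<^sub>F n in sequentially. 2 / \<tau> \<le> real n"
    by (rule eventually_sequentiallyI[of "nat \<lceil>2 / \<tau>\<rceil>"]) linarith
  then show ?thesis
  proof eventually_elim
    case (elim n)
    have "2 \<le> real n * \<tau>" using elim tau by (simp add: divide_le_eq)
    moreover have "\<gamma> * n \<le> \<tau> / 2 * n" "\<gamma> * n \<le> (1 - \<tau>) / 2 * n"
      unfolding \<gamma>_def by (intro mult_right_mono; simp)+
    then have "\<gamma> * n \<le> real n * \<tau> / 2" "\<gamma> * n \<le> (real n - real n * \<tau>) / 2"
      by (simp_all add: algebra_simps)
    moreover have "real n * \<tau> \<le> real n" using tau by (simp add: mult_left_le)
    moreover have "u \<le> k \<and> u \<le> r - k"
      if "2 \<le> x" "u \<le> x / 2" "u \<le> (r - x) / 2" "x \<le> r" "x - 1 \<le> k" "k \<le> x" for u x r k :: real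
    proof
      show "u \<le> k" using that by linarith
      have "(r - x) / 2 \<le> r - k" using that(4,6) by (simp add: field_simps)
      then show "u \<le> r - k" using that(3) by linarith
    qed
    ultimately show ?case using k0_bounds[of n] by blast
  qed
qed

definition "m h n = nat \<lfloor>h / a n\<rfloor>"

lemma m_bounds: "0 < h \<Longrightarrow> 0 < a n \<Longrightarrow> a n * m h n \<le> h" "0 < h \<Longrightarrow> 0 < a n \<Longrightarrow> h - a n \<le> a n * m h n"
proof -
  assume h: "0 < h" "0 < a n"
  then have "0 \<le> h / a n" by simp
  then have "real (m h n) \<le> h / a n" "h / a n - 1 \<le> real (m h n)" unfolding m_def by linarith+
  then show "a n * m h n \<le> h" "h - a n \<le> a n * m h n" using h by (simp_all add: field_simps)
qed

lemma am_tendsto: assumes "0 < h" shows "(\<lambda>n. a n * m h n) \<longlonglongrightarrow> h"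
proof (rule tendsto_sandwich[of "\<lambda>n. h - a n" _ _ "\<lambda>_. h"])
  show "(\<lambda>n. h - a n) \<longlonglongrightarrow> h" using tendsto_diff[OF tendsto_const a_tendsto, of h] by simp
  show "\<forall>\<^sub>F n in sequentially. h - a n \<le> a n * m h n" "\<forall>\<^sub>F n in sequentially. a n * m h n \<le> h"
    using ev_a_pos m_bounds[OF assms] by (auto elim!: eventually_mono)
qed simp

lemma m_at_top: assumes "0 < h" shows "filterlim (m h) at_top sequentially"
  unfolding filterlim_at_top
proof
  fix Z :: nat
  have "\<forall>\<^sub>F n in sequentially. a n < h / (real Z + 1)"
    using a_tendsto assms by (intro order_tendstoD) auto
  then show "\<forall>\<^sub>F n in sequentially. Z \<le> m h n"
    using ev_a_pos
  proof eventually_elim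
    case (elim n)
    then have "real Z \<le> h / a n" using assms by (simp add: field_simps)
    then show ?case unfolding m_def by linarith
  qed
qed

text \<open>Up to sign the coefficient is \<theta> / \<theta>0 times sqrt (a m), where \<theta> is
  the parameter of the block and a m tends to h.\<close>

lemma coef_tendsto: assumes "0 < h" shows "(\<lambda>n. coef n (m h n) J l) \<longlonglongrightarrow> - sqrt h"
proof -
  define \<theta> where "\<theta> = (if l < J then \<theta>1 else \<theta>2)"
  have "(\<lambda>n. - (\<theta> n / \<theta>0 * sqrt (a n * m h n))) \<longlonglongrightarrow> - (\<theta>0 / \<theta>0 * sqrt h)"
    using theta_lim theta0 unfolding \<theta>_def
    by (intro tendsto_minus tendsto_mult tendsto_divide tendsto_real_sqrt am_tendsto[OF assms] tendsto_const) auto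
  moreover have "\<forall>\<^sub>F n in sequentially. - (\<theta> n / \<theta>0 * sqrt (a n * m h n)) = coef n (m h n) J l"
    using ev_delta_pos
  proof eventually_elim
    case (elim n)
    have "sqrt (a n * m h n) = sqrt ((\<delta> n / (2 * \<theta>0))\<^sup>2 * (2 * real (m h n)))"
      using theta0 by (simp add: a_def power_divide power_mult_distrib)
    also have "\<dots> = \<delta> n / (2 * \<theta>0) * sqrt (2 * real (m h n))"
      using elim theta0 by (simp add: real_sqrt_mult)
    finally show ?case using theta0 by (simp add: coef_def \<theta>_def power2_eq_square mult_ac)
  qed
  ultimately have "(\<lambda>n. coef n (m h n) J l) \<longlonglongrightarrow> - (\<theta>0 / \<theta>0 * sqrt h)" by (rule Lim_transform_eventually)
  then show ?thesis using theta0 by simp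
qed

end

section \<open>Asymptotic upper bounds for closed sets\<close>

context euler_change_model
begin

definition "scaled n \<omega> = a n * (real (k_hat n \<omega>) - real (k0 n))"

lemma scaled_measurable: "scaled n \<in> borel_measurable M"
proof -
  have "(\<lambda>k. a n * (real k - real (k0 n))) \<in> measurable (count_space UNIV) borel" by simp
  from measurable_compose[OF k_hat_measurable[of n] this] show ?thesis by (simp add: scaled_def[abs_def])
qed

text \<open>Block lengths are of order \<delta>^-2, so the error is a multiple of lam / (sqrt n
  \<delta>) plus a multiple of 1 / (n \<delta>^2); both vanish.\<close>

lemma ev_expansion_error:
  assumes h: "0 < h" and J: "0 < J" and \<epsilon>: "0 < \<epsilon>"
  shows "\<forall>\<^sub>F n in sequentially. \<delta> n / (2 * \<theta>0\<^sup>2) *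
      (real J * m h n / (\<gamma> ^ 3 * n) * (8 * lam n * sqrt n + 2 * \<delta> n * (real J * m h n))) \<le> \<epsilon>"
proof -
  define C where "C = real J * h / \<gamma> ^ 3"
  have C0: "0 \<le> C" using h gamma by (simp add: C_def)
  have "(\<lambda>n. C * (8 * (lam n / (sqrt n * \<delta> n)) + 4 * \<theta>0\<^sup>2 * real J * h * (1 / (real n * (\<delta> n)\<^sup>2))))
      \<longlonglongrightarrow> C * (8 * 0 + 4 * \<theta>0\<^sup>2 * real J * h * 0)"
    by (intro tendsto_mult tendsto_add tendsto_const lam_over_signal inverse_signal_square)
  then have "\<forall>\<^sub>F n in sequentially. C * (8 * (lam n / (sqrt n * \<delta> n)) + 4 * \<theta>0\<^sup>2 * real J * h * (1 / (real n * (\<delta> n)\<^sup>2))) < \<epsilon>"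
    using \<epsilon> by (intro order_tendstoD) auto
  then show ?thesis
    using ev_rate_pos ev_delta_pos ev_a_pos
  proof eventually_elim
    case (elim n)
    have n: "0 < real n" and d: "0 < \<delta> n" using elim by auto
    have am: "\<delta> n * m h n \<le> 2 * \<theta>0\<^sup>2 * h / \<delta> n"
    proof -
      have "\<delta> n * (\<delta> n * m h n) \<le> 2 * \<theta>0\<^sup>2 * h"
        using m_bounds(1)[OF h, of n] elim theta0 by (simp add: a_def power2_eq_square field_simps)
      then show ?thesis using d by (simp add: pos_le_divide_eq mult_ac)
    qed
    have lam0: "0 \<le> lam n" using elim ln_ge_1[of n] unfolding lam_def rate_def[symmetric] by simp
    have "\<delta> n / (2 * \<theta>0\<^sup>2) * (real J * m h n / (\<gamma> ^ 3 * n) * (8 * lam n * sqrt n + 2 * \<delta> n * (real J * m h n)))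
        = (\<delta> n * m h n) * (real J / (2 * \<theta>0\<^sup>2 * \<gamma> ^ 3 * n)) * (8 * lam n * sqrt n + 2 * real J * (\<delta> n * m h n))"
      by (simp add: mult_ac)
    also have "\<dots> \<le> (2 * \<theta>0\<^sup>2 * h / \<delta> n) * (real J / (2 * \<theta>0\<^sup>2 * \<gamma> ^ 3 * n))
        * (8 * lam n * sqrt n + 2 * real J * (2 * \<theta>0\<^sup>2 * h / \<delta> n))"
      using am d lam0 gamma h by (intro mult_mono add_mono mult_left_mono mult_right_mono) auto
    also have "\<dots> = C / (\<delta> n * n) * (8 * lam n * sqrt n + 4 * \<theta>0\<^sup>2 * real J * h / \<delta> n)"
      using theta0 by (simp add: C_def mult_ac)
    also have "\<dots> = C * (8 * (lam n / (sqrt n * \<delta> n)) + 4 * \<theta>0\<^sup>2 * real J * h * (1 / (real n * (\<delta> n)\<^sup>2)))"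
    proof -
      have "lam n * sqrt n / (\<delta> n * n) = lam n / (sqrt n * \<delta> n)"
        using n by (simp add: divide_simps)
      moreover have "1 / (\<delta> n * n) * (1 / \<delta> n) = 1 / (real n * (\<delta> n)\<^sup>2)" by (simp add: power2_eq_square)
      moreover have "C / q * (8 * p + 4 * \<theta>0\<^sup>2 * real J * h / \<delta> n) = C * (8 * (p / q) + 4 * \<theta>0\<^sup>2 * real J * h * (1 / q * (1 / \<delta> n)))" for p q
        by (simp add: distrib_left add_divide_distrib)
      ultimately show ?thesis by (metis mult.assoc)
    qed
    finally show ?case using elim(1) by linarith
  qed
qed

text \<open>The first term bounds the probability of \<open>bad_linear\<close> at the horizon J h,
  the second that of \<open>bad_block\<close>. Half of \<eta> pays for \<open>bad_sqrt\<close>, half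
  for the weak convergence of the block sums.\<close>

lemma prob_scaled_eventually_le:
  fixes h \<epsilon> :: real and J :: nat
  assumes h: "0 < h" "h \<le> \<epsilon>" and J: "0 < J" and \<eta>: "0 < \<eta>"
    and S: "closed S"
  shows "\<forall>\<^sub>F n in sequentially. prob {\<omega> \<in> space M. scaled n \<omega> \<in> S}
    \<le> 8192 / (real J * h) + 24 * real J * eta4 * h\<^sup>2 / \<epsilon> ^ 4
      + almost_max_prob h J (6 * \<epsilon>) (near_grid S h J) + \<eta>"
proof -
  define A where "A = near_grid S h J"
  have A: "A \<subseteq> {..2 * J}" unfolding A_def by (rule near_grid_subset)
  have \<epsilon>: "0 < \<epsilon>" using h by simp
  have fdd: "\<forall>\<^sub>F n in sequentially. measure (Pi\<^sub>M {..<2 * J} (\<lambda>_. chisq_sum_law (m h n))) (almost_max (coef n (m h n) J) h J (6 * \<epsilon>) A)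
      \<le> almost_max_prob h J (6 * \<epsilon>) A + \<eta> / 2"
    unfolding almost_max_prob_def
  proof (rule weak_limit_product_closed)
    show "weak_conv_m (\<lambda>n. chisq_sum_law (m h n)) std_normal_distribution"
      by (rule chisq_sum_law_conv[OF m_at_top[OF h(1)]])
    show "\<forall>\<^sub>F n in sequentially. xs n \<notin> almost_max (coef n (m h n) J) h J (6 * \<epsilon>) A"
      if "x \<in> extensional {..<2 * J}" "\<And>i. i \<in> {..<2 * J} \<Longrightarrow> (\<lambda>n. xs n i) \<longlonglongrightarrow> x i" "x \<notin> almost_max (\<lambda>_. - sqrt h) h J (6 * \<epsilon>) A" for xs x
      using that by (intro almost_max_closed[OF coef_tendsto[OF h(1)] _ A]) auto
  qed (use \<eta> A almost_max_measurable real_distribution_chisq_sum_law real_dist_normal_dist in auto)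
  have ev1: "\<forall>\<^sub>F n in sequentially. 16 * \<theta>0\<^sup>2 * (1 + ln (real n)) / (lam n)\<^sup>2 < \<eta> / 2"
    using prob_bad_sqrt_tendsto \<eta> by (intro order_tendstoD) auto
  have ev2: "\<forall>\<^sub>F n in sequentially. \<theta>1 n < 2 * \<theta>0" "\<forall>\<^sub>F n in sequentially. \<theta>2 n < 2 * \<theta>0"
    using theta_lim theta0 by (auto intro!: order_tendstoD)
  have ev3: "\<forall>\<^sub>F n in sequentially. lam n / (sqrt (real n) * \<delta> n) < \<gamma> / 16"
    using lam_over_signal gamma by (intro order_tendstoD) auto
  have ev4: "\<forall>\<^sub>F n in sequentially. real J * a n < h / 2"
    using tendsto_mult[OF tendsto_const a_tendsto, of "real J"] h by (intro order_tendstoD) auto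
  have ev5: "\<forall>\<^sub>F n in sequentially. 1 / (real n * (\<delta> n)\<^sup>2) < \<gamma> / (4 * \<theta>0\<^sup>2 * real J * h)"
    using inverse_signal_square gamma theta0 J h by (intro order_tendstoD) auto
  show ?thesis
    using fdd ev1 ev2 ev3 ev4 ev5 ev_k0 ev_rate_pos ev_delta_pos ev_a_pos ev_expansion_error[OF h(1) J \<epsilon>]
  proof eventually_elim
    case (elim n)
    have n: "3 \<le> n" "0 < real n" "0 < n" "2 \<le> n" and d: "0 < \<delta> n" and a: "0 < a n" using elim by auto
    define \<kappa> where "\<kappa> = k0 n - J * m h n"
    define \<epsilon>' where "\<epsilon>' = 2 * \<theta>0\<^sup>2 * \<epsilon> / \<delta> n"
    have \<epsilon>': "0 < \<epsilon>'" using \<epsilon> d theta0 by (simp add: \<epsilon>'_def)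
    have am: "a n * m h n \<le> h" "h - a n \<le> a n * m h n" using m_bounds[OF h(1) a] by auto
    have a_small: "a n \<le> h / 2"
    proof -
      have "1 * a n \<le> real J * a n" using J a by (intro mult_right_mono) auto
      then show ?thesis using elim by linarith
    qed
    have am_half: "h / 2 \<le> a n * m h n" using am a_small by linarith
    have m0: "0 < m h n" using am_half h(1) by (cases "m h n") auto
    have gap: "real J * \<bar>a n * m h n - h\<bar> \<le> h"
    proof -
      have "real J * \<bar>a n * m h n - h\<bar> \<le> real J * a n" using am by (intro mult_left_mono) auto
      then show ?thesis using elim h by linarith
    qed
    have d2m: "(\<delta> n)\<^sup>2 * m h n \<le> 2 * \<theta>0\<^sup>2 * h" "\<theta>0\<^sup>2 * h \<le> (\<delta> n)\<^sup>2 * m h n"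
      using am(1) am_half theta0 by (simp_all add: a_def field_simps)
    have Jm: "real J * m h n \<le> \<gamma> * n / 2"
    proof -
      have *: "4 * \<theta>0\<^sup>2 * real J * h \<le> \<gamma> * (real n * (\<delta> n)\<^sup>2)"
        using elim n d theta0 J h by (simp add: divide_simps split: if_splits)
      have "2 * (real J * ((\<delta> n)\<^sup>2 * m h n)) \<le> \<gamma> * (real n * (\<delta> n)\<^sup>2)"
      proof -
        have "real J * (2 * \<theta>0\<^sup>2 * h) * 2 = 4 * \<theta>0\<^sup>2 * real J * h" by simp
        then show ?thesis
          using mult_left_mono[OF d2m(1) of_nat_0_le_iff[of J]] * by linarith
      qed
      then have "(2 * (real J * m h n)) * (\<delta> n)\<^sup>2 \<le> (\<gamma> * n) * (\<delta> n)\<^sup>2" by (simp add: mult_ac)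
      then show ?thesis using d by simp
    qed
    have gn: "0 < \<gamma> * n" using gamma n by simp
    have Jm_k0: "J * m h n \<le> k0 n"
    proof -
      have "real (J * m h n) \<le> real (k0 n)" unfolding of_nat_mult using Jm elim gn by linarith
      then show ?thesis by (simp only: of_nat_le_iff)
    qed
    have k0n: "k0 n < n" and \<kappa>_le: "\<kappa> + 2 * J * m h n \<le> n"
    proof -
      have "real (k0 n) < real n" using elim gn by linarith
      then show "k0 n < n" by simp
      have "real (k0 n) + real (J * m h n) \<le> real n" unfolding of_nat_mult using Jm elim gn by linarith
      then have "k0 n + J * m h n \<le> n" by (simp only: of_nat_le_iff flip: of_nat_add)
      then show "\<kappa> + 2 * J * m h n \<le> n" using Jm_k0 by (simp add: \<kappa>_def)
    qed
    have lam: "16 * lam n * sqrt n \<le> \<delta> n * sqrt (real (k0 n) * (real n - k0 n))"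
    proof -
      have "lam n \<le> \<gamma> / 16 * (sqrt n * \<delta> n)"
        using elim(5) n d by (simp add: pos_divide_less_eq)
      then have "16 * lam n * sqrt n \<le> 16 * (\<gamma> / 16 * (sqrt n * \<delta> n)) * sqrt n" by (intro mult_right_mono mult_left_mono) auto
      also have "\<dots> = \<delta> n * sqrt ((\<gamma> * n) * (\<gamma> * n))" using gn by simp
      also have "\<dots> \<le> \<delta> n * sqrt (real (k0 n) * (real n - k0 n))"
        using elim gn d by (intro mult_left_mono real_sqrt_le_mono mult_mono) auto
      finally show ?thesis .
    qed
    have lam_pos: "0 < lam n"
      using elim ln_ge_1[of n] unfolding lam_def rate_def[symmetric] by simp
    have B: "\<theta>1 n \<le> 2 * \<theta>0" "\<theta>2 n \<le> 2 * \<theta>0" using elim by auto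
    have Jm0: "0 < J * m h n" using J m0 by simp
    note sq = prob_bad_sqrt[OF n(3) B lam_pos]
    note li = prob_bad_linear[OF n(3) B d Jm0 k0n]
    note bl = prob_bad_block[OF n(3) B \<epsilon>' \<kappa>_le]
    let ?u = "\<lambda>\<omega>. \<lambda>l\<in>{..<2 * J}. block_sum n \<kappa> (m h n) l \<omega>"
    let ?D = "almost_max (coef n (m h n) J) h J (6 * \<epsilon>) A"
    have J2: "0 < 2 * J" using J by simp
    note law = block_sum_law[OF n(3) m0 J2, of \<kappa>]
    have D: "?D \<in> sets (Pi\<^sub>M {..<2 * J} (\<lambda>_. borel))" by (rule almost_max_measurable[OF A])
    have uD: "?u -` ?D \<inter> space M \<in> events" by (rule measurable_sets[OF law(2) D])
    have "{\<omega> \<in> space M. scaled n \<omega> \<in> S} \<subseteq> (bad_sqrt n \<union> bad_linear n (real (J * m h n)))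
        \<union> (bad_block n \<kappa> (m h n) (2 * J) \<epsilon>' \<union> (?u -` ?D \<inter> space M))"
    proof
      fix \<omega> assume \<omega>: "\<omega> \<in> {\<omega> \<in> space M. scaled n \<omega> \<in> S}"
      have "?u \<omega> \<in> ?D" if "\<omega> \<notin> bad_sqrt n" "\<omega> \<notin> bad_linear n (real (J * m h n))" "\<omega> \<notin> bad_block n \<kappa> (m h n) (2 * J) \<epsilon>'"
        unfolding A_def \<kappa>_def
      proof (rule snapshot[OF n(4) J h gamma])
        show "real J * \<bar>a n * real (m h n) - h\<bar> \<le> h" by (rule gap)
      qed (use elim d lam m0 Jm am(1) that \<omega> in \<open>simp_all add: \<kappa>_def \<epsilon>'_def scaled_def\<close>)
      then show "\<omega> \<in> (bad_sqrt n \<union> bad_linear n (real (J * m h n)))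
        \<union> (bad_block n \<kappa> (m h n) (2 * J) \<epsilon>' \<union> (?u -` ?D \<inter> space M))" using \<omega> by blast
    qed
    then have "prob {\<omega> \<in> space M. scaled n \<omega> \<in> S} \<le> prob ((bad_sqrt n \<union> bad_linear n (real (J * m h n)))
        \<union> (bad_block n \<kappa> (m h n) (2 * J) \<epsilon>' \<union> (?u -` ?D \<inter> space M)))"
      using sq(1) li(1) bl(1) uD by (intro finite_measure_mono) auto
    also have "\<dots> \<le> prob (bad_sqrt n \<union> bad_linear n (real (J * m h n))) + prob (bad_block n \<kappa> (m h n) (2 * J) \<epsilon>' \<union> (?u -` ?D \<inter> space M))"
      using sq(1) li(1) bl(1) uD by (intro measure_Un_le) auto
    also have "\<dots> \<le> (prob (bad_sqrt n) + prob (bad_linear n (real (J * m h n)))) + (prob (bad_block n \<kappa> (m h n) (2 * J) \<epsilon>') + prob (?u -` ?D \<inter> space M))"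
      using sq(1) li(1) bl(1) uD by (intro add_mono measure_Un_le) auto
    finally have main: "prob {\<omega> \<in> space M. scaled n \<omega> \<in> S} \<le> (prob (bad_sqrt n) + prob (bad_linear n (real (J * m h n))))
        + (prob (bad_block n \<kappa> (m h n) (2 * J) \<epsilon>') + prob (?u -` ?D \<inter> space M))" .
    have p1: "prob (bad_sqrt n) \<le> \<eta> / 2" using sq(2) elim(2) by linarith
    have p2: "prob (bad_linear n (real (J * m h n))) \<le> 8192 / (real J * h)"
    proof -
      have "real J * (\<theta>0\<^sup>2 * h) \<le> real J * ((\<delta> n)\<^sup>2 * m h n)" using d2m(2) by (intro mult_left_mono) auto
      then have le: "real J * h * \<theta>0\<^sup>2 \<le> real (J * m h n) * (\<delta> n)\<^sup>2" by (simp add: mult_ac)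
      have "prob (bad_linear n (real (J * m h n))) \<le> 8192 * \<theta>0\<^sup>2 / (real (J * m h n) * (\<delta> n)\<^sup>2)" using li(2) .
      also have "\<dots> \<le> 8192 * \<theta>0\<^sup>2 / (real J * h * \<theta>0\<^sup>2)"
      proof (rule divide_left_mono[OF le])
        have "0 < real (J * m h n)" using Jm0 by (simp only: of_nat_0_less_iff)
        then show "0 < real (J * m h n) * (\<delta> n)\<^sup>2 * (real J * h * \<theta>0\<^sup>2)"
          using J h theta0 d by (intro mult_pos_pos) auto
      qed simp
      also have "\<dots> = 8192 / (real J * h)" using theta0 by simp
      finally show ?thesis .
    qed
    have p3: "prob (bad_block n \<kappa> (m h n) (2 * J) \<epsilon>') \<le> 24 * real J * eta4 * h\<^sup>2 / \<epsilon> ^ 4"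
    proof -
      have e4: "0 \<le> eta4" using std_normal_eta_moments(3) by simp
      have eq: "48 * \<theta>0 ^ 4 * eta4 * (real (m h n))\<^sup>2 / \<epsilon>' ^ 4
          = 3 * eta4 * ((\<delta> n)\<^sup>2 * m h n)\<^sup>2 / (\<theta>0 ^ 4 * \<epsilon> ^ 4)"
        unfolding \<epsilon>'_def using theta0 d by (simp add: power_divide power_mult_distrib eval_nat_numeral mult_ac)
      also have "\<dots> \<le> 3 * eta4 * (2 * \<theta>0\<^sup>2 * h)\<^sup>2 / (\<theta>0 ^ 4 * \<epsilon> ^ 4)"
        using d2m(1) e4 theta0 \<epsilon> by (intro divide_right_mono mult_left_mono power_mono) auto
      also have "\<dots> = 12 * eta4 * h\<^sup>2 / \<epsilon> ^ 4"
        using theta0 by (simp add: power_mult_distrib eval_nat_numeral)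
      finally have "real (2 * J) * (48 * \<theta>0 ^ 4 * eta4 * (real (m h n))\<^sup>2 / \<epsilon>' ^ 4) \<le> real (2 * J) * (12 * eta4 * h\<^sup>2 / \<epsilon> ^ 4)"
        by (intro mult_left_mono) auto
      then show ?thesis using bl(2) by simp
    qed
    have p4: "prob (?u -` ?D \<inter> space M) \<le> almost_max_prob h J (6 * \<epsilon>) A + \<eta> / 2"
      using elim(1) measure_distr[OF law(2) D] unfolding law(1) by simp
    show ?case using main p1 p2 p3 p4 unfolding A_def by linarith
  qed
qed

end

text \<open>Portmanteau and Slutsky in one: left half-lines bound the distribution function from
  above, right half-lines bound its complement, and both are enlarged by \<rho> to allow for the
  distance of \<open>Y n\<close> from \<open>U n\<close>.\<close>

lemma weak_conv_m_if_closed_limsup: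
  fixes U Y :: "nat \<Rightarrow> 'a \<Rightarrow> real" and V :: "'b \<Rightarrow> real"
  assumes M: "prob_space M" and N: "prob_space N"
    and U: "\<And>n. U n \<in> borel_measurable M" and Y: "\<And>n. Y n \<in> borel_measurable M" and V: "V \<in> borel_measurable N"
    and limsup: "\<And>S e. closed S \<Longrightarrow> 0 < e \<Longrightarrow>
      \<forall>\<^sub>F n in sequentially. measure M {\<omega> \<in> space M. U n \<omega> \<in> S} \<le> measure N (V -` S \<inter> space N) + e"
    and close: "\<And>\<rho> e. 0 < \<rho> \<Longrightarrow> 0 < e \<Longrightarrow> \<forall>\<^sub>F n in sequentially. measure M {\<omega> \<in> space M. \<rho> < \<bar>Y n \<omega> - U n \<omega>\<bar>} \<le> e"
  shows "weak_conv_m (\<lambda>n. distr M borel (Y n)) (distr N borel V)"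
  unfolding weak_conv_m_def weak_conv_def
proof (intro allI impI)
  interpret M: prob_space M by fact
  interpret N: prob_space N by fact
  define F where "F = cdf (distr N borel V)"
  have F: "F x = N.prob (V -` {..x} \<inter> space N)" for x
    unfolding F_def cdf_def using V by (subst measure_distr) auto
  fix x assume "isCont (cdf (distr N borel V)) x"
  then have cont: "isCont F x" by (simp add: F_def)
  have cdf_Y: "cdf (distr M borel (Y n)) x = M.prob {\<omega> \<in> space M. Y n \<omega> \<le> x}" for n
    unfolding cdf_def using Y[of n] by (subst measure_distr) (auto simp: vimage_def Int_def conj_commute)
  have meas: "{\<omega> \<in> space M. U n \<omega> \<in> S} \<in> M.events" if "closed S" for S n
    using measurable_sets[OF U[of n] borel_closed[OF that]] by (simp add: vimage_def Int_def conj_commute)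
  have measD: "{\<omega> \<in> space M. \<rho> < \<bar>Y n \<omega> - U n \<omega>\<bar>} \<in> M.events" for \<rho> n
    using U[of n] Y[of n] by measurable
  have "\<forall>\<^sub>F n in sequentially. \<bar>M.prob {\<omega> \<in> space M. Y n \<omega> \<le> x} - F x\<bar> < e" if e: "0 < e" for e
  proof -
    have e4: "0 < e / 4" using e by simp
    from cont[unfolded continuous_at_eps_delta dist_real_def, rule_format, OF e4]
    obtain d where d: "0 < d" "\<And>z. \<bar>z - x\<bar> < d \<Longrightarrow> \<bar>F z - F x\<bar> < e / 4" by blast
    \<comment> \<open>A third of \<open>d\<close>, because the lower bound needs the point
      \<open>x - 2 * \<rho>\<close>: the half-line from \<open>x - \<rho>\<close> on is closed and
      must avoid the one up to that point.\<close>
    define \<rho> where "\<rho> = d / 3"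
    have \<rho>: "0 < \<rho>" using d by (simp add: \<rho>_def)
    have F_near: "\<bar>F (x + \<rho>) - F x\<bar> < e / 4" "\<bar>F (x - 2 * \<rho>) - F x\<bar> < e / 4"
    proof -
      have "\<bar>x + \<rho> - x\<bar> < d" "\<bar>x - 2 * \<rho> - x\<bar> < d" using d(1) by (simp_all add: \<rho>_def)
      from this[THEN d(2)] show "\<bar>F (x + \<rho>) - F x\<bar> < e / 4" "\<bar>F (x - 2 * \<rho>) - F x\<bar> < e / 4" .
    qed
    have up: "N.prob (V -` {..x + \<rho>} \<inter> space N) < F x + e / 4"
      using F_near(1) unfolding F[symmetric] by linarith
    have low: "N.prob (V -` {x - \<rho>..} \<inter> space N) < 1 - F x + e / 4"
    proof -
      have "N.prob (V -` {x - \<rho>..} \<inter> space N) \<le> N.prob (space N - (V -` {..x - 2 * \<rho>} \<inter> space N))"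
        using V \<rho> by (intro N.finite_measure_mono) auto
      also have "\<dots> = 1 - F (x - 2 * \<rho>)"
        unfolding F using V by (subst N.prob_compl) auto
      also have "\<dots> < 1 - F x + e / 4"
        using F_near(2) by linarith
      finally show ?thesis .
    qed
    show ?thesis
      using limsup[OF closed_atMost e4, of "x + \<rho>"] limsup[OF closed_atLeast e4, of "x - \<rho>"] close[OF \<rho> e4]
    proof eventually_elim
      case (elim n)
      let ?D = "{\<omega> \<in> space M. \<rho> < \<bar>Y n \<omega> - U n \<omega>\<bar>}"
      have "M.prob {\<omega> \<in> space M. Y n \<omega> \<le> x} \<le> M.prob ({\<omega> \<in> space M. U n \<omega> \<in> {..x + \<rho>}} \<union> ?D)"
        using meas[of "{..x + \<rho>}" n] measD[of \<rho> n] by (intro M.finite_measure_mono) (auto simp: not_less abs_le_iff)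
      also have "\<dots> \<le> M.prob {\<omega> \<in> space M. U n \<omega> \<in> {..x + \<rho>}} + M.prob ?D"
        using meas[of "{..x + \<rho>}" n] measD[of \<rho> n] by (intro measure_Un_le) auto
      finally have 1: "M.prob {\<omega> \<in> space M. Y n \<omega> \<le> x} < F x + 3 * e / 4" using elim up by linarith
      have "M.prob (space M - {\<omega> \<in> space M. Y n \<omega> \<le> x}) \<le> M.prob ({\<omega> \<in> space M. U n \<omega> \<in> {x - \<rho>..}} \<union> ?D)"
        using meas[of "{x - \<rho>..}" n] measD[of \<rho> n] by (intro M.finite_measure_mono) (auto simp: not_less abs_le_iff)
      also have "\<dots> \<le> M.prob {\<omega> \<in> space M. U n \<omega> \<in> {x - \<rho>..}} + M.prob ?D"
        using meas[of "{x - \<rho>..}" n] measD[of \<rho> n] by (intro measure_Un_le) auto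
      finally have "1 - M.prob {\<omega> \<in> space M. Y n \<omega> \<le> x} < 1 - F x + 3 * e / 4"
        using elim low Y[of n] by (subst (asm) M.prob_compl) (auto simp: borel_measurable_le)
      with 1 show ?case using e by (simp add: abs_less_iff)
    qed
  qed
  then show "(\<lambda>n. cdf (distr M borel (Y n)) x) \<longlonglongrightarrow> cdf (distr N borel V) x"
    unfolding cdf_Y F_def[symmetric] tendsto_iff dist_real_def by blast
qed

lemma (in euler_change_model) prob_scaled_limsup:
  assumes B: "two_sided_bm N W1 W2"
    and V: "V \<in> borel_measurable N" "AE \<omega> in N. peaked (\<lambda>v. two_sided_bm.G W1 W2 v \<omega>) (V \<omega>)"
    and S: "closed S" and e: "0 < e"
  shows "\<forall>\<^sub>F n in sequentially. prob {\<omega> \<in> space M. scaled n \<omega> \<in> S} \<le> measure N (V -` S \<inter> space N) + e"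
proof -
  interpret B: two_sided_bm N W1 W2 by fact
  \<comment> \<open>With mesh \<open>Q\<^sup>-\<^sup>6\<close>, slack \<open>6 / Q\<close> and horizon \<open>J h = Q\<close>, both error terms of
    \<open>prob_scaled_eventually_le\<close> are of order \<open>1 / Q\<close>.\<close>
  define Q where "Q q = real (Suc q)" for q
  define h where "h q = 1 / Q q ^ 6" for q
  define \<epsilon> where "\<epsilon> q = 1 / Q q" for q
  define J where "J q = Suc q ^ 7" for q :: nat
  have Q: "1 \<le> Q q" "0 < Q q" for q by (simp_all add: Q_def)
  have invQ: "(\<lambda>q. 1 / Q q) \<longlonglongrightarrow> 0"
    using LIMSEQ_inverse_real_of_nat by (simp add: Q_def inverse_eq_divide)
  have Jr: "real (J q) = Q q ^ 7" for q by (simp add: J_def Q_def)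
  have Jh: "real (J q) * h q = Q q" for q
    using Q[of q] by (simp add: Jr h_def eval_nat_numeral)
  have h0: "0 < h q" "h q \<le> \<epsilon> q" for q
    using Q[of q] power_increasing[of 1 6 "Q q"] by (simp_all add: h_def \<epsilon>_def frac_le)
  have mod: "real (J q) * (h q)\<^sup>2 / \<epsilon> q ^ 4 = 1 / Q q" for q
    using Q[of q] by (simp add: Jr h_def \<epsilon>_def eval_nat_numeral field_simps)
  have h_lim: "h \<longlonglongrightarrow> 0"
  proof (rule tendsto_sandwich[OF _ _ tendsto_const invQ])
    show "\<forall>\<^sub>F q in sequentially. 0 \<le> h q" "\<forall>\<^sub>F q in sequentially. h q \<le> 1 / Q q"
      using h0 less_imp_le unfolding \<epsilon>_def by (auto intro!: always_eventually)
  qed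
  have \<epsilon>_lim: "(\<lambda>q. 6 * \<epsilon> q) \<longlonglongrightarrow> 0"
    using tendsto_mult[OF tendsto_const invQ, of 6] by (simp add: \<epsilon>_def)
  have K: "filterlim (\<lambda>q. real (J q) * h q) at_top sequentially"
    unfolding Jh Q_def by (rule filterlim_compose[OF filterlim_real_sequentially filterlim_Suc])
  have e3: "0 < e / 3" using e by simp
  have J0: "0 < J q" for q by (simp add: J_def)
  have "(\<lambda>q. (8192 + 24 * eta4) * (1 / Q q)) \<longlonglongrightarrow> (8192 + 24 * eta4) * 0"
    by (intro tendsto_mult tendsto_const invQ)
  then have "\<forall>\<^sub>F q in sequentially. (8192 + 24 * eta4) * (1 / Q q) < e / 3"
    using e3 by (intro order_tendstoD) auto
  with B.almost_max_limit[OF V S h_lim h0(1) \<epsilon>_lim J0 K e3]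
  have "\<forall>\<^sub>F q in sequentially. almost_max_prob (h q) (J q) (6 * \<epsilon> q) (near_grid S (h q) (J q)) \<le> measure N (V -` S \<inter> space N) + e / 3 \<and> (8192 + 24 * eta4) * (1 / Q q) < e / 3"
    by (rule eventually_conj)
  \<comment> \<open>The mesh is fixed here, before \<open>n\<close> tends to infinity.\<close>
  then obtain q where q: "almost_max_prob (h q) (J q) (6 * \<epsilon> q) (near_grid S (h q) (J q)) \<le> measure N (V -` S \<inter> space N) + e / 3" "(8192 + 24 * eta4) * (1 / Q q) < e / 3"
    using eventually_happens'[OF sequentially_bot] by blast
  have const: "8192 / (real (J q) * h q) + 24 * real (J q) * eta4 * (h q)\<^sup>2 / \<epsilon> q ^ 4 = (8192 + 24 * eta4) * (1 / Q q)"
  proof -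
    have "24 * real (J q) * eta4 * (h q)\<^sup>2 / \<epsilon> q ^ 4 = 24 * eta4 * (real (J q) * (h q)\<^sup>2 / \<epsilon> q ^ 4)" by simp
    then show ?thesis unfolding mod Jh by (simp add: distrib_right add_divide_distrib)
  qed
  show ?thesis
    using prob_scaled_eventually_le[OF h0 J0 e3 S, of q q]
    by (rule eventually_mono) (use q const in linarith)
qed

text \<open>The normalised estimator is
  \<open>\<theta>0\<^sup>2 / (\<theta>t n \<omega>)\<^sup>2\<close> times a centred version of
  \<open>scaled\<close>. The ratio tends to 1 in probability, and \<open>prob_scaled_limsup\<close>
  for the closed sets |v| \<ge> R supplies the tightness that makes the product error small.\<close>

lemma (in euler_change_model) normalised_estimator_close:
  assumes B: "two_sided_bm N W1 W2"
    and V: "V \<in> borel_measurable N" "AE \<omega> in N. peaked (\<lambda>v. two_sided_bm.G W1 W2 v \<omega>) (V \<omega>)"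
    and meas: "\<And>n. \<theta>t n \<in> borel_measurable M"
    and cons: "tendsto_zero_in_prob M (\<lambda>n \<omega>. \<theta>t n \<omega> - \<theta>1 n) \<or> tendsto_zero_in_prob M (\<lambda>n \<omega>. \<theta>t n \<omega> - \<theta>2 n)"
    and \<rho>: "0 < \<rho>" and e: "0 < e"
  shows "\<forall>\<^sub>F n in sequentially. prob {\<omega> \<in> space M. \<rho> <
      \<bar>real n * (\<delta> n)\<^sup>2 * (real (k_hat n \<omega>) / real n - \<tau>) / (2 * (\<theta>t n \<omega>)\<^sup>2) - scaled n \<omega>\<bar>} \<le> e"
proof -
  interpret B: two_sided_bm N W1 W2 by fact
  have "\<exists>R::nat. B.B1.prob (V -` {v. real R \<le> \<bar>v\<bar>} \<inter> space N) < e / 3"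
  proof -
    have "(\<lambda>R::nat. B.B1.prob (V -` {v. real R \<le> \<bar>v\<bar>} \<inter> space N)) \<longlonglongrightarrow> B.B1.prob (\<Inter>R. V -` {v. real R \<le> \<bar>v\<bar>} \<inter> space N)"
    proof (rule B.B1.finite_Lim_measure_decseq)
      have "closed {v. real R \<le> \<bar>v\<bar>}" for R by (intro closed_Collect_le continuous_intros)
      then show "range (\<lambda>R. V -` {v. real R \<le> \<bar>v\<bar>} \<inter> space N) \<subseteq> sets N"
        using V(1) by (auto intro!: measurable_sets[OF V(1)] borel_closed)
      show "decseq (\<lambda>R. V -` {v. real R \<le> \<bar>v\<bar>} \<inter> space N)" by (force simp: decseq_def)
    qed
    moreover have "(\<Inter>R. V -` {v. real R \<le> \<bar>v\<bar>} \<inter> space N) = {}"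
    proof (rule equals0I)
      fix \<omega> assume "\<omega> \<in> (\<Inter>R. V -` {v. real R \<le> \<bar>v\<bar>} \<inter> space N)"
      then have "real R \<le> \<bar>V \<omega>\<bar>" for R by blast
      moreover obtain R :: nat where "\<bar>V \<omega>\<bar> < real R" using reals_Archimedean2 by blast
      ultimately show False using not_le by blast
    qed
    ultimately have "\<forall>\<^sub>F R in sequentially. B.B1.prob (V -` {v. real R \<le> \<bar>v\<bar>} \<inter> space N) < e / 3"
      using e by (intro order_tendstoD) auto
    then show ?thesis by (rule eventually_happens'[OF sequentially_bot])
  qed
  then obtain R :: nat where R: "B.B1.prob (V -` {v. real R \<le> \<bar>v\<bar>} \<inter> space N) < e / 3" by blast
  have closedR: "closed {v. real R \<le> \<bar>v\<bar>}" by (intro closed_Collect_le continuous_intros)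
  have e3: "0 < e / 3" using e by simp
  \<comment> \<open>Half of \<rho> is for the ratio error times a position of size at most R + 1;
    the other half is for the rounding in \<open>k0\<close>.\<close>
  define \<kappa> where "\<kappa> = \<rho> / (2 * (real R + 1))"
  have \<kappa>: "0 < \<kappa>" using \<rho> by (simp add: \<kappa>_def)
  have "isCont (\<lambda>x. \<theta>0\<^sup>2 / x\<^sup>2) \<theta>0" using theta0 by (intro continuous_intros) auto
  from this[unfolded continuous_at_eps_delta dist_real_def, rule_format, OF \<kappa>]
  obtain d where d: "0 < d" "\<And>x. \<bar>x - \<theta>0\<bar> < d \<Longrightarrow> \<bar>\<theta>0\<^sup>2 / x\<^sup>2 - 1\<bar> < \<kappa>"
    using theta0 by auto
  have tilde: "\<forall>\<^sub>F n in sequentially. prob {\<omega> \<in> space M. d \<le> \<bar>\<theta>t n \<omega> - \<theta>0\<bar>} \<le> e / 3"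
  proof -
    obtain \<theta> where \<theta>: "tendsto_zero_in_prob M (\<lambda>n \<omega>. \<theta>t n \<omega> - \<theta> n)" "\<theta> \<longlonglongrightarrow> \<theta>0"
      using cons theta_lim by blast
    have "(\<lambda>n. prob {\<omega> \<in> space M. d / 2 < \<bar>\<theta>t n \<omega> - \<theta> n\<bar>}) \<longlonglongrightarrow> 0"
      using \<theta>(1)[unfolded tendsto_zero_in_prob_def, rule_format, of "d / 2"] d(1) by simp
    then have "\<forall>\<^sub>F n in sequentially. prob {\<omega> \<in> space M. d / 2 < \<bar>\<theta>t n \<omega> - \<theta> n\<bar>} < e / 3"
      using e3 by (intro order_tendstoD) auto
    moreover have "\<forall>\<^sub>F n in sequentially. \<bar>\<theta> n - \<theta>0\<bar> < d / 2"
      using tendstoD[OF \<theta>(2), of "d / 2"] d(1) unfolding dist_real_def by simp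
    ultimately show ?thesis
    proof eventually_elim
      case (elim n)
      have m: "{\<omega> \<in> space M. d / 2 < \<bar>\<theta>t n \<omega> - \<theta> n\<bar>} \<in> events" using meas[of n] by measurable
      have s: "{\<omega> \<in> space M. d \<le> \<bar>\<theta>t n \<omega> - \<theta>0\<bar>} \<subseteq> {\<omega> \<in> space M. d / 2 < \<bar>\<theta>t n \<omega> - \<theta> n\<bar>}"
      proof safe
        fix \<omega> assume "d \<le> \<bar>\<theta>t n \<omega> - \<theta>0\<bar>"
        then show "d / 2 < \<bar>\<theta>t n \<omega> - \<theta> n\<bar>" using elim(2) by linarith
      qed
      show ?case using finite_measure_mono[OF s m] elim(1) by linarith
    qed
  qed
  have a_small: "\<forall>\<^sub>F n in sequentially. a n < min 1 (\<rho> / 2)"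
    using a_tendsto \<rho> by (intro order_tendstoD) auto
  show ?thesis
    using tilde prob_scaled_limsup[OF B V closedR e3] a_small ev_a_pos eventually_gt_at_top[of 0]
  proof eventually_elim
    case (elim n)
    let ?Y = "\<lambda>\<omega>. real n * (\<delta> n)\<^sup>2 * (real (k_hat n \<omega>) / real n - \<tau>) / (2 * (\<theta>t n \<omega>)\<^sup>2)"
    let ?A = "{\<omega> \<in> space M. d \<le> \<bar>\<theta>t n \<omega> - \<theta>0\<bar>}" and ?B = "{\<omega> \<in> space M. scaled n \<omega> \<in> {v. real R \<le> \<bar>v\<bar>}}"
    have A: "?A \<in> events" using meas[of n] by measurable
    have Bm: "?B \<in> events"
      using measurable_sets[OF scaled_measurable[of n] borel_closed[OF closedR]] by (simp add: vimage_def Int_def conj_commute)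
    have "{\<omega> \<in> space M. \<rho> < \<bar>?Y \<omega> - scaled n \<omega>\<bar>} \<subseteq> ?A \<union> ?B"
    proof (rule subsetI, rule ccontr)
      fix \<omega> assume \<omega>: "\<omega> \<in> {\<omega> \<in> space M. \<rho> < \<bar>?Y \<omega> - scaled n \<omega>\<bar>}" "\<omega> \<notin> ?A \<union> ?B"
      then have near: "\<bar>\<theta>t n \<omega> - \<theta>0\<bar> < d" and u: "\<bar>scaled n \<omega>\<bar> < real R" by auto
      define r where "r = \<theta>0\<^sup>2 / (\<theta>t n \<omega>)\<^sup>2"
      \<comment> \<open>Centred at n \<tau> rather than at its integer part; after scaling the two
        differ by at most \<open>a n\<close>.\<close>
      define w where "w = a n * (real (k_hat n \<omega>) - real n * \<tau>)"
      have r: "\<bar>r - 1\<bar> < \<kappa>" unfolding r_def by (rule d(2)[OF near])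
      have Y: "?Y \<omega> = r * w"
      proof -
        have eq: "real n * (\<delta> n)\<^sup>2 * (real (k_hat n \<omega>) / real n - \<tau>) = (\<delta> n)\<^sup>2 * (real (k_hat n \<omega>) - real n * \<tau>)"
          using elim(5) by (simp add: right_diff_distrib)
        show ?thesis unfolding eq r_def w_def a_def using theta0 by simp
      qed
      have "w - scaled n \<omega> = a n * (real (k0 n) - real n * \<tau>)" by (simp add: w_def scaled_def algebra_simps)
      moreover have "\<bar>real (k0 n) - real n * \<tau>\<bar> \<le> 1" using k0_bounds[of n] by linarith
      ultimately have wu: "\<bar>w - scaled n \<omega>\<bar> \<le> a n" using elim(4) mult_left_mono[of _ 1 "a n"] by (simp add: abs_mult)
      then have w: "\<bar>w\<bar> \<le> real R + 1" using u elim(3) by linarith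
      have "\<bar>(r - 1) * w\<bar> \<le> \<kappa> * (real R + 1)" unfolding abs_mult using r w by (intro mult_mono) auto
      also have "\<dots> = \<rho> / 2" by (simp add: \<kappa>_def divide_simps)
      finally have "\<bar>(r - 1) * w\<bar> \<le> \<rho> / 2" .
      moreover have "?Y \<omega> - scaled n \<omega> = (r - 1) * w + (w - scaled n \<omega>)" unfolding Y by (simp add: algebra_simps)
      ultimately have "\<bar>?Y \<omega> - scaled n \<omega>\<bar> \<le> \<rho>" using wu elim(3) by linarith
      then show False using \<omega>(1) by simp
    qed
    then have "prob {\<omega> \<in> space M. \<rho> < \<bar>?Y \<omega> - scaled n \<omega>\<bar>} \<le> prob (?A \<union> ?B)" using A Bm by (intro finite_measure_mono) auto
    also have "\<dots> \<le> prob ?A + prob ?B" using A Bm by (rule measure_Un_le)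
    finally show ?case using elim(1,2) R by linarith
  qed
qed

theorem theorem3p3:
  fixes M :: "'a measure" and W :: "real \<Rightarrow> 'a \<Rightarrow> real"
    and N :: "'b measure" and W1 W2 :: "real \<Rightarrow> 'b \<Rightarrow> real"
    and l r :: ereal and x\<^sub>0 T \<tau>\<^sub>0 \<theta>\<^sub>0 :: real and b \<sigma> :: "real \<Rightarrow> real"
    and \<Theta> :: "real set" and \<theta>\<^sub>1 \<theta>\<^sub>2 \<Delta> :: "nat \<Rightarrow> real"
    and X :: "nat \<Rightarrow> nat \<Rightarrow> 'a \<Rightarrow> real"
    and k_hat :: "nat \<Rightarrow> 'a \<Rightarrow> nat" and \<theta>_tilde :: "nat \<Rightarrow> 'a \<Rightarrow> real"
  assumes BM: "standard_brownian_motion M W"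
    and coeffs: "diffusion_coefficients l r x\<^sub>0 b \<sigma>"
    and T: "0 < T" and Delta: "\<And>n. 0 < n \<Longrightarrow> real n * \<Delta> n = T" and Delta_lim: "\<Delta> \<longlonglongrightarrow> 0"
    and tau: "0 < \<tau>\<^sub>0" "\<tau>\<^sub>0 < 1"
    and Theta: "compact \<Theta>" "\<Theta> \<subseteq> {0<..}"
    and theta_in: "\<And>n. \<theta>\<^sub>1 n \<in> \<Theta>" "\<And>n. \<theta>\<^sub>2 n \<in> \<Theta>"
    and theta_lim: "\<theta>\<^sub>1 \<longlonglongrightarrow> \<theta>\<^sub>0" "\<theta>\<^sub>2 \<longlonglongrightarrow> \<theta>\<^sub>0"
    and jump_lim: "(\<lambda>n. \<theta>\<^sub>2 n - \<theta>\<^sub>1 n) \<longlonglongrightarrow> 0"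
    and jump_rate: "filterlim (\<lambda>n. sqrt (real n) * (\<theta>\<^sub>2 n - \<theta>\<^sub>1 n) / sqrt (ln (real n))) at_top sequentially"
    and euler: "\<And>n \<omega>. \<omega> \<in> space M \<Longrightarrow>
          euler_scheme b \<sigma> x\<^sub>0 (\<Delta> n) (\<lambda>i. if i \<le> change_index \<tau>\<^sub>0 n then \<theta>\<^sub>1 n else \<theta>\<^sub>2 n) n
            (\<lambda>t. W t \<omega>) (\<lambda>i. X n i \<omega>)"
    and k_hat_measurable: "\<And>n. k_hat n \<in> measurable M (count_space UNIV)"
    and k_hat: "\<And>n \<omega>. 2 \<le> n \<Longrightarrow> \<omega> \<in> space M \<Longrightarrow>
          least_squares_change_point (normalised_increment b \<sigma> (\<Delta> n) (\<lambda>i. X n i \<omega>)) n (k_hat n \<omega>)"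
    and theta_tilde_measurable: "\<And>n. \<theta>_tilde n \<in> borel_measurable M"
    and theta_tilde_consistent:
          "tendsto_zero_in_prob M (\<lambda>n \<omega>. \<theta>_tilde n \<omega> - \<theta>\<^sub>1 n) \<or>
           tendsto_zero_in_prob M (\<lambda>n \<omega>. \<theta>_tilde n \<omega> - \<theta>\<^sub>2 n)"
    and BM1: "standard_brownian_motion N W1" and BM2: "standard_brownian_motion N W2"
    and indep: "indep_processes N W1 W2"
  shows "\<exists>V \<in> borel_measurable N.
           (AE \<omega> in N. \<forall>v. is_arg_max (\<lambda>v. two_sided W1 W2 v \<omega> - \<bar>v\<bar> / 2) (\<lambda>_. True) v
                            \<longleftrightarrow> v = V \<omega>) \<and>
           weak_conv_m
             (\<lambda>n. distr M borel (\<lambda>\<omega>. real n * (\<theta>\<^sub>2 n - \<theta>\<^sub>1 n)\<^sup>2 * (real (k_hat n \<omega>) / real n - \<tau>\<^sub>0)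
                                        / (2 * (\<theta>_tilde n \<omega>)\<^sup>2)))
             (distr N borel V)"
proof -
  interpret W: standard_brownian_motion M W by fact
  interpret W1: standard_brownian_motion N W1 by fact
  interpret W2: standard_brownian_motion N W2 by fact
  interpret L: two_sided_bm N W1 W2 by unfold_locales (fact indep)
  \<comment> \<open>Compactness keeps the limit away from 0, so that dividing by its square makes
    sense.\<close>
  have "\<theta>\<^sub>0 \<in> \<Theta>"
    using closed_sequentially[OF compact_imp_closed[OF Theta(1)] _ theta_lim(1)] theta_in(1) by blast
  then have theta0: "0 < \<theta>\<^sub>0" using Theta(2) by auto
  have theta_pos: "0 < \<theta>\<^sub>1 n" "0 < \<theta>\<^sub>2 n" for n using theta_in[of n] Theta(2) by auto
  interpret C: euler_change_model M W b \<sigma> x\<^sub>0 T \<tau>\<^sub>0 \<theta>\<^sub>0 \<theta>\<^sub>1 \<theta>\<^sub>2 \<Delta> X k_hat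
  proof
    show "0 < \<sigma> x" for x using coeffs by (simp add: diffusion_coefficients_def)
  qed (fact T Delta tau theta0 theta_pos theta_lim jump_rate euler k_hat_measurable k_hat)+
  obtain V where V: "V \<in> borel_measurable N" "AE \<omega> in N. peaked (\<lambda>v. L.G v \<omega>) (V \<omega>)"
    using L.argmax_measurable by blast
  define Y where "Y n \<omega> = real n * (C.\<delta> n)\<^sup>2 * (real (k_hat n \<omega>) / real n - \<tau>\<^sub>0) / (2 * (\<theta>_tilde n \<omega>)\<^sup>2)" for n \<omega>
  have Y: "Y n \<in> borel_measurable M" for n
  proof -
    have "(\<lambda>\<omega>. real (k_hat n \<omega>)) \<in> borel_measurable M"
      using measurable_compose[OF k_hat_measurable[of n], of real borel] by simp
    then show ?thesis unfolding Y_def[abs_def] using theta_tilde_measurable[of n] by measurable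
  qed
  have "weak_conv_m (\<lambda>n. distr M borel (Y n)) (distr N borel V)"
  proof (rule weak_conv_m_if_closed_limsup[OF W.prob_space_axioms W1.prob_space_axioms C.scaled_measurable Y V(1)])
    show "\<forall>\<^sub>F n in sequentially. measure M {\<omega> \<in> space M. C.scaled n \<omega> \<in> S} \<le> measure N (V -` S \<inter> space N) + e"
      if "closed S" "0 < e" for S e
      by (rule C.prob_scaled_limsup[OF L.two_sided_bm_axioms V that])
    show "\<forall>\<^sub>F n in sequentially. measure M {\<omega> \<in> space M. \<rho> < \<bar>Y n \<omega> - C.scaled n \<omega>\<bar>} \<le> e"
      if "0 < \<rho>" "0 < e" for \<rho> e
      unfolding Y_def
      by (rule C.normalised_estimator_close[OF L.two_sided_bm_axioms V theta_tilde_measurable theta_tilde_consistent that])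
  qed
  moreover have "AE \<omega> in N. \<forall>v. is_arg_max (\<lambda>v. two_sided W1 W2 v \<omega> - \<bar>v\<bar> / 2) (\<lambda>_. True) v \<longleftrightarrow> v = V \<omega>"
    using V(2)
  proof eventually_elim
    case (elim \<omega>)
    interpret peaked "\<lambda>v. L.G v \<omega>" "V \<omega>" by fact
    show ?case
      using max unique unfolding L.G_def is_arg_max_def by (metis not_less order_antisym)
  qed
  ultimately show ?thesis using V(1) unfolding Y_def[abs_def] C.\<delta>_def by blast
qed

end
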